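(* Let $D\subset(0,\infty)\times(0,\infty)$ be nonempty. Assume that there are positive lower and upper a priori bounds for positive smooth solutions of the stationary system which are uniform for $(d_1,d_2)\in D$; that is, there exist constants $0<\alpha\le\beta<\infty$ such that for every $(d_1,d_2)\in D$ every positive smooth solution $(u,v)$ satisfies $\alpha\le u,v\le\beta$ in $\overline\Omega$. Then there exists a positive constant $C$ such that for any $(d_1,d_2)\in D$ satisfying $d_1\ge C$, $(u,v)\equiv(u^*,v^* )$ is the only positive smooth solution of the stationary system.
   Context: $\Omega\subset\mathbb{R}^n$, $n\ge1$, is a bounded smooth domain with unit outer normal $\nu$ on $\partial\Omega$; $d_1,d_2>0$; $\sigma\ge0$ is a constant; $p,q,r,s\ge0$ satisfy $0<\frac{p-1}{r}<\frac{q}{s+1}$. The quantities $\Omega,p,q,r,s,\sigma$ are fixed. The stationary system is $$d_1\Delta u-u+\frac{u^p}{v^q}+\sigma=0,\quad d_2\Delta v-v+\frac{u^r}{v^s}=0\ \text{ in }\Omega,\qquad \frac{\partial u}{\partial\nu}=\frac{\partial v}{\partial\nu}=0\ \text{ on }\partial\Omega.$$ A positive smooth solution is a pair $u,v\in C^\infty(\overline\Omega)$ with $u,v>0$ in $\overline\Omega$ solving it. $(u^*,v^* )$ denotes the unique constant positive solution of the stationary system. *)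

theory Defs
  imports "HOL-Analysis.Analysis"
begin

definition partial_derivative :: "'n::finite \<Rightarrow> (real ^ 'n \<Rightarrow> real) \<Rightarrow> real ^ 'n \<Rightarrow> real" where
  "partial_derivative i f x = frechet_derivative f (at x) (axis i 1)"

text \<open>Multi-indices are given as lists of coordinate directions.\<close>

primrec iterated_partial :: "'n::finite list \<Rightarrow> (real ^ 'n \<Rightarrow> real) \<Rightarrow> real ^ 'n \<Rightarrow> real" where
  "iterated_partial [] f = f"
| "iterated_partial (i # js) f = partial_derivative i (iterated_partial js f)"

definition laplacian :: "(real ^ 'n \<Rightarrow> real) \<Rightarrow> real ^ 'n::finite \<Rightarrow> real" where
  "laplacian f x = (\<Sum>i\<in>UNIV. iterated_partial [i, i] f x)"

text \<open>Intended for open \<open>S\<close>. Requiring every iterate to be differentiable guarantees that the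
  (otherwise unspecified) values of \<^const>\<open>frechet_derivative\<close> at points of \<open>S\<close> are genuine.\<close>

definition smooth_on :: "(real ^ 'n::finite) set \<Rightarrow> (real ^ 'n \<Rightarrow> real) \<Rightarrow> bool" where
  "smooth_on S f \<longleftrightarrow> (\<forall>js. \<forall>x\<in>S. iterated_partial js f differentiable (at x))"

text \<open>The space \<open>C\<^sup>\<infinity>\<close> of the closure of an open set \<open>\<Omega>\<close>: all partial derivatives in \<open>\<Omega>\<close> have
  continuous extensions to the closure, and the values of \<open>f\<close> on the boundary are those of the
  extension. Values of \<open>f\<close> outside the closure are irrelevant.\<close>

definition smooth_up_to_boundary :: "(real ^ 'n::finite) set \<Rightarrow> (real ^ 'n \<Rightarrow> real) \<Rightarrow> bool" where
  "smooth_up_to_boundary \<Omega> f \<longleftrightarrow>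
     smooth_on \<Omega> f \<and> continuous_on (closure \<Omega>) f \<and>
     (\<forall>js. \<exists>g. continuous_on (closure \<Omega>) g \<and> (\<forall>x\<in>\<Omega>. g x = iterated_partial js f x))"

text \<open>Near \<open>x\<^sub>0\<close>, the set \<open>\<Omega>\<close> is the strict epigraph, in direction \<open>\<epsilon> \<cdot> axis i 1\<close>, of a smooth
  function \<open>\<gamma>\<close> of the other \<open>n - 1\<close> coordinates. A function of these coordinates is encoded as a
  function on the whole space that does not depend on the \<open>i\<close>-th one (a constant if \<open>n = 1\<close>).\<close>

definition boundary_chart ::
    "(real ^ 'n::finite) set \<Rightarrow> real ^ 'n \<Rightarrow> real \<Rightarrow> 'n \<Rightarrow> real \<Rightarrow> (real ^ 'n \<Rightarrow> real) \<Rightarrow> bool" where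
  "boundary_chart \<Omega> x\<^sub>0 \<rho> i \<epsilon> \<gamma> \<longleftrightarrow>
     \<rho> > 0 \<and> \<epsilon> \<in> {1, - 1} \<and> smooth_on UNIV \<gamma> \<and>
     (\<forall>x t. \<gamma> (x + t *\<^sub>R axis i 1) = \<gamma> x) \<and>
     \<Omega> \<inter> ball x\<^sub>0 \<rho> = {x \<in> ball x\<^sub>0 \<rho>. \<epsilon> * x $ i > \<gamma> x}"

definition bounded_smooth_domain :: "(real ^ 'n::finite) set \<Rightarrow> bool" where
  "bounded_smooth_domain \<Omega> \<longleftrightarrow>
     \<Omega> \<noteq> {} \<and> open \<Omega> \<and> connected \<Omega> \<and> bounded \<Omega> \<and>
     (\<forall>x\<^sub>0\<in>frontier \<Omega>. \<exists>\<rho> i \<epsilon> \<gamma>. boundary_chart \<Omega> x\<^sub>0 \<rho> i \<epsilon> \<gamma>)"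

text \<open>The normalised gradient of the local defining function \<open>\<gamma> x - \<epsilon> * x $ i\<close>, which is negative
  in \<open>\<Omega>\<close>; it does not depend on the chart. Note that \<^const>\<open>sgn\<close> normalises a vector.\<close>

definition outer_unit_normal :: "(real ^ 'n::finite) set \<Rightarrow> real ^ 'n \<Rightarrow> real ^ 'n \<Rightarrow> bool" where
  "outer_unit_normal \<Omega> x \<nu> \<longleftrightarrow>
     x \<in> frontier \<Omega> \<and>
     (\<exists>\<rho> i \<epsilon> \<gamma>. boundary_chart \<Omega> x \<rho> i \<epsilon> \<gamma> \<and>
        \<nu> = sgn ((\<chi> j. partial_derivative j \<gamma> x) - \<epsilon> *\<^sub>R axis i 1))"

text \<open>At \<open>x \<in> \<partial>\<Omega>\<close> the gradient is understood as the boundary value of its continuous extension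
  from \<open>\<Omega>\<close>.\<close>

definition has_normal_derivative ::
    "(real ^ 'n::finite) set \<Rightarrow> (real ^ 'n \<Rightarrow> real) \<Rightarrow> real ^ 'n \<Rightarrow> real ^ 'n \<Rightarrow> real \<Rightarrow> bool" where
  "has_normal_derivative \<Omega> f x \<nu> c \<longleftrightarrow>
     ((\<lambda>y. (\<chi> j. partial_derivative j f y) \<bullet> \<nu>) \<longlongrightarrow> c) (at x within \<Omega>)"

definition neumann_condition :: "(real ^ 'n::finite) set \<Rightarrow> (real ^ 'n \<Rightarrow> real) \<Rightarrow> bool" where
  "neumann_condition \<Omega> f \<longleftrightarrow>
     (\<forall>x\<in>frontier \<Omega>. \<forall>\<nu>. outer_unit_normal \<Omega> x \<nu> \<longrightarrow> has_normal_derivative \<Omega> f x \<nu> 0)"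

definition positive_smooth_solution ::
    "(real ^ 'n::finite) set \<Rightarrow> real \<Rightarrow> real \<Rightarrow> real \<Rightarrow> real \<Rightarrow> real \<Rightarrow> real \<Rightarrow> real \<Rightarrow>
     (real ^ 'n \<Rightarrow> real) \<Rightarrow> (real ^ 'n \<Rightarrow> real) \<Rightarrow> bool" where
  "positive_smooth_solution \<Omega> p q r s \<sigma> d\<^sub>1 d\<^sub>2 u v \<longleftrightarrow>
     smooth_up_to_boundary \<Omega> u \<and> smooth_up_to_boundary \<Omega> v \<and>
     (\<forall>x\<in>closure \<Omega>. u x > 0 \<and> v x > 0) \<and>
     (\<forall>x\<in>\<Omega>. d\<^sub>1 * laplacian u x - u x + u x powr p / v x powr q + \<sigma> = 0) \<and>
     (\<forall>x\<in>\<Omega>. d\<^sub>2 * laplacian v x - v x + u x powr r / v x powr s = 0) \<and>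
     neumann_condition \<Omega> u \<and> neumann_condition \<Omega> v"

text \<open>The unique constant positive solution \<open>(u\<^sup>*, v\<^sup>*)\<close>; constants solve the system for all
  diffusion coefficients or for none.\<close>

definition constant_positive_solution ::
    "(real ^ 'n::finite) set \<Rightarrow> real \<Rightarrow> real \<Rightarrow> real \<Rightarrow> real \<Rightarrow> real \<Rightarrow> real \<times> real" where
  "constant_positive_solution \<Omega> p q r s \<sigma> =
     (THE (a, b). \<forall>d\<^sub>1>0. \<forall>d\<^sub>2>0.
        positive_smooth_solution \<Omega> p q r s \<sigma> d\<^sub>1 d\<^sub>2 (\<lambda>_. a) (\<lambda>_. b))"

end

theory Submission
  imports Defs
begin

text \<open>
  Write \<open>f(u,v) = -u + u\<^sup>p v\<^sup>-\<^sup>q + \<sigma>\<close> and \<open>g(u,v) = -v + u\<^sup>r v\<^sup>-\<^sup>s\<close> for the kinetics. The proof is an energy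
  argument in which the inhibitor is slaved to the activator, with a constant that does not see
  \<open>d\<^sub>2\<close>.

  Let \<open>m\<close> be the average of \<open>u\<close> over \<open>\<Omega>\<close> and let \<open>w\<close> be the value of \<open>v\<close> with \<open>g(m,w) = 0\<close>. Because
  \<open>s \<ge> 0\<close>, the function \<open>g\<close> decreases in \<open>v\<close> at least as fast as \<open>-v\<close>. Testing the second equation with
  \<open>v - w\<close> therefore gives \<open>\<integral>(v-w)\<^sup>2 \<le> L\<^sup>2 \<integral>(u-m)\<^sup>2\<close>: the diffusion term has a favourable sign and
  is dropped. Testing the first equation with \<open>u - m\<close>, where \<open>\<integral>(u-m) = 0\<close> allows \<open>f(m,w)\<close> to be
  subtracted, gives \<open>d\<^sub>1 \<integral>|\<nabla>u|\<^sup>2 \<le> \<Lambda> \<integral>(u-m)\<^sup>2\<close>, and the Poincare inequality bounds the right-hand side by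
  \<open>\<Lambda> K \<integral>|\<nabla>u|\<^sup>2\<close>. If \<open>d\<^sub>1 > \<Lambda> K\<close> then \<open>\<nabla>u = 0\<close>, hence \<open>u = m\<close> and \<open>v = w\<close>. The constants \<open>L\<close> and \<open>\<Lambda>\<close> depend only
  on Lipschitz bounds for the kinetics on a compact interval of positive numbers, which is where the a priori bounds
  enter. This is the content of \<open>large_diffusion_forces_constants\<close>. That the kinetics have exactly one
  positive zero is the scalar statement \<open>unique_root_sublinear\<close>, since eliminating \<open>v\<close> leaves
  \<open>u = u\<^sup>\<theta> + \<sigma>\<close> with \<open>\<theta> = p - qr/(s+1) < 1\<close>.

  Two analytic tools are developed along the way.

  \<^item> \<open>poincare_inequality\<close>: the squared difference between \<open>u\<close> and its translate along a segment inside
    \<open>\<Omega>\<close> is controlled by the Dirichlet energy. Moving small pieces of \<open>\<Omega>\<close> by finitely many such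
    translations into one fixed ball reduces the inequality to that ball, where averaging over all
    translations proves it. At the boundary, the chart provides a direction that leads inwards.
  \<^item> \<open>green_identity\<close>: the divergence theorem for a field that is tangential at the boundary. Such a
    field can be cut off near \<open>\<partial>\<Omega>\<close> by \<open>\<eta>(\<Psi>/\<delta>)\<close> for a defining function \<open>\<Psi>\<close>. The
    error is the flux through a strip of volume \<open>O(\<delta>)\<close> against a gradient of size \<open>O(1/\<delta>)\<close>, times
    the component of the field along \<open>\<nabla>\<Psi>\<close>, which tends to zero. All integrals are over sets of full
    dimension.
\<close>

section \<open>Translations and the Poincare inequality\<close>

lemma nn_integral_lborel_translation:
  fixes f :: "'a::euclidean_space \<Rightarrow> ennreal"
  assumes "f \<in> borel_measurable borel"
  shows "(\<integral>\<^sup>+x. f (h + x) \<partial>lborel) = (\<integral>\<^sup>+x. f x \<partial>lborel)"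
proof -
  have "(\<integral>\<^sup>+x. f x \<partial>lborel) = (\<integral>\<^sup>+x. f x \<partial>(distr lborel borel ((+) h)))"
    by (simp add: lborel_distr_plus)
  also have "\<dots> = (\<integral>\<^sup>+x. f (h + x) \<partial>lborel)"
    by (rule nn_integral_distr) (use assms in auto)
  finally show ?thesis by simp
qed

text \<open>The Cauchy-Schwarz inequality for the fundamental theorem of calculus on the unit interval. With
  \<open>a = \<phi>(1) - \<phi>(0)\<close> it amounts to \<open>\<integral>(\<phi>' - a)\<^sup>2 \<ge> 0\<close>, which is used here in the form that a primitive of
  \<open>(\<phi>' - a)\<^sup>2\<close> increases.\<close>

lemma square_increment_le_nn_integral:
  fixes \<phi> \<phi>' :: "real \<Rightarrow> real"
  assumes der: "\<And>t. t \<in> {0..1} \<Longrightarrow> DERIV \<phi> t :> \<phi>' t"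
    and cont: "continuous_on {0..1} \<phi>'"
  shows "ennreal ((\<phi> 1 - \<phi> 0)\<^sup>2) \<le> (\<integral>\<^sup>+t. ennreal ((\<phi>' t)\<^sup>2) * indicator {0..1} t \<partial>lborel)"
proof -
  define a where "a = \<phi> 1 - \<phi> 0"
  \<comment> \<open>Clamping the argument extends the integrand continuously to the real line, so that its primitive is
    differentiable at both end points.\<close>
  define c where "c t = (\<phi>' (max 0 (min 1 t)))\<^sup>2" for t
  define G where "G t = integral {-1..t} c" for t
  have c: "continuous_on S c" for S
    unfolding c_def
    by (intro continuous_intros continuous_on_compose2[OF cont]) auto
  have G: "DERIV G t :> c t" if "t \<in> {0..1}" for t
  proof -
    have "(G has_real_derivative c t) (at t within {-1..2})"
      unfolding G_def by (rule integral_has_real_derivative[OF c]) (use that in auto)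
    moreover have "at t within {-1..2} = at t"
      using that by (intro at_within_interior) auto
    ultimately show ?thesis by simp
  qed
  define k where "k t = G t - 2 * a * \<phi> t + a\<^sup>2 * t" for t
  have k: "DERIV k t :> (\<phi>' t - a)\<^sup>2" if "t \<in> {0..1}" for t
  proof -
    have "DERIV k t :> c t - 2 * a * \<phi>' t + a\<^sup>2"
      unfolding k_def by (auto intro!: derivative_eq_intros G der that)
    moreover have "c t - 2 * a * \<phi>' t + a\<^sup>2 = (\<phi>' t - a)\<^sup>2"
      using that by (simp add: c_def power2_eq_square algebra_simps)
    ultimately show ?thesis by simp
  qed
  have "k 0 \<le> k 1"
  proof (rule DERIV_nonneg_imp_nondecreasing[where f=k and a=0 and b=1])
    fix x :: real assume "0 \<le> x" "x \<le> 1"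
    then show "\<exists>y. DERIV k x :> y \<and> 0 \<le> y"
      by (intro exI[of _ "(\<phi>' x - a)\<^sup>2"] conjI k) auto
  qed simp
  then have "a\<^sup>2 \<le> G 1 - G 0"
    by (simp add: k_def a_def power2_eq_square algebra_simps)
  moreover have "(\<integral>\<^sup>+t. ennreal (c t) * indicator {0..1} t \<partial>lborel) = G 1 - G 0"
    by (rule nn_integral_FTC_Icc) (use G c in \<open>auto simp: c_def intro!: borel_measurable_continuous_onI\<close>)
  moreover have "(\<integral>\<^sup>+t. ennreal (c t) * indicator {0..1} t \<partial>lborel)
      = (\<integral>\<^sup>+t. ennreal ((\<phi>' t)\<^sup>2) * indicator {0..1} t \<partial>lborel)"
    by (intro nn_integral_cong) (auto simp: c_def indicator_def)
  ultimately show ?thesis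
    by (simp add: a_def ennreal_leI)
qed

text \<open>The basic estimate behind the Poincare inequality: integrate the squared derivative along the
  segment from \<open>x\<close> to \<open>x + h\<close>, exchange the order of integration, and use that Lebesgue measure is invariant
  under the translation by \<open>t h\<close>. The translated sets stay in \<open>\<Omega>\<close>, so for each \<open>t\<close> the whole energy is an upper bound.\<close>

lemma nn_integral_square_translate_diff_le:
  fixes u :: "'a::euclidean_space \<Rightarrow> real"
  assumes \<Omega>: "open \<Omega>"
    and u: "\<And>x. x \<in> \<Omega> \<Longrightarrow> GDERIV u x :> g x"
    and g: "continuous_on \<Omega> g"
    and S: "S \<in> sets borel" "\<And>x t. x \<in> S \<Longrightarrow> t \<in> {0..1} \<Longrightarrow> x + t *\<^sub>R h \<in> \<Omega>"
  shows "(\<integral>\<^sup>+x\<in>S. ennreal ((u (x + h) - u x)\<^sup>2) \<partial>lborel)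
      \<le> ennreal ((norm h)\<^sup>2) * (\<integral>\<^sup>+x\<in>\<Omega>. ennreal ((norm (g x))\<^sup>2) \<partial>lborel)"
proof -
  define G where "G x = ennreal ((norm h)\<^sup>2) * (ennreal ((norm (g x))\<^sup>2) * indicator \<Omega> x)" for x
  have [measurable]: "\<Omega> \<in> sets borel" "S \<in> sets borel" using \<Omega> S by auto
  have "(\<lambda>x. indicator \<Omega> x *\<^sub>R g x) \<in> borel_measurable borel"
    using borel_measurable_continuous_on_indicator[OF _ g] \<Omega> by auto
  then have "(\<lambda>x. ennreal ((norm h)\<^sup>2) * ennreal ((norm (indicator \<Omega> x *\<^sub>R g x))\<^sup>2)) \<in> borel_measurable borel"
    by measurable
  moreover have "(\<lambda>x. ennreal ((norm h)\<^sup>2) * ennreal ((norm (indicator \<Omega> x *\<^sub>R g x))\<^sup>2)) = G"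
    by (auto simp: G_def indicator_def fun_eq_iff)
  ultimately have G [measurable]: "G \<in> borel_measurable borel" by simp
  have pw: "ennreal ((u (x + h) - u x)\<^sup>2) \<le> (\<integral>\<^sup>+t. G (t *\<^sub>R h + x) * indicator {0..1} t \<partial>lborel)"
    if x: "x \<in> S" for x
  proof -
    have in\<Omega>: "x + t *\<^sub>R h \<in> \<Omega>" if "t \<in> {0..1}" for t using S(2)[OF x that] .
    have "ennreal ((u (x + 1 *\<^sub>R h) - u (x + 0 *\<^sub>R h))\<^sup>2)
      \<le> (\<integral>\<^sup>+t. ennreal ((h \<bullet> g (x + t *\<^sub>R h))\<^sup>2) * indicator {0..1} t \<partial>lborel)"
    proof (rule square_increment_le_nn_integral)
      fix t :: real assume t: "t \<in> {0..1}"
      have "((\<lambda>t. u (x + t *\<^sub>R h)) has_derivative (\<lambda>s. (s *\<^sub>R h) \<bullet> g (x + t *\<^sub>R h))) (at t)"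
        by (rule has_derivative_compose[where g=u and f="\<lambda>t. x + t *\<^sub>R h" and f'="\<lambda>s. s *\<^sub>R h"])
           (use u[OF in\<Omega>[OF t]] in \<open>auto simp: gderiv_def intro!: derivative_eq_intros\<close>)
      then show "DERIV (\<lambda>t. u (x + t *\<^sub>R h)) t :> h \<bullet> g (x + t *\<^sub>R h)"
        by (simp add: has_field_derivative_def mult_commute_abs)
    next
      show "continuous_on {0..1} (\<lambda>t. h \<bullet> g (x + t *\<^sub>R h))"
        by (intro continuous_intros continuous_on_compose2[OF g]) (use in\<Omega> in auto)
    qed
    also have "\<dots> \<le> (\<integral>\<^sup>+t. G (t *\<^sub>R h + x) * indicator {0..1} t \<partial>lborel)"
    proof (rule nn_integral_mono)
      fix t :: real
      have "(h \<bullet> g (x + t *\<^sub>R h))\<^sup>2 \<le> (norm h)\<^sup>2 * (norm (g (x + t *\<^sub>R h)))\<^sup>2"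
        using Cauchy_Schwarz_ineq[of h "g (x + t *\<^sub>R h)"] by (simp add: power2_norm_eq_inner)
      then have "ennreal ((h \<bullet> g (x + t *\<^sub>R h))\<^sup>2) \<le> G (t *\<^sub>R h + x)" if "t \<in> {0..1}"
        using in\<Omega>[OF that] by (auto simp: G_def add.commute simp flip: ennreal_mult intro!: ennreal_leI)
      then show "ennreal ((h \<bullet> g (x + t *\<^sub>R h))\<^sup>2) * indicator {0..1} t \<le> G (t *\<^sub>R h + x) * indicator {0..1} t"
        by (auto simp: indicator_def)
    qed
    finally show ?thesis by simp
  qed
  have "(\<integral>\<^sup>+x\<in>S. ennreal ((u (x + h) - u x)\<^sup>2) \<partial>lborel)
      \<le> (\<integral>\<^sup>+x. (\<integral>\<^sup>+t. G (t *\<^sub>R h + x) * indicator {0..1} t \<partial>lborel) \<partial>lborel)"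
    by (intro nn_integral_mono) (auto simp: indicator_def[of S] pw)
  also have "\<dots> = (\<integral>\<^sup>+t. (\<integral>\<^sup>+x. G (t *\<^sub>R h + x) * indicator {0..1} t \<partial>lborel) \<partial>lborel)"
    by (rule lborel_pair.Fubini') measurable
  also have "\<dots> = (\<integral>\<^sup>+t. (\<integral>\<^sup>+x. G (t *\<^sub>R h + x) \<partial>lborel) * indicator {0..1::real} t \<partial>lborel)"
    by (intro nn_integral_cong nn_integral_multc) measurable
  also have "\<dots> = (\<integral>\<^sup>+t. (\<integral>\<^sup>+x. G x \<partial>lborel) * indicator {0..1::real} t \<partial>lborel)"
    by (simp add: nn_integral_lborel_translation)
  also have "\<dots> = (\<integral>\<^sup>+x. G x \<partial>lborel)"
    by (subst nn_integral_cmult) auto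
  also have "\<dots> = ennreal ((norm h)\<^sup>2) * (\<integral>\<^sup>+x\<in>\<Omega>. ennreal ((norm (g x))\<^sup>2) \<partial>lborel)"
  proof -
    have "(\<lambda>x. ennreal ((norm (indicator \<Omega> x *\<^sub>R g x))\<^sup>2)) \<in> borel_measurable borel"
      using borel_measurable_continuous_on_indicator[OF _ g] \<Omega> by measurable
    moreover have "(\<lambda>x. ennreal ((norm (indicator \<Omega> x *\<^sub>R g x))\<^sup>2)) = (\<lambda>x. ennreal ((norm (g x))\<^sup>2) * indicator \<Omega> x)"
      by (auto simp: indicator_def fun_eq_iff)
    ultimately have "(\<lambda>x. ennreal ((norm (g x))\<^sup>2) * indicator \<Omega> x) \<in> borel_measurable borel"
      by metis
    then show ?thesis unfolding G_def by (subst nn_integral_cmult) auto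
  qed
  finally show ?thesis .
qed

text \<open>Some point lies at or below the mean. This lets a value of \<open>u\<close> stand in for its average over a ball.\<close>

lemma exists_le_of_nn_integral_le:
  assumes [measurable]: "A \<in> sets M" "J \<in> borel_measurable M"
    and pos: "emeasure M A > 0" and fin: "emeasure M A < \<infinity>" and c: "c < \<infinity>"
    and le: "(\<integral>\<^sup>+x\<in>A. J x \<partial>M) \<le> c * emeasure M A"
  shows "\<exists>x\<in>A. J x \<le> c"
proof (rule ccontr)
  assume *: "\<not> (\<exists>x\<in>A. J x \<le> c)"
  have "(\<integral>\<^sup>+x\<in>A. c \<partial>M) < (\<integral>\<^sup>+x\<in>A. J x \<partial>M)"
  proof (rule nn_integral_less)
    show "(\<integral>\<^sup>+x\<in>A. c \<partial>M) \<noteq> \<infinity>"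
      using fin c by (simp add: nn_integral_cmult_indicator ennreal_mult_eq_top_iff less_top)
    show "AE x in M. c * indicator A x \<le> J x * indicator A x"
      using * by (auto simp: indicator_def not_le less_imp_le)
    show "\<not> (AE x in M. J x * indicator A x \<le> c * indicator A x)"
    proof
      assume "AE x in M. J x * indicator A x \<le> c * indicator A x"
      then have "AE x in M. x \<notin> A"
        by eventually_elim (use * in \<open>auto simp: indicator_def not_le split: if_splits\<close>)
      then have "emeasure M A = 0"
        by (subst (asm) AE_iff_measurable[where N=A]) (use sets.sets_into_space[OF assms(1)] in auto)
      then show False using pos by simp
    qed
  qed auto
  then show False using le by (simp add: nn_integral_cmult_indicator)
qed

lemma borel_measurable_square_diff:
  fixes u :: "'a::euclidean_space \<Rightarrow> real"
  assumes "open \<Omega>" "continuous_on \<Omega> u"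
  shows "(\<lambda>x. ennreal ((u x - c)\<^sup>2) * indicator \<Omega> x) \<in> borel_measurable borel"
proof -
  have [measurable]: "\<Omega> \<in> sets borel" using assms by auto
  have [measurable]: "(\<lambda>x. indicator \<Omega> x *\<^sub>R u x) \<in> borel_measurable borel"
    using borel_measurable_continuous_on_indicator[OF _ assms(2)] assms by auto
  have "(\<lambda>x. ennreal ((indicator \<Omega> x *\<^sub>R u x - c)\<^sup>2) * indicator \<Omega> x) \<in> borel_measurable borel"
    by measurable
  also have "(\<lambda>x. ennreal ((indicator \<Omega> x *\<^sub>R u x - c)\<^sup>2) * indicator \<Omega> x) = (\<lambda>x. ennreal ((u x - c)\<^sup>2) * indicator \<Omega> x)"
    by (auto simp: indicator_def fun_eq_iff)
  finally show ?thesis .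
qed

lemma GDERIV_imp_continuous_on:
  assumes "\<And>x. x \<in> S \<Longrightarrow> GDERIV u x :> g x"
  shows "continuous_on S u"
  using assms by (auto simp: gderiv_def continuous_on_eq_continuous_within
      intro: has_derivative_continuous continuous_at_imp_continuous_within)

text \<open>The double integral of \<open>(u(y) - u(x))\<^sup>2\<close> over \<open>x, y\<close> in the ball becomes, with \<open>y = x + h\<close>, an integral over
  \<open>h\<close> of the quantity estimated above; by convexity the segments stay in the ball. A point \<open>x\<close> at which
  the inner integral is at most its mean provides the constant \<open>c = u(x)\<close>. The energy on the right is that over the larger
  set \<open>\<Omega>\<close>, as needed later.\<close>

lemma poincare_inequality_ball:
  fixes \<Omega> :: "'a::euclidean_space set"
  assumes \<Omega>: "open \<Omega>" and r: "r > 0" and B: "ball z r \<subseteq> \<Omega>"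
  shows "\<exists>K>0. \<forall>u g. (\<forall>x\<in>\<Omega>. GDERIV u x :> g x) \<and> continuous_on \<Omega> g \<longrightarrow>
     (\<exists>c. (\<integral>\<^sup>+x\<in>ball z r. ennreal ((u x - c)\<^sup>2) \<partial>lborel)
        \<le> ennreal K * (\<integral>\<^sup>+x\<in>\<Omega>. ennreal ((norm (g x))\<^sup>2) \<partial>lborel))"
proof -
  define B where "B = ball z r"
  define C where "C = (cball 0 (2 * r) :: 'a set)"
  have [measurable]: "B \<in> sets borel" "C \<in> sets borel" by (auto simp: B_def C_def)
  have B\<Omega>: "B \<subseteq> \<Omega>" using B by (simp add: B_def)
  have Bfin: "emeasure lborel B < \<infinity>"
    unfolding B_def using emeasure_bounded_finite[of "ball z r"] by simp
  have Cfin: "emeasure lborel C < \<infinity>"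
    unfolding C_def using emeasure_bounded_finite[of "cball (0::'a) (2*r)"] by simp
  \<comment> \<open>Only translations by at most the diameter \<open>2 r\<close> contribute, each with weight \<open>|h|\<^sup>2 \<le> 4 r\<^sup>2\<close>.\<close>
  define K where "K = 4 * r\<^sup>2 * measure lborel C / measure lborel B"
  have mB: "measure lborel B > 0" unfolding B_def using content_ball_pos[OF r, of z] by simp
  have mC: "measure lborel C > 0" unfolding C_def using content_cball_pos[of "2*r" 0] r by simp
  have Bpos: "emeasure lborel B > 0"
    using mB Bfin by (simp add: emeasure_eq_ennreal_measure less_top)
  have K: "K > 0" using mB mC r by (simp add: K_def)
  show ?thesis
  proof (rule exI[of _ K], intro conjI K allI impI, elim conjE)
    fix u :: "'a \<Rightarrow> real" and g
    assume u: "\<forall>x\<in>\<Omega>. GDERIV u x :> g x" and g: "continuous_on \<Omega> g"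
    define E where "E = (\<integral>\<^sup>+x\<in>\<Omega>. ennreal ((norm (g x))\<^sup>2) \<partial>lborel)"
    have "\<exists>c. (\<integral>\<^sup>+x\<in>B. ennreal ((u x - c)\<^sup>2) \<partial>lborel) \<le> ennreal K * E"
    proof (cases "E = \<infinity>")
      case True
      then show "\<exists>c. (\<integral>\<^sup>+x\<in>B. ennreal ((u x - c)\<^sup>2) \<partial>lborel) \<le> ennreal K * E"
        using K by (simp add: ennreal_mult_top)
    next
      case False
      have cu: "continuous_on \<Omega> u" using u by (intro GDERIV_imp_continuous_on) auto
      define w where "w x = indicator B x *\<^sub>R u x" for x
      have [measurable]: "w \<in> borel_measurable borel"
        unfolding w_def
        using borel_measurable_continuous_on_indicator[of B u] continuous_on_subset[OF cu B\<Omega>] by simp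
      define F where "F x h = ennreal ((w (h + x) - w x)\<^sup>2) * (indicator B x * indicator B (h + x))" for x h
      have [measurable]: "(\<lambda>(x,h). F x h) \<in> borel_measurable (lborel \<Otimes>\<^sub>M lborel)"
        unfolding F_def by measurable
      define J where "J x = (\<integral>\<^sup>+h. F x h \<partial>lborel)" for x
      have [measurable]: "J \<in> borel_measurable borel"
        unfolding J_def by measurable
      have Jeq: "J x = (\<integral>\<^sup>+y\<in>B. ennreal ((u y - u x)\<^sup>2) \<partial>lborel)" if "x \<in> B" for x
      proof -
        have "J x = (\<integral>\<^sup>+h. ennreal ((w (x + h) - w x)\<^sup>2) * indicator B (x + h) \<partial>lborel)"
          using that by (simp add: J_def F_def add.commute)
        also have "\<dots> = (\<integral>\<^sup>+y. ennreal ((w y - w x)\<^sup>2) * indicator B y \<partial>lborel)"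
          by (rule nn_integral_lborel_translation[where f="\<lambda>y. ennreal ((w y - w x)\<^sup>2) * indicator B y"]) measurable
        finally show ?thesis using that
          by (auto simp: w_def indicator_def intro!: nn_integral_cong)
      qed
      have J0: "J x = 0" if "x \<notin> B" for x using that by (simp add: J_def F_def)
      have "(\<integral>\<^sup>+x\<in>B. J x \<partial>lborel) = (\<integral>\<^sup>+x. J x \<partial>lborel)"
        using J0 by (intro nn_integral_cong) (auto simp: indicator_def)
      also have "\<dots> = (\<integral>\<^sup>+h. (\<integral>\<^sup>+x. F x h \<partial>lborel) \<partial>lborel)"
        unfolding J_def by (rule lborel_pair.Fubini'[symmetric]) measurable
      also have "\<dots> \<le> (\<integral>\<^sup>+h. (ennreal (4 * r\<^sup>2) * E) * indicator C h \<partial>lborel)"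
      proof (rule nn_integral_mono)
        fix h :: 'a
        define S where "S = B \<inter> (+) h -` B"
        have S [measurable]: "S \<in> sets borel"
          unfolding S_def B_def by (intro borel_open open_Int open_vimage) (auto intro: continuous_intros)
        show "(\<integral>\<^sup>+x. F x h \<partial>lborel) \<le> (ennreal (4 * r\<^sup>2) * E) * indicator C h"
        proof (cases "S = {}")
          case True
          then have "F x h = 0" for x by (auto simp: F_def S_def indicator_def)
          then show ?thesis by simp
        next
          case False
          then obtain y where y: "y \<in> B" "h + y \<in> B" by (auto simp: S_def)
          have "norm h \<le> 2 * r"
            using y norm_triangle_ineq[of "h + y - z" "z - y"]
            by (simp add: B_def dist_norm norm_minus_commute algebra_simps)
          then have hC: "h \<in> C" and h2: "(norm h)\<^sup>2 \<le> 4 * r\<^sup>2"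
            using power_mono[of "norm h" "2*r" 2] by (auto simp: C_def power_mult_distrib)
          have "(\<integral>\<^sup>+x. F x h \<partial>lborel) = (\<integral>\<^sup>+x\<in>S. ennreal ((u (x + h) - u x)\<^sup>2) \<partial>lborel)"
            by (intro nn_integral_cong) (auto simp: F_def S_def w_def indicator_def add.commute)
          also have "\<dots> \<le> ennreal ((norm h)\<^sup>2) * E"
            unfolding E_def
          proof (rule nn_integral_square_translate_diff_le[OF \<Omega> _ g S])
            fix x t assume x: "x \<in> S" and t: "t \<in> {0..1::real}"
            have "(1 - t) *\<^sub>R x + t *\<^sub>R (h + x) \<in> B"
              by (rule convexD_alt) (use x t in \<open>auto simp: S_def B_def\<close>)
            then show "x + t *\<^sub>R h \<in> \<Omega>" using B\<Omega> by (auto simp: algebra_simps)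
          qed (use u in auto)
          also have "\<dots> \<le> ennreal (4 * r\<^sup>2) * E"
            by (intro mult_right_mono ennreal_leI h2) auto
          finally show ?thesis using hC by simp
        qed
      qed
      also have "\<dots> = ennreal (4 * r\<^sup>2) * E * emeasure lborel C"
        by (simp add: nn_integral_cmult_indicator)
      also have "\<dots> = ennreal K * E * emeasure lborel B"
      proof -
        have "ennreal (4 * r\<^sup>2) * emeasure lborel C = ennreal K * emeasure lborel B"
          using Bfin Cfin mB r by (simp add: emeasure_eq_ennreal_measure less_top K_def flip: ennreal_mult)
        then show ?thesis by (simp add: mult_ac)
      qed
      finally have "(\<integral>\<^sup>+x\<in>B. J x \<partial>lborel) \<le> ennreal K * E * emeasure lborel B" .
      then have "\<exists>x\<in>B. J x \<le> ennreal K * E"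
        using False Bpos Bfin
        by (intro exists_le_of_nn_integral_le) (auto simp: ennreal_mult_less_top less_top)
      then show "\<exists>c. (\<integral>\<^sup>+x\<in>B. ennreal ((u x - c)\<^sup>2) \<partial>lborel) \<le> ennreal K * E"
        using Jeq by auto
    qed
    then show "\<exists>c. (\<integral>\<^sup>+x\<in>ball z r. ennreal ((u x - c)\<^sup>2) \<partial>lborel)
        \<le> ennreal K * (\<integral>\<^sup>+x\<in>\<Omega>. ennreal ((norm (g x))\<^sup>2) \<partial>lborel)"
      by (simp add: E_def B_def)
  qed
qed

lemma square_translate_triangle:
  fixes u :: "'a::euclidean_space \<Rightarrow> real"
  assumes \<Omega>: "open \<Omega>" and u: "\<And>x. x \<in> \<Omega> \<Longrightarrow> GDERIV u x :> g x" and g: "continuous_on \<Omega> g"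
    and S: "S \<in> sets borel" "\<And>x t. x \<in> S \<Longrightarrow> t \<in> {0..1} \<Longrightarrow> x + t *\<^sub>R h \<in> \<Omega>"
    and T: "open T" "T \<subseteq> \<Omega>" "\<And>x. x \<in> S \<Longrightarrow> x + h \<in> T"
  shows "(\<integral>\<^sup>+x\<in>S. ennreal ((u x - c)\<^sup>2) \<partial>lborel)
      \<le> ennreal (2 * (norm h)\<^sup>2) * (\<integral>\<^sup>+x\<in>\<Omega>. ennreal ((norm (g x))\<^sup>2) \<partial>lborel)
        + 2 * (\<integral>\<^sup>+x\<in>T. ennreal ((u x - c)\<^sup>2) \<partial>lborel)"
proof -
  note [measurable] = S(1)
  have [measurable]: "\<Omega> \<in> sets borel" "T \<in> sets borel" using \<Omega> T by auto
  have cu: "continuous_on \<Omega> u" using u by (intro GDERIV_imp_continuous_on) auto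
  have S\<Omega>: "S \<subseteq> \<Omega>" using S(2)[of _ 0] by auto
  define w where "w x = indicator \<Omega> x *\<^sub>R u x" for x
  have [measurable]: "w \<in> borel_measurable borel"
    unfolding w_def using borel_measurable_continuous_on_indicator[OF _ cu] by simp
  have w: "w x = u x" if "x \<in> \<Omega>" for x using that by (simp add: w_def)
  have "(\<integral>\<^sup>+x\<in>S. ennreal ((u x - c)\<^sup>2) \<partial>lborel)
     \<le> (\<integral>\<^sup>+x. 2 * (ennreal ((w (x + h) - w x)\<^sup>2) * indicator S x)
           + 2 * (ennreal ((w (h + x) - c)\<^sup>2) * indicator T (h + x)) \<partial>lborel)"
  proof (rule nn_integral_mono)
    fix x
    have "(u x - c)\<^sup>2 \<le> 2 * (u (x + h) - u x)\<^sup>2 + 2 * (u (x + h) - c)\<^sup>2"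
      using sum_squares_ge_zero[of "(u (x + h) - u x) + (u (x + h) - c)" 0]
      by (simp add: power2_eq_square algebra_simps)
    then have "ennreal ((u x - c)\<^sup>2) \<le> ennreal (2 * (u (x + h) - u x)\<^sup>2 + 2 * (u (x + h) - c)\<^sup>2)"
      by (rule ennreal_leI)
    also have "\<dots> = 2 * ennreal ((u (x + h) - u x)\<^sup>2) + 2 * ennreal ((u (x + h) - c)\<^sup>2)"
      by (simp add: ennreal_plus ennreal_mult)
    finally show "ennreal ((u x - c)\<^sup>2) * indicator S x
       \<le> 2 * (ennreal ((w (x + h) - w x)\<^sup>2) * indicator S x)
           + 2 * (ennreal ((w (h + x) - c)\<^sup>2) * indicator T (h + x))"
      using T(2,3) S\<Omega> by (cases "x \<in> S") (auto simp: w subset_iff add.commute[of h])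
  qed
  also have "\<dots> = 2 * (\<integral>\<^sup>+x\<in>S. ennreal ((w (x + h) - w x)\<^sup>2) \<partial>lborel)
           + 2 * (\<integral>\<^sup>+x. ennreal ((w (h + x) - c)\<^sup>2) * indicator T (h + x) \<partial>lborel)"
    by (simp add: nn_integral_add nn_integral_cmult)
  also have "(\<integral>\<^sup>+x. ennreal ((w (h + x) - c)\<^sup>2) * indicator T (h + x) \<partial>lborel)
      = (\<integral>\<^sup>+x. ennreal ((w x - c)\<^sup>2) * indicator T x \<partial>lborel)"
    by (rule nn_integral_lborel_translation[where f="\<lambda>x. ennreal ((w x - c)\<^sup>2) * indicator T x"]) measurable
  also have "\<dots> = (\<integral>\<^sup>+x\<in>T. ennreal ((u x - c)\<^sup>2) \<partial>lborel)"
    using T(2) by (intro nn_integral_cong) (auto simp: w indicator_def subset_iff)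
  also have "(\<integral>\<^sup>+x\<in>S. ennreal ((w (x + h) - w x)\<^sup>2) \<partial>lborel) = (\<integral>\<^sup>+x\<in>S. ennreal ((u (x + h) - u x)\<^sup>2) \<partial>lborel)"
    using S\<Omega> T(2,3) by (intro nn_integral_cong) (auto simp: w indicator_def subset_iff)
  also have "\<dots> \<le> ennreal ((norm h)\<^sup>2) * (\<integral>\<^sup>+x\<in>\<Omega>. ennreal ((norm (g x))\<^sup>2) \<partial>lborel)"
    using nn_integral_square_translate_diff_le[OF \<Omega> u g S] by blast
  finally show ?thesis
    by (simp add: ennreal_mult mult_left_mono add_right_mono mult.assoc)
qed

text \<open>The property that is propagated through \<open>\<Omega>\<close>: near \<open>x\<close>, the deviation of \<open>u\<close> from \<^emph>\<open>any\<close> constant \<open>c\<close> is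
  controlled by the energy and by the deviation from the same \<open>c\<close> on the reference set \<open>B\<close>. Quantifying
  over all \<open>c\<close> lets estimates at different points be combined before the constant is chosen.\<close>

definition controls_oscillation_near :: "'a::euclidean_space set \<Rightarrow> 'a set \<Rightarrow> 'a \<Rightarrow> bool" where
  "controls_oscillation_near \<Omega> B x \<longleftrightarrow>
     (\<exists>\<delta> K. \<delta> > 0 \<and> K > 0 \<and> (\<forall>u g c. (\<forall>x\<in>\<Omega>. GDERIV u x :> g x) \<and> continuous_on \<Omega> g \<longrightarrow>
       (\<integral>\<^sup>+y\<in>ball x \<delta> \<inter> \<Omega>. ennreal ((u y - c)\<^sup>2) \<partial>lborel)
        \<le> ennreal K * ((\<integral>\<^sup>+y\<in>\<Omega>. ennreal ((norm (g y))\<^sup>2) \<partial>lborel)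
             + (\<integral>\<^sup>+y\<in>B. ennreal ((u y - c)\<^sup>2) \<partial>lborel))))"

text \<open>The control at \<open>x + h\<close> is pulled back to \<open>x\<close>: replacing \<open>u\<close> by its translate near \<open>x\<close> costs at most a multiple of the
  energy. The point \<open>x\<close> may lie on the boundary.\<close>

lemma controls_oscillation_near_translate:
  assumes \<Omega>: "open \<Omega>" and ctrl: "controls_oscillation_near \<Omega> B (x + h)"
    and \<eta>: "\<eta> > 0" "\<And>y t. y \<in> \<Omega> \<inter> ball x \<eta> \<Longrightarrow> t \<in> {0..1} \<Longrightarrow> y + t *\<^sub>R h \<in> \<Omega>"
  shows "controls_oscillation_near \<Omega> B x"
proof -
  obtain \<delta> K where \<delta>: "\<delta> > 0" and K: "K > 0"
    and *: "\<And>u g c. (\<forall>x\<in>\<Omega>. GDERIV u x :> g x) \<and> continuous_on \<Omega> g \<longrightarrow>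
       (\<integral>\<^sup>+y\<in>ball (x + h) \<delta> \<inter> \<Omega>. ennreal ((u y - c)\<^sup>2) \<partial>lborel)
        \<le> ennreal K * ((\<integral>\<^sup>+y\<in>\<Omega>. ennreal ((norm (g y))\<^sup>2) \<partial>lborel)
             + (\<integral>\<^sup>+y\<in>B. ennreal ((u y - c)\<^sup>2) \<partial>lborel))"
    using ctrl unfolding controls_oscillation_near_def by blast
  define S where "S = ball x (min \<delta> \<eta>) \<inter> \<Omega>"
  have S: "open S" "S \<in> sets borel" using \<Omega> by (auto simp: S_def)
  have S2: "y + t *\<^sub>R h \<in> \<Omega>" if "y \<in> S" "t \<in> {0..1}" for y t
    using that by (intro \<eta>) (auto simp: S_def)
  have S3: "y + h \<in> ball (x + h) \<delta> \<inter> \<Omega>" if "y \<in> S" for y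
    using S2[OF that, of 1] that by (auto simp: S_def)
  show ?thesis
    unfolding controls_oscillation_near_def
  proof (rule exI[of _ "min \<delta> \<eta>"], rule exI[of _ "2 * (norm h)\<^sup>2 + 2 * K"], intro conjI allI impI)
    show "min \<delta> \<eta> > 0" using \<delta> \<eta> by simp
    show "2 * (norm h)\<^sup>2 + 2 * K > 0" using K by (simp add: add_nonneg_pos)
    fix u :: "'a \<Rightarrow> real" and g c assume u: "(\<forall>x\<in>\<Omega>. GDERIV u x :> g x) \<and> continuous_on \<Omega> g"
    define E where "E = (\<integral>\<^sup>+y\<in>\<Omega>. ennreal ((norm (g y))\<^sup>2) \<partial>lborel)"
    define F where "F = (\<integral>\<^sup>+y\<in>B. ennreal ((u y - c)\<^sup>2) \<partial>lborel)"
    have "(\<integral>\<^sup>+y\<in>S. ennreal ((u y - c)\<^sup>2) \<partial>lborel)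
       \<le> ennreal (2 * (norm h)\<^sup>2) * E + 2 * (\<integral>\<^sup>+y\<in>ball (x + h) \<delta> \<inter> \<Omega>. ennreal ((u y - c)\<^sup>2) \<partial>lborel)"
      unfolding E_def
      by (rule square_translate_triangle) (use u \<Omega> S S2 S3 in auto)
    also have "\<dots> \<le> ennreal (2 * (norm h)\<^sup>2) * (E + F) + 2 * (ennreal K * (E + F))"
      using *[rule_format, OF u, of c]
      by (intro add_mono mult_left_mono) (auto simp: E_def F_def)
    also have "\<dots> = ennreal (2 * (norm h)\<^sup>2 + 2 * K) * (E + F)"
      using K by (simp add: ennreal_plus ennreal_mult algebra_simps)
    finally show "(\<integral>\<^sup>+y\<in>ball x (min \<delta> \<eta>) \<inter> \<Omega>. ennreal ((u y - c)\<^sup>2) \<partial>lborel)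
        \<le> ennreal (2 * (norm h)\<^sup>2 + 2 * K) * ((\<integral>\<^sup>+y\<in>\<Omega>. ennreal ((norm (g y))\<^sup>2) \<partial>lborel)
             + (\<integral>\<^sup>+y\<in>B. ennreal ((u y - c)\<^sup>2) \<partial>lborel))"
      by (simp add: E_def F_def S_def)
  qed
qed

text \<open>Within a ball contained in \<open>\<Omega>\<close> the property passes from any point close to the centre to any other by
  translation. So it is locally constant on the connected set \<open>\<Omega>\<close>, and it holds at the centre of \<open>B\<close>.\<close>

lemma controls_oscillation_near_interior:
  assumes \<Omega>: "open \<Omega>" "connected \<Omega>" and r: "r > 0" "ball z r \<subseteq> \<Omega>" and x: "x \<in> \<Omega>"
  shows "controls_oscillation_near \<Omega> (ball z r) x"
proof (rule connected_induction_simple[OF \<Omega>(2), where a=z])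
  show "controls_oscillation_near \<Omega> (ball z r) z"
    unfolding controls_oscillation_near_def
  proof (rule exI[where x=r], rule exI[where x="1::real"], intro conjI allI impI)
    fix u :: "'a \<Rightarrow> real" and g c
    have "ball z r \<inter> \<Omega> = ball z r" using r(2) by (rule inf.absorb1)
    then show "(\<integral>\<^sup>+y\<in>ball z r \<inter> \<Omega>. ennreal ((u y - c)\<^sup>2) \<partial>lborel)
        \<le> ennreal 1 * ((\<integral>\<^sup>+y\<in>\<Omega>. ennreal ((norm (g y))\<^sup>2) \<partial>lborel)
             + (\<integral>\<^sup>+y\<in>ball z r. ennreal ((u y - c)\<^sup>2) \<partial>lborel))"
      by (simp only: ennreal_1 mult_1) (rule add_increasing, simp_all only: zero_le order_refl)
  qed (rule r(1), rule zero_less_one)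
  show "z \<in> \<Omega>" "x \<in> \<Omega>" using r x by (auto simp: subset_iff)
  fix a assume "a \<in> \<Omega>"
  then obtain e where e: "e > 0" "ball a e \<subseteq> \<Omega>" using \<Omega>(1) by (auto simp: open_contains_ball)
  have step: "controls_oscillation_near \<Omega> (ball z r) y"
    if y': "y' \<in> ball a (e/4)" and y: "y \<in> ball a (e/4)"
      and ctrl: "controls_oscillation_near \<Omega> (ball z r) y'" for y y'
  proof (rule controls_oscillation_near_translate[OF \<Omega>(1), where h="y' - y" and \<eta>="e/4"])
    show "controls_oscillation_near \<Omega> (ball z r) (y + (y' - y))" using ctrl by simp
    show "e / 4 > 0" using e by simp
    fix w t assume w: "w \<in> \<Omega> \<inter> ball y (e/4)" and t: "t \<in> {0..1::real}"
    have "dist a (w + t *\<^sub>R (y' - y)) = norm ((a - y) + (y - w) + t *\<^sub>R (y - a) + t *\<^sub>R (a - y'))"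
      by (simp add: dist_norm algebra_simps)
    also have "\<dots> \<le> norm (a - y) + norm (y - w) + norm (t *\<^sub>R (y - a)) + norm (t *\<^sub>R (a - y'))"
      by (intro order_trans[OF norm_triangle_ineq] add_mono order_refl)
    also have "\<dots> \<le> norm (a - y) + norm (y - w) + norm (y - a) + norm (a - y')"
      using t mult_left_le_one_le[of "norm (y - a)" t] mult_left_le_one_le[of "norm (a - y')" t] by auto
    also have "\<dots> < e"
      using y y' w by (simp add: dist_norm norm_minus_commute)
    finally show "w + t *\<^sub>R (y' - y) \<in> \<Omega>" using e by auto
  qed
  have "ball a (e/4) \<subseteq> \<Omega>" using e subset_ball[of "e/4" e a] by (intro order_trans[OF _ e(2)]) auto
  then have "openin (top_of_set \<Omega>) (ball a (e/4))" using \<Omega>(1) by (simp add: openin_open_eq)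
  moreover have "a \<in> ball a (e/4)" using e by simp
  ultimately show "\<exists>T. openin (top_of_set \<Omega>) T \<and> a \<in> T \<and> (\<forall>x\<in>T. \<forall>y\<in>T.
      controls_oscillation_near \<Omega> (ball z r) x \<longrightarrow> controls_oscillation_near \<Omega> (ball z r) y)"
    using step by (intro exI[of _ "ball a (e/4)"] conjI ballI impI)
qed

text \<open>The assumption \<open>segment\<close> is the only regularity of the boundary that enters: near each boundary point, one
  fixed vector moves the nearby part of \<open>\<Omega>\<close> along segments inside \<open>\<Omega>\<close>, and the boundary point itself into \<open>\<Omega>\<close>. It makes
  the oscillation control available on the compact closure, and a finite subcover then adds up the local
  estimates.\<close>

theorem poincare_inequality:
  fixes \<Omega> :: "'a::euclidean_space set"
  assumes \<Omega>: "open \<Omega>" "connected \<Omega>" "bounded \<Omega>" "\<Omega> \<noteq> {}"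
    and segment: "\<And>x. x \<in> frontier \<Omega> \<Longrightarrow> \<exists>h \<eta>. \<eta> > 0 \<and> x + h \<in> \<Omega> \<and>
        (\<forall>y\<in>\<Omega> \<inter> ball x \<eta>. \<forall>t\<in>{0..1}. y + t *\<^sub>R h \<in> \<Omega>)"
  shows "\<exists>K>0. \<forall>u g. (\<forall>x\<in>\<Omega>. GDERIV u x :> g x) \<and> continuous_on \<Omega> g \<longrightarrow>
     (\<exists>c. (\<integral>\<^sup>+x\<in>\<Omega>. ennreal ((u x - c)\<^sup>2) \<partial>lborel)
        \<le> ennreal K * (\<integral>\<^sup>+x\<in>\<Omega>. ennreal ((norm (g x))\<^sup>2) \<partial>lborel))"
proof -
  obtain z where "z \<in> \<Omega>" using \<Omega> by auto
  then obtain r where r: "r > 0" "ball z r \<subseteq> \<Omega>" using \<Omega>(1) by (auto simp: open_contains_ball)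
  define B where "B = ball z r"
  have "controls_oscillation_near \<Omega> B x" if "x \<in> closure \<Omega>" for x
  proof (cases "x \<in> \<Omega>")
    case True
    then show ?thesis unfolding B_def by (rule controls_oscillation_near_interior[OF \<Omega>(1,2) r])
  next
    case False
    then have "x \<in> frontier \<Omega>" using that \<Omega>(1) by (simp add: frontier_def interior_open)
    then obtain h \<eta> where *: "\<eta> > 0" "x + h \<in> \<Omega>" "\<forall>y\<in>\<Omega> \<inter> ball x \<eta>. \<forall>t\<in>{0..1}. y + t *\<^sub>R h \<in> \<Omega>"
      using segment by blast
    have "controls_oscillation_near \<Omega> B (x + h)"
      unfolding B_def by (rule controls_oscillation_near_interior[OF \<Omega>(1,2) r *(2)])
    then show ?thesis
      by (rule controls_oscillation_near_translate[OF \<Omega>(1) _ *(1)]) (use *(3) in auto)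
  qed
  note near = this
  define P where "P x \<delta> L \<longleftrightarrow> \<delta> > 0 \<and> L > 0 \<and>
      (\<forall>u g c. (\<forall>x\<in>\<Omega>. GDERIV u x :> g x) \<and> continuous_on \<Omega> g \<longrightarrow>
       (\<integral>\<^sup>+y\<in>ball x \<delta> \<inter> \<Omega>. ennreal ((u y - c)\<^sup>2) \<partial>lborel)
        \<le> ennreal L * ((\<integral>\<^sup>+y\<in>\<Omega>. ennreal ((norm (g y))\<^sup>2) \<partial>lborel)
             + (\<integral>\<^sup>+y\<in>B. ennreal ((u y - c)\<^sup>2) \<partial>lborel)))" for x \<delta> L
  have "\<exists>\<delta> L. P x \<delta> L" if "x \<in> closure \<Omega>" for x
    using near[OF that] unfolding controls_oscillation_near_def P_def .
  then obtain \<delta> L where PL: "\<And>x. x \<in> closure \<Omega> \<Longrightarrow> P x (\<delta> x) (L x)" by metis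
  have \<delta>: "\<delta> x > 0" and L: "L x > 0" if "x \<in> closure \<Omega>" for x
    using PL[OF that] by (auto simp: P_def)
  have ctrl: "(\<integral>\<^sup>+y\<in>ball x (\<delta> x) \<inter> \<Omega>. ennreal ((u y - c)\<^sup>2) \<partial>lborel)
        \<le> ennreal (L x) * ((\<integral>\<^sup>+y\<in>\<Omega>. ennreal ((norm (g y))\<^sup>2) \<partial>lborel)
             + (\<integral>\<^sup>+y\<in>B. ennreal ((u y - c)\<^sup>2) \<partial>lborel))"
    if "x \<in> closure \<Omega>" "(\<forall>x\<in>\<Omega>. GDERIV u x :> g x) \<and> continuous_on \<Omega> g" for x u g c
    using PL[OF that(1)] that(2) unfolding P_def by blast
  have "compact (closure \<Omega>)" using \<Omega> by (simp add: compact_closure)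
  moreover have "closure \<Omega> \<subseteq> (\<Union>x\<in>closure \<Omega>. ball x (\<delta> x))" using \<delta> by force
  ultimately obtain X where X: "X \<subseteq> closure \<Omega>" "finite X" "closure \<Omega> \<subseteq> (\<Union>x\<in>X. ball x (\<delta> x))"
    by (elim compactE_image) auto
  obtain K0 where K0: "K0 > 0" and ball: "\<And>u g. (\<forall>x\<in>\<Omega>. GDERIV u x :> g x) \<and> continuous_on \<Omega> g \<longrightarrow>
     (\<exists>c. (\<integral>\<^sup>+x\<in>B. ennreal ((u x - c)\<^sup>2) \<partial>lborel)
        \<le> ennreal K0 * (\<integral>\<^sup>+x\<in>\<Omega>. ennreal ((norm (g x))\<^sup>2) \<partial>lborel))"
    using poincare_inequality_ball[OF \<Omega>(1) r] unfolding B_def by blast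
  define K where "K = (\<Sum>x\<in>X. L x) * (1 + K0)"
  have "X \<noteq> {}" using X \<open>z \<in> \<Omega>\<close> closure_subset[of \<Omega>] by auto
  then have K: "K > 0"
    unfolding K_def using X L K0 by (intro mult_pos_pos sum_pos) (auto simp: subset_iff)
  show ?thesis
  proof (rule exI[of _ K], intro conjI K allI impI)
    fix u :: "'a \<Rightarrow> real" and g assume u: "(\<forall>x\<in>\<Omega>. GDERIV u x :> g x) \<and> continuous_on \<Omega> g"
    define E where "E = (\<integral>\<^sup>+x\<in>\<Omega>. ennreal ((norm (g x))\<^sup>2) \<partial>lborel)"
    from ball[rule_format, OF u] obtain c where
      c: "(\<integral>\<^sup>+x\<in>B. ennreal ((u x - c)\<^sup>2) \<partial>lborel) \<le> ennreal K0 * E"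
      by (auto simp: E_def)
    have cu: "continuous_on \<Omega> u" using u by (intro GDERIV_imp_continuous_on) auto
    have "(\<integral>\<^sup>+x\<in>\<Omega>. ennreal ((u x - c)\<^sup>2) \<partial>lborel)
        \<le> (\<integral>\<^sup>+y. (\<Sum>x\<in>X. ennreal ((u y - c)\<^sup>2) * indicator (ball x (\<delta> x) \<inter> \<Omega>) y) \<partial>lborel)"
    proof (rule nn_integral_mono)
      fix y
      show "ennreal ((u y - c)\<^sup>2) * indicator \<Omega> y
         \<le> (\<Sum>x\<in>X. ennreal ((u y - c)\<^sup>2) * indicator (ball x (\<delta> x) \<inter> \<Omega>) y)"
      proof (cases "y \<in> \<Omega>")
        case True
        then obtain x where x: "x \<in> X" "y \<in> ball x (\<delta> x)" using X closure_subset[of \<Omega>] by blast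
        have "ennreal ((u y - c)\<^sup>2) * indicator (ball x (\<delta> x) \<inter> \<Omega>) y
           \<le> (\<Sum>x\<in>X. ennreal ((u y - c)\<^sup>2) * indicator (ball x (\<delta> x) \<inter> \<Omega>) y)"
          by (rule member_le_sum) (use x X in auto)
        then show ?thesis using x True by simp
      qed simp
    qed
    also have "\<dots> = (\<Sum>x\<in>X. \<integral>\<^sup>+y\<in>ball x (\<delta> x) \<inter> \<Omega>. ennreal ((u y - c)\<^sup>2) \<partial>lborel)"
      using borel_measurable_square_diff[OF open_Int[OF open_ball \<Omega>(1)] continuous_on_subset[OF cu Int_lower2]]
      by (intro nn_integral_sum) simp
    also have "\<dots> \<le> (\<Sum>x\<in>X. ennreal (L x) * (E + ennreal K0 * E))"
    proof (rule sum_mono)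
      fix x assume "x \<in> X"
      then have "x \<in> closure \<Omega>" using X by auto
      from ctrl[OF this u, of c]
      show "(\<integral>\<^sup>+y\<in>ball x (\<delta> x) \<inter> \<Omega>. ennreal ((u y - c)\<^sup>2) \<partial>lborel) \<le> ennreal (L x) * (E + ennreal K0 * E)"
        by (rule order_trans) (use c in \<open>auto simp: E_def intro!: mult_left_mono add_left_mono\<close>)
    qed
    also have "\<dots> = ennreal K * E"
    proof -
      have L0: "(\<Sum>x\<in>X. L x) \<ge> 0" using X L by (intro sum_nonneg) (auto simp: subset_iff less_imp_le)
      have "(\<Sum>x\<in>X. ennreal (L x)) = ennreal (\<Sum>x\<in>X. L x)"
        using X L by (intro sum_ennreal) (auto simp: subset_iff less_imp_le)
      moreover have "E + ennreal K0 * E = ennreal (1 + K0) * E"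
        using K0 by (subst ennreal_plus) (auto simp: distrib_right)
      moreover have "ennreal K = ennreal (\<Sum>x\<in>X. L x) * ennreal (1 + K0)"
        unfolding K_def using L0 K0 by (intro ennreal_mult) auto
      ultimately show ?thesis by (simp only: mult.assoc flip: sum_distrib_right)
    qed
    finally show "\<exists>c. (\<integral>\<^sup>+x\<in>\<Omega>. ennreal ((u x - c)\<^sup>2) \<partial>lborel)
        \<le> ennreal K * (\<integral>\<^sup>+x\<in>\<Omega>. ennreal ((norm (g x))\<^sup>2) \<partial>lborel)"
      unfolding E_def by blast
  qed
qed

section \<open>A divergence theorem without surface measure\<close>

lemma DERIV_pos_part_square: "DERIV (\<lambda>t::real. (max 0 t)\<^sup>2) t :> 2 * max 0 t"
proof -
  consider "t > 0" | "t < 0" | "t = 0" by linarith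
  then show ?thesis
  proof cases
    case 1
    have "DERIV (\<lambda>t. t\<^sup>2) t :> 2 * max 0 t"
      using 1 by (auto intro!: derivative_eq_intros)
    moreover have "eventually (\<lambda>t. t \<in> {0<..}) (nhds t)"
      using 1 by (intro eventually_nhds_in_open) auto
    then have "eventually (\<lambda>t::real. t\<^sup>2 = (max 0 t)\<^sup>2) (nhds t)"
      by eventually_elim auto
    ultimately show ?thesis by (subst (asm) DERIV_cong_ev) auto
  next
    case 2
    have "DERIV (\<lambda>t. 0) t :> 2 * max 0 t"
      using 2 by (auto intro!: derivative_eq_intros)
    moreover have "eventually (\<lambda>t. t \<in> {..<0}) (nhds t)"
      using 2 by (intro eventually_nhds_in_open) auto
    then have "eventually (\<lambda>t::real. 0 = (max 0 t)\<^sup>2) (nhds t)"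
      by eventually_elim auto
    ultimately show ?thesis by (subst (asm) DERIV_cong_ev) auto
  next
    case 3
    have "((\<lambda>h::real. (max 0 h)\<^sup>2 / h) \<longlongrightarrow> 0) (at 0)"
    proof (rule Lim_null_comparison)
      show "\<forall>\<^sub>F h in at 0. norm ((max 0 h)\<^sup>2 / h) \<le> \<bar>h::real\<bar>"
        by (rule always_eventually) (auto simp: power2_eq_square max_def)
      show "((\<lambda>h::real. \<bar>h\<bar>) \<longlongrightarrow> 0) (at 0)"
        by (rule tendsto_eq_intros) auto
    qed
    then show ?thesis using 3 by (simp add: DERIV_def)
  qed
qed

text \<open>A continuously differentiable step that vanishes for \<open>t \<le> 1\<close> and equals \<open>1\<close> for \<open>t \<ge> 2\<close>. Squares of positive parts
  are used because they are continuously differentiable without any gluing.\<close>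

definition smooth_step :: "real \<Rightarrow> real" where
  "smooth_step t = 1 - (max 0 (1 - (max 0 (t - 1))\<^sup>2))\<^sup>2"

definition smooth_step_deriv :: "real \<Rightarrow> real" where
  "smooth_step_deriv t = 4 * max 0 (1 - (max 0 (t - 1))\<^sup>2) * max 0 (t - 1)"

lemma DERIV_smooth_step: "DERIV smooth_step t :> smooth_step_deriv t"
proof -
  have "DERIV (\<lambda>t. (max 0 (t - 1))\<^sup>2) t :> (2 * max 0 (t - 1)) * 1"
    by (rule DERIV_chain2[OF DERIV_pos_part_square]) (auto intro!: derivative_eq_intros)
  from DERIV_diff[OF DERIV_const this, of 1]
  have "DERIV (\<lambda>t. 1 - (max 0 (t - 1))\<^sup>2) t :> - (2 * max 0 (t - 1))" by simp
  from DERIV_diff[OF DERIV_const DERIV_chain2[OF DERIV_pos_part_square this], of 1]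
  have "DERIV (\<lambda>t. 1 - (max 0 (1 - (max 0 (t - 1))\<^sup>2))\<^sup>2) t
     :> - (2 * max 0 (1 - (max 0 (t - 1))\<^sup>2) * - (2 * max 0 (t - 1)))"
    by simp
  then show ?thesis by (simp add: smooth_step_def[abs_def] smooth_step_deriv_def mult.assoc)
qed

lemma smooth_step_bounds: "0 \<le> smooth_step t" "smooth_step t \<le> 1"
proof -
  have "(max 0 (1 - (max 0 (t - 1))\<^sup>2))\<^sup>2 \<le> 1" by (rule power_le_one) auto
  then show "0 \<le> smooth_step t" "smooth_step t \<le> 1" by (auto simp: smooth_step_def)
qed

lemma smooth_step_eq_0: "t \<le> 1 \<Longrightarrow> smooth_step t = 0"
  by (simp add: smooth_step_def max_def)

lemma smooth_step_eq_1:
  assumes "t \<ge> 2" shows "smooth_step t = 1"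
proof -
  have "1 \<le> (t - 1)\<^sup>2" using assms by (intro one_le_power) auto
  then have "max 0 (1 - (max 0 (t - 1))\<^sup>2) = 0" using assms by simp
  then show ?thesis by (simp add: smooth_step_def)
qed

lemma smooth_step_deriv_nonneg: "0 \<le> smooth_step_deriv t"
  by (simp add: smooth_step_deriv_def)

lemma smooth_step_deriv_eq_0:
  assumes "t \<ge> 2" shows "smooth_step_deriv t = 0"
proof -
  have "1 \<le> (t - 1)\<^sup>2" using assms by (intro one_le_power) auto
  then have "max 0 (1 - (max 0 (t - 1))\<^sup>2) = 0" using assms by simp
  then show ?thesis by (simp add: smooth_step_deriv_def)
qed

lemma smooth_step_deriv_le: "smooth_step_deriv t \<le> 4"
proof (cases "t \<ge> 2")
  case False
  have "max 0 (1 - (max 0 (t - 1))\<^sup>2) * max 0 (t - 1) \<le> 1 * 1"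
    using False by (intro mult_mono) auto
  then show ?thesis by (simp add: smooth_step_deriv_def)
qed (simp add: smooth_step_deriv_eq_0)

lemma continuous_on_smooth_step_deriv [continuous_intros]:
  "continuous_on S f \<Longrightarrow> continuous_on S (\<lambda>x. smooth_step_deriv (f x))"
  unfolding smooth_step_deriv_def by (intro continuous_intros)

lemma continuous_on_smooth_step [continuous_intros]:
  "continuous_on S f \<Longrightarrow> continuous_on S (\<lambda>x. smooth_step (f x))"
  unfolding smooth_step_def by (intro continuous_intros)

lemma integral_lborel_translation:
  fixes f :: "'a::euclidean_space \<Rightarrow> real"
  assumes "integrable lborel f"
  shows "integrable lborel (\<lambda>x. f (h + x))" "(\<integral>x. f (h + x) \<partial>lborel) = (\<integral>x. f x \<partial>lborel)"
proof -
  have [measurable]: "f \<in> borel_measurable borel" using assms by auto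
  have d: "integrable (distr lborel borel ((+) h)) f" using assms by (simp add: lborel_distr_plus)
  then show "integrable lborel (\<lambda>x. f (h + x))" by (subst (asm) integrable_distr_eq) auto
  have "(\<integral>x. f (h + x) \<partial>lborel) = (\<integral>x. f x \<partial>distr lborel borel ((+) h))"
    by (subst integral_distr) auto
  then show "(\<integral>x. f (h + x) \<partial>lborel) = (\<integral>x. f x \<partial>lborel)" by (simp add: lborel_distr_plus)
qed

text \<open>The integral of each difference quotient vanishes by translation invariance, and the quotients
  converge to the derivative, dominated by \<open>M\<close> on a bounded set by the mean value theorem.\<close>

lemma integral_gradient_component_eq_0:
  fixes f :: "'a::euclidean_space \<Rightarrow> real"
  assumes f: "\<And>x. GDERIV f x :> g x"
    and M: "\<And>x. \<bar>e \<bullet> g x\<bar> \<le> M"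
    and supp: "\<And>x. norm x > R \<Longrightarrow> f x = 0"
  shows "integrable lborel (\<lambda>x. e \<bullet> g x)" "(\<integral>x. e \<bullet> g x \<partial>lborel) = 0"
proof -
  have cf: "continuous_on UNIV f"
    using f by (intro GDERIV_imp_continuous_on)
  then have [measurable]: "f \<in> borel_measurable borel" by (rule borel_measurable_continuous_onI)
  have "integrable lborel (\<lambda>x. indicator (cball 0 R) x *\<^sub>R f x)"
    by (rule borel_integrable_compact) (auto intro: continuous_on_subset[OF cf])
  moreover have "(\<lambda>x. indicator (cball 0 R) x *\<^sub>R f x) = f"
    using supp by (auto simp: fun_eq_iff indicator_def)
  ultimately have intf: "integrable lborel f" by simp
  have der: "DERIV (\<lambda>t. f (x + t *\<^sub>R e)) t :> e \<bullet> g (x + t *\<^sub>R e)" for x t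
  proof -
    have "((\<lambda>t. f (x + t *\<^sub>R e)) has_derivative (\<lambda>s. (s *\<^sub>R e) \<bullet> g (x + t *\<^sub>R e))) (at t)"
      by (rule has_derivative_compose[where g=f and f="\<lambda>t. x + t *\<^sub>R e" and f'="\<lambda>s. s *\<^sub>R e"])
         (use f in \<open>auto simp: gderiv_def intro!: derivative_eq_intros\<close>)
    then show ?thesis by (simp add: has_field_derivative_def mult_commute_abs)
  qed
  define \<tau> where "\<tau> n = inverse (real (Suc n))" for n
  have \<tau>: "\<tau> n > 0" "\<tau> n \<le> 1" for n by (auto simp: \<tau>_def divide_simps)
  define q where "q n x = (f (x + \<tau> n *\<^sub>R e) - f x) / \<tau> n" for n x
  have [measurable]: "q n \<in> borel_measurable borel" for n unfolding q_def by measurable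
  have lim: "(\<lambda>n. q n x) \<longlonglongrightarrow> e \<bullet> g x" for x
  proof -
    have "((\<lambda>h. (f (x + h *\<^sub>R e) - f x) / h) \<longlongrightarrow> e \<bullet> g x) (at 0)"
      using der[of x 0] by (simp add: DERIV_def)
    moreover have "filterlim \<tau> (at 0) sequentially"
      using LIMSEQ_inverse_real_of_nat by (auto simp: filterlim_at \<tau>_def[abs_def])
    ultimately show ?thesis unfolding q_def by (rule filterlim_compose)
  qed
  define C where "C = cball (0::'a) (R + norm e)"
  have M0: "M \<ge> 0" using M[of 0] by linarith
  have bound: "norm (q n x) \<le> M * indicator C x" for n x
  proof (cases "x \<in> C")
    case True
    obtain z where z: "0 < z" "z < \<tau> n" "f (x + \<tau> n *\<^sub>R e) - f (x + 0 *\<^sub>R e) = (\<tau> n - 0) * (e \<bullet> g (x + z *\<^sub>R e))"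
      using MVT2[of 0 "\<tau> n" "\<lambda>t. f (x + t *\<^sub>R e)" "\<lambda>t. e \<bullet> g (x + t *\<^sub>R e)"] \<tau> der by blast
    then have "q n x = e \<bullet> g (x + z *\<^sub>R e)" using \<tau>[of n] by (simp add: q_def)
    then show ?thesis using M True by simp
  next
    case False
    then have n: "norm x > R + norm e" by (simp add: C_def)
    have "norm (\<tau> n *\<^sub>R e) \<le> norm e" using \<tau>[of n] mult_left_le_one_le[of "norm e" "\<tau> n"] by simp
    moreover have "norm x \<le> norm (x + \<tau> n *\<^sub>R e) + norm (\<tau> n *\<^sub>R e)"
      using norm_triangle_ineq4[of "x + \<tau> n *\<^sub>R e" "\<tau> n *\<^sub>R e"] by simp
    ultimately have "norm (x + \<tau> n *\<^sub>R e) > R" using n by linarith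
    moreover have "norm x > R" using n norm_ge_zero[of e] by linarith
    ultimately show ?thesis using False supp by (simp add: q_def)
  qed
  have intC: "integrable lborel (\<lambda>x. M * indicator C x)"
    using emeasure_bounded_finite[of C] by (auto simp: C_def)
  have m: "(\<lambda>x. e \<bullet> g x) \<in> borel_measurable lborel"
    by (rule borel_measurable_LIMSEQ_real[OF lim]) auto
  show "integrable lborel (\<lambda>x. e \<bullet> g x)"
    by (rule integrable_dominated_convergence[where s=q and w="\<lambda>x. M * indicator C x", OF m _ intC]) (use lim bound in auto)
  have "(\<lambda>n. \<integral>x. q n x \<partial>lborel) \<longlonglongrightarrow> (\<integral>x. e \<bullet> g x \<partial>lborel)"
    by (rule integral_dominated_convergence[where w="\<lambda>x. M * indicator C x", OF m _ intC]) (use lim bound in auto)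
  moreover have "(\<integral>x. q n x \<partial>lborel) = 0" for n
    using integral_lborel_translation[OF intf, of "\<tau> n *\<^sub>R e"] intf
    unfolding q_def by (subst Bochner_Integration.integral_divide_zero) (simp add: add.commute)
  ultimately show "(\<integral>x. e \<bullet> g x \<partial>lborel) = 0" by (simp add: LIMSEQ_const_iff)
qed

text \<open>Turns the pointwise limits at boundary points into uniform smallness on a strip \<open>\<Psi> < \<delta>\<close>: points violating
  it for ever smaller \<open>\<delta>\<close> would accumulate, by compactness, at a boundary point.\<close>

lemma small_near_boundary:
  fixes \<Psi> k :: "'a::euclidean_space \<Rightarrow> real"
  assumes \<Omega>: "open \<Omega>" "bounded \<Omega>"
    and \<Psi>: "continuous_on UNIV \<Psi>" "\<And>x. x \<in> \<Omega> \<Longrightarrow> \<Psi> x > 0"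
    and k: "\<And>x. x \<in> frontier \<Omega> \<Longrightarrow> (k \<longlongrightarrow> 0) (at x within \<Omega>)"
    and e: "e > 0"
  shows "\<exists>\<delta>>0. \<forall>x\<in>\<Omega>. \<Psi> x < \<delta> \<longrightarrow> \<bar>k x\<bar> < e"
proof (rule ccontr)
  assume "\<not> ?thesis"
  then have *: "\<exists>x\<in>\<Omega>. \<Psi> x < \<delta> \<and> \<bar>k x\<bar> \<ge> e" if "\<delta> > 0" for \<delta>
    using that \<open>\<not> _\<close> by (meson not_less)
  have "\<exists>x\<in>\<Omega>. \<Psi> x < inverse (real (Suc n)) \<and> \<bar>k x\<bar> \<ge> e" for n
    by (rule *) simp
  then obtain y where y: "\<And>n. y n \<in> \<Omega>" "\<And>n. \<Psi> (y n) < inverse (real (Suc n))" "\<And>n. \<bar>k (y n)\<bar> \<ge> e"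
    by metis
  have "compact (closure \<Omega>)" using \<Omega> by (simp add: compact_closure)
  moreover have "\<forall>n. y n \<in> closure \<Omega>" using y(1) closure_subset by blast
  ultimately obtain x r where x: "x \<in> closure \<Omega>" "strict_mono r" "(y \<circ> r) \<longlonglongrightarrow> x"
    unfolding compact_def by meson
  have "(\<lambda>n. \<Psi> ((y \<circ> r) n)) \<longlonglongrightarrow> \<Psi> x"
    by (rule isCont_tendsto_compose[OF _ x(3)]) (use \<Psi>(1) in \<open>auto simp: continuous_on_eq_continuous_within\<close>)
  moreover have "(\<lambda>n. inverse (real (Suc (r n)))) \<longlonglongrightarrow> 0"
    using LIMSEQ_subseq_LIMSEQ[OF LIMSEQ_inverse_real_of_nat x(2)] by (simp add: o_def)
  ultimately have "\<Psi> x \<le> 0"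
    by (rule LIMSEQ_le) (use y(2) in \<open>auto intro: less_imp_le\<close>)
  then have "x \<notin> \<Omega>" using \<Psi>(2)[of x] by auto
  then have fr: "x \<in> frontier \<Omega>" using x(1) \<Omega>(1) by (simp add: frontier_def interior_open)
  have "filterlim (y \<circ> r) (at x within \<Omega>) sequentially"
    using x(3) y(1) \<open>x \<notin> \<Omega>\<close> by (auto simp: filterlim_at intro!: always_eventually)
  then have "(\<lambda>n. k ((y \<circ> r) n)) \<longlonglongrightarrow> 0" by (rule filterlim_compose[OF k[OF fr]])
  then have "\<forall>\<^sub>F n in sequentially. \<bar>k ((y \<circ> r) n)\<bar> < e"
    using e by (simp add: tendsto_iff)
  then show False using y(3) by (auto simp: eventually_sequentially not_less[symmetric])
qed

text \<open>The field \<open>\<eta>(\<Psi>/\<delta>) F\<close>, extended by zero, has compact support in \<open>\<Omega>\<close>, so its divergence integrates to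
  zero. As \<open>\<delta> \<rightarrow> 0\<close>, the term \<open>\<eta>(\<Psi>/\<delta>) div F\<close> converges to \<open>div F\<close>. The other term is
  supported in the strip \<open>\<Psi> < 2\<delta>\<close> and bounded by \<open>(4/\<delta>) |F \<bullet> \<nabla>\<Psi>|\<close>; since the volume of the strip is \<open>O(\<delta>)\<close> and
  \<open>F \<bullet> \<nabla>\<Psi>\<close> tends to zero at the boundary, it disappears.\<close>

theorem integral_divergence_eq_0:
  fixes \<Omega> :: "(real ^ 'n) set" and F :: "real ^ 'n \<Rightarrow> real ^ 'n"
  assumes \<Omega>: "open \<Omega>" "bounded \<Omega>"
    and \<Psi>: "\<And>x. GDERIV \<Psi> x :> P x" "continuous_on UNIV P"
    and pos: "\<And>x. x \<in> \<Omega> \<Longrightarrow> \<Psi> x > 0" and neg: "\<And>x. x \<notin> \<Omega> \<Longrightarrow> \<Psi> x \<le> 0"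
    and strip: "\<And>\<delta>. \<delta> > 0 \<Longrightarrow> measure lborel {x\<in>\<Omega>. \<Psi> x < \<delta>} \<le> K * \<delta>"
    and F: "\<And>x j. x \<in> \<Omega> \<Longrightarrow> GDERIV (\<lambda>y. F y $ j) x :> G j x"
    and bF: "bounded (F ` \<Omega>)" and bG: "\<And>j. bounded (G j ` \<Omega>)" and cG: "\<And>j. continuous_on \<Omega> (G j)"
    and tangential: "\<And>x. x \<in> frontier \<Omega> \<Longrightarrow> ((\<lambda>y. F y \<bullet> P y) \<longlongrightarrow> 0) (at x within \<Omega>)"
  shows "(\<integral>x. indicator \<Omega> x * (\<Sum>j\<in>UNIV. G j x $ j) \<partial>lborel) = 0"
proof -
  have [measurable]: "\<Omega> \<in> sets borel" using \<Omega> by auto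
  have c\<Psi>: "continuous_on S \<Psi>" for S
    using \<Psi>(1) by (intro GDERIV_imp_continuous_on)
  have cF: "continuous_on \<Omega> F"
  proof -
    have "continuous_on \<Omega> (\<lambda>y. F y $ j)" for j
      by (rule GDERIV_imp_continuous_on[OF F])
    then have "continuous_on \<Omega> (\<lambda>y. \<chi> j. F y $ j)" by (intro continuous_on_vec_lambda)
    then show ?thesis by simp
  qed
  have cP: "continuous_on S P" for S using \<Psi>(2) continuous_on_subset by blast
  obtain R where R: "\<And>x. x \<in> \<Omega> \<Longrightarrow> norm x \<le> R" using \<Omega>(2) by (auto simp: bounded_iff)
  obtain MF where MF: "\<And>x. x \<in> \<Omega> \<Longrightarrow> norm (F x) \<le> MF" using bF by (auto simp: bounded_iff)
  have "\<forall>j. \<exists>M. \<forall>x\<in>\<Omega>. norm (G j x) \<le> M" using bG by (auto simp: bounded_iff)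
  then obtain MG where MG: "\<And>x j. x \<in> \<Omega> \<Longrightarrow> norm (G j x) \<le> MG j" by metis
  have "bounded (P ` closure \<Omega>)"
    by (intro compact_imp_bounded compact_continuous_image cP) (use \<Omega> in \<open>simp add: compact_closure\<close>)
  then obtain MP where MP: "\<And>x. x \<in> \<Omega> \<Longrightarrow> norm (P x) \<le> MP"
    using closure_subset[of \<Omega>] by (fastforce simp: bounded_iff)
  have fin: "emeasure lborel S < \<infinity>" if "S \<subseteq> \<Omega>" for S
    using emeasure_bounded_finite[OF bounded_subset[OF \<Omega>(2) that]] by simp
  have int: "integrable lborel (\<lambda>x. indicator \<Omega> x * h x)"
    if "continuous_on \<Omega> h" "\<And>x. x \<in> \<Omega> \<Longrightarrow> \<bar>h x\<bar> \<le> M" for h :: "real ^ 'n \<Rightarrow> real" and M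
  proof (rule Bochner_Integration.integrable_bound)
    show "integrable lborel (\<lambda>x. M * indicator \<Omega> x)" using fin[of \<Omega>] by auto
    show "(\<lambda>x. indicator \<Omega> x * h x) \<in> borel_measurable lborel"
      using borel_measurable_continuous_on_indicator[OF _ that(1)] by simp
  qed (use that(2) in \<open>auto simp: indicator_def intro: order_trans[OF _ abs_ge_self]\<close>)
  define divF where "divF x = (\<Sum>j\<in>UNIV. G j x $ j)" for x
  have cdivF: "continuous_on \<Omega> divF" unfolding divF_def by (intro continuous_intros cG)
  have bdivF: "\<bar>divF x\<bar> \<le> (\<Sum>j\<in>UNIV. MG j)" if "x \<in> \<Omega>" for x
    unfolding divF_def
    by (rule order_trans[OF sum_abs sum_mono]) (use MG[OF that] component_le_norm_cart order_trans in blast)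
  define cut where "cut \<delta> x = smooth_step (\<Psi> x / \<delta>)" for \<delta> x
  define cut' where "cut' \<delta> x = smooth_step_deriv (\<Psi> x / \<delta>) / \<delta>" for \<delta> x
  have ccut: "continuous_on S (cut \<delta>)" if "\<delta> > 0" for \<delta> S
    unfolding cut_def using that by (intro continuous_intros c\<Psi>) auto
  have ccut': "continuous_on S (cut' \<delta>)" if "\<delta> > 0" for \<delta> S
    unfolding cut'_def using that by (intro continuous_intros c\<Psi>) auto
  have bcut: "\<bar>cut \<delta> x\<bar> \<le> 1" for \<delta> x
    using smooth_step_bounds[of "\<Psi> x / \<delta>"] by (simp add: cut_def)
  have bcut': "\<bar>cut' \<delta> x\<bar> \<le> 4 / \<delta>" if "\<delta> > 0" for \<delta> x
    using smooth_step_deriv_nonneg smooth_step_deriv_le that by (simp add: cut'_def divide_right_mono)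
  have "integrable lborel (\<lambda>x. indicator \<Omega> x * (cut' \<delta> x * (F x \<bullet> P x)))
      \<and> (\<integral>x. indicator \<Omega> x * (cut' \<delta> x * (F x \<bullet> P x)) \<partial>lborel)
        + (\<integral>x. indicator \<Omega> x * (cut \<delta> x * divF x) \<partial>lborel) = 0"
    if \<delta>: "\<delta> > 0" for \<delta>
  proof -
    define g where "g j x = (if x \<in> \<Omega> then cut \<delta> x *\<^sub>R G j x + (F x $ j * cut' \<delta> x) *\<^sub>R P x else 0)" for j x
    have g: "GDERIV (\<lambda>x. if x \<in> \<Omega> then cut \<delta> x * F x $ j else 0) x :> g j x" for j x
    proof (cases "x \<in> \<Omega>")
      case True
      have "GDERIV (cut \<delta>) x :> cut' \<delta> x *\<^sub>R P x"
      proof -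
        have "DERIV (\<lambda>t. smooth_step (t / \<delta>)) (\<Psi> x) :> smooth_step_deriv (\<Psi> x / \<delta>) * (1 / \<delta>)"
          by (rule DERIV_chain2[OF DERIV_smooth_step]) (use \<delta> in \<open>auto intro!: derivative_eq_intros\<close>)
        from GDERIV_DERIV_compose[OF \<Psi>(1) this] show ?thesis by (simp add: cut_def[abs_def] cut'_def)
      qed
      from GDERIV_mult[OF this F[OF True]]
      have "GDERIV (\<lambda>x. cut \<delta> x * F x $ j) x :> g j x" using True by (simp add: g_def)
      then show ?thesis
        unfolding gderiv_def
        by (rule has_derivative_transform_within_open[OF _ \<Omega>(1) True]) auto
    next
      case False
      define T where "T = {y. \<Psi> y < \<delta>}"
      have T: "open T" unfolding T_def by (intro open_Collect_less c\<Psi> continuous_intros)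
      have "x \<in> T" using neg[OF False] \<delta> by (simp add: T_def)
      have "((\<lambda>y. 0) has_derivative (\<lambda>h. h \<bullet> g j x)) (at x)" using False by (simp add: g_def)
      then show ?thesis
        unfolding gderiv_def
        by (rule has_derivative_transform_within_open[OF _ T \<open>x \<in> T\<close>])
           (use \<delta> in \<open>auto simp: T_def cut_def smooth_step_eq_0\<close>)
    qed
    have bound: "\<bar>axis j 1 \<bullet> g j x\<bar> \<le> \<bar>MG j\<bar> + \<bar>MF\<bar> * (4 / \<delta>) * \<bar>MP\<bar>" for j x
    proof (cases "x \<in> \<Omega>")
      case True
      have "\<bar>axis j 1 \<bullet> g j x\<bar> \<le> norm (g j x)"
        using component_le_norm_cart[of "g j x" j] by (simp add: inner_axis')
      also have "\<dots> \<le> \<bar>cut \<delta> x\<bar> * norm (G j x) + (\<bar>F x $ j\<bar> * \<bar>cut' \<delta> x\<bar>) * norm (P x)"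
        using True norm_triangle_ineq[of "cut \<delta> x *\<^sub>R G j x" "(F x $ j * cut' \<delta> x) *\<^sub>R P x"]
        by (simp add: g_def abs_mult)
      also have "\<dots> \<le> 1 * \<bar>MG j\<bar> + (\<bar>MF\<bar> * (4 / \<delta>)) * \<bar>MP\<bar>"
        using bcut[of \<delta> x] bcut'[OF \<delta>, of x] MG[OF True, of j] MF[OF True] MP[OF True] \<delta>
          component_le_norm_cart[of "F x" j]
        by (intro add_mono mult_mono) auto
      finally show ?thesis by simp
    qed (use \<delta> in \<open>simp add: g_def\<close>)
    have supp: "(if x \<in> \<Omega> then cut \<delta> x * F x $ j else 0) = 0" if "norm x > R" for x j
      using R[of x] that by auto
    note zero = integral_gradient_component_eq_0[OF g bound supp]
    have sum: "(\<Sum>j\<in>UNIV. axis j 1 \<bullet> g j x)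
        = indicator \<Omega> x * (cut' \<delta> x * (F x \<bullet> P x)) + indicator \<Omega> x * (cut \<delta> x * divF x)" for x
    proof -
      have "F x \<bullet> P x = (\<Sum>j\<in>UNIV. F x $ j * P x $ j)" by (simp add: inner_vec_def)
      then show ?thesis
        by (auto simp: g_def divF_def inner_axis' sum.distrib sum_distrib_left indicator_def mult_ac)
    qed
    have "(\<integral>x. (\<Sum>j\<in>UNIV. axis j 1 \<bullet> g j x) \<partial>lborel) = 0"
      by (subst Bochner_Integration.integral_sum) (use zero in auto)
    moreover have 1: "integrable lborel (\<lambda>x. indicator \<Omega> x * (cut' \<delta> x * (F x \<bullet> P x)))"
    proof (rule int)
      fix x assume "x \<in> \<Omega>"
      then show "\<bar>cut' \<delta> x * (F x \<bullet> P x)\<bar> \<le> 4 / \<delta> * (\<bar>MF\<bar> * \<bar>MP\<bar>)"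
        using bcut'[OF \<delta>, of x] MF MP \<delta> Cauchy_Schwarz_ineq2[of "F x" "P x"]
        unfolding abs_mult
        by (intro mult_mono order_trans[OF Cauchy_Schwarz_ineq2]) (auto intro: order_trans[OF _ abs_ge_self])
    qed (intro continuous_intros ccut' \<delta> cF cP)
    moreover have "integrable lborel (\<lambda>x. indicator \<Omega> x * (cut \<delta> x * divF x))"
    proof (rule int)
      fix x assume "x \<in> \<Omega>"
      then show "\<bar>cut \<delta> x * divF x\<bar> \<le> 1 * (\<Sum>j\<in>UNIV. MG j)"
        unfolding abs_mult using bcut bdivF by (intro mult_mono) auto
    qed (intro continuous_intros ccut \<delta> cdivF)
    ultimately show ?thesis by (simp add: sum)
  qed
  then have intcut': "integrable lborel (\<lambda>x. indicator \<Omega> x * (cut' \<delta> x * (F x \<bullet> P x)))"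
    and split: "(\<integral>x. indicator \<Omega> x * (cut \<delta> x * divF x) \<partial>lborel)
        = - (\<integral>x. indicator \<Omega> x * (cut' \<delta> x * (F x \<bullet> P x)) \<partial>lborel)"
    if "\<delta> > 0" for \<delta> using that by (auto simp: eq_neg_iff_add_eq_0 add.commute)
  define \<tau> where "\<tau> n = inverse (real (Suc n))" for n
  have \<tau>: "\<tau> n > 0" for n by (simp add: \<tau>_def)
  have \<tau>0: "\<tau> \<longlonglongrightarrow> 0" unfolding \<tau>_def[abs_def] by (rule LIMSEQ_inverse_real_of_nat)
  have lim1: "(\<lambda>n. \<integral>x. indicator \<Omega> x * (cut (\<tau> n) x * divF x) \<partial>lborel) \<longlonglongrightarrow> (\<integral>x. indicator \<Omega> x * divF x \<partial>lborel)"
  proof (rule integral_dominated_convergence[where w="\<lambda>x. (\<Sum>j\<in>UNIV. MG j) * indicator \<Omega> x"])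
    show "integrable lborel (\<lambda>x. (\<Sum>j\<in>UNIV. MG j) * indicator \<Omega> x)" using fin[of \<Omega>] by auto
    show "(\<lambda>x. indicator \<Omega> x * divF x) \<in> borel_measurable lborel"
      using borel_measurable_continuous_on_indicator[OF _ cdivF] by simp
    show "(\<lambda>x. indicator \<Omega> x * (cut (\<tau> n) x * divF x)) \<in> borel_measurable lborel" for n
      using borel_measurable_continuous_on_indicator[OF _ continuous_on_mult[OF ccut[OF \<tau>[of n]] cdivF]] by simp
    show "AE x in lborel. (\<lambda>n. indicator \<Omega> x * (cut (\<tau> n) x * divF x)) \<longlonglongrightarrow> indicator \<Omega> x * divF x"
    proof (intro AE_I2)
      fix x
      show "(\<lambda>n. indicator \<Omega> x * (cut (\<tau> n) x * divF x)) \<longlonglongrightarrow> indicator \<Omega> x * divF x"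
      proof (cases "x \<in> \<Omega>")
        case True
        have "\<forall>\<^sub>F n in sequentially. \<tau> n < \<Psi> x / 2"
          using order_tendstoD(2)[OF \<tau>0, of "\<Psi> x / 2"] pos[OF True] by simp
        then have "\<forall>\<^sub>F n in sequentially. indicator \<Omega> x * divF x = indicator \<Omega> x * (cut (\<tau> n) x * divF x)"
        proof eventually_elim
          case (elim n)
          then have "2 \<le> \<Psi> x / \<tau> n" using \<tau>[of n] by (simp add: field_simps)
          then show ?case by (simp add: cut_def smooth_step_eq_1)
        qed
        then show ?thesis by (rule Lim_transform_eventually[OF tendsto_const])
      qed simp
    qed
    show "AE x in lborel. norm (indicator \<Omega> x * (cut (\<tau> n) x * divF x)) \<le> (\<Sum>j\<in>UNIV. MG j) * indicator \<Omega> x" for n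
    proof (intro AE_I2)
      fix x
      have "\<bar>cut (\<tau> n) x\<bar> * \<bar>divF x\<bar> \<le> 1 * (\<Sum>j\<in>UNIV. MG j)" if "x \<in> \<Omega>"
        using bcut bdivF[OF that] by (intro mult_mono) auto
      then show "norm (indicator \<Omega> x * (cut (\<tau> n) x * divF x)) \<le> (\<Sum>j\<in>UNIV. MG j) * indicator \<Omega> x"
        by (auto simp: indicator_def abs_mult)
    qed
  qed
  have lim2: "(\<lambda>n. \<integral>x. indicator \<Omega> x * (cut (\<tau> n) x * divF x) \<partial>lborel) \<longlonglongrightarrow> 0"
  proof (rule LIMSEQ_I)
    fix e :: real assume e: "e > 0"
    have K: "K \<ge> 0" using strip[of 1] measure_nonneg[of lborel "{x\<in>\<Omega>. \<Psi> x < 1}"] by linarith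
    \<comment> \<open>The flux through the strip is at most \<open>(4/\<tau>) e' \<cdot> K (2\<tau>) = 8 K e'\<close>; the summand \<open>1\<close> covers \<open>K = 0\<close>.\<close>
    define e' where "e' = e / (8 * K + 1)"
    have e': "e' > 0" using e K by (simp add: e'_def)
    have "8 * K * e' < e" using e K by (simp add: e'_def field_simps)
    obtain \<delta> where \<delta>: "\<delta> > 0" and small: "\<And>x. x \<in> \<Omega> \<Longrightarrow> \<Psi> x < \<delta> \<Longrightarrow> \<bar>F x \<bullet> P x\<bar> < e'"
      using small_near_boundary[OF \<Omega> c\<Psi> pos tangential e'] by blast
    have "\<forall>\<^sub>F n in sequentially. \<tau> n < \<delta> / 2" using order_tendstoD(2)[OF \<tau>0, of "\<delta>/2"] \<delta> by simp
    then obtain N where N: "\<And>n. n \<ge> N \<Longrightarrow> \<tau> n < \<delta> / 2" by (auto simp: eventually_sequentially)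
    have "norm ((\<integral>x. indicator \<Omega> x * (cut (\<tau> n) x * divF x) \<partial>lborel) - 0) < e" if n: "n \<ge> N" for n
    proof -
      define S where "S = {x\<in>\<Omega>. \<Psi> x < 2 * \<tau> n}"
      have "S = \<Omega> \<inter> {x. \<Psi> x < 2 * \<tau> n}" by (auto simp: S_def)
      then have [measurable]: "S \<in> sets borel"
        using \<Omega>(1) by (auto intro!: borel_open open_Int open_Collect_less c\<Psi> continuous_intros)
      have Sfin: "emeasure lborel S < \<infinity>" by (rule fin) (auto simp: S_def)
      have "norm (\<integral>x. indicator \<Omega> x * (cut' (\<tau> n) x * (F x \<bullet> P x)) \<partial>lborel)
          \<le> (\<integral>x. (4 / \<tau> n * e') * indicator S x \<partial>lborel)"
      proof (rule Bochner_Integration.integral_norm_bound_integral[OF intcut'[OF \<tau>]])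
        show "integrable lborel (\<lambda>x. (4 / \<tau> n * e') * indicator S x)" using Sfin by auto
        fix x
        show "norm (indicator \<Omega> x * (cut' (\<tau> n) x * (F x \<bullet> P x))) \<le> 4 / \<tau> n * e' * indicator S x"
        proof (cases "x \<in> S")
          case True
          then have x: "x \<in> \<Omega>" "\<bar>F x \<bullet> P x\<bar> < e'" using small[of x] N[OF n] by (auto simp: S_def)
          have "\<bar>cut' (\<tau> n) x\<bar> * \<bar>F x \<bullet> P x\<bar> \<le> 4 / \<tau> n * e'"
            using bcut'[OF \<tau>[of n], of x] x \<tau>[of n] by (intro mult_mono) auto
          then show ?thesis using True x by (simp add: abs_mult)
        next
          case False
          have "cut' (\<tau> n) x = 0" if "x \<in> \<Omega>"
          proof -
            have "2 \<le> \<Psi> x / \<tau> n" using False that \<tau>[of n] by (auto simp: S_def field_simps)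
            then show ?thesis by (simp add: cut'_def smooth_step_deriv_eq_0)
          qed
          then show ?thesis using False by (auto simp: indicator_def)
        qed
      qed
      also have "\<dots> = 4 / \<tau> n * e' * measure lborel S" by simp
      also have "\<dots> \<le> 4 / \<tau> n * e' * (K * (2 * \<tau> n))"
        using strip[of "2 * \<tau> n"] \<tau>[of n] e' by (intro mult_left_mono) (auto simp: S_def)
      also have "\<dots> = 8 * K * e'" using \<tau>[of n] by simp
      finally show ?thesis using \<open>8 * K * e' < e\<close> split[OF \<tau>[of n]] by simp
    qed
    then show "\<exists>N. \<forall>n\<ge>N. norm ((\<integral>x. indicator \<Omega> x * (cut (\<tau> n) x * divF x) \<partial>lborel) - 0) < e" by blast
  qed
  from LIMSEQ_unique[OF lim1 lim2] show ?thesis by (simp add: divF_def)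
qed

section \<open>A defining function for a bounded smooth domain\<close>

lemma differentiable_imp_GDERIV:
  fixes f :: "real ^ 'n \<Rightarrow> real"
  assumes "f differentiable (at x)"
  shows "GDERIV f x :> (\<chi> j. partial_derivative j f x)"
proof -
  let ?f' = "frechet_derivative f (at x)"
  have f': "(f has_derivative ?f') (at x)" using assms by (simp add: frechet_derivative_works)
  then interpret linear ?f' by (rule has_derivative_linear)
  have "?f' h = h \<bullet> (\<chi> j. partial_derivative j f x)" for h
  proof -
    have "?f' h = ?f' (\<Sum>j\<in>UNIV. (h $ j) *\<^sub>R axis j 1)"
      using basis_expansion[of h] by (simp add: scalar_mult_eq_scaleR)
    also have "\<dots> = (\<Sum>j\<in>UNIV. h $ j * ?f' (axis j 1))" by (simp add: sum scale)
    finally show ?thesis by (simp add: partial_derivative_def inner_vec_def)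
  qed
  then have "?f' = (\<lambda>h. h \<bullet> (\<chi> j. partial_derivative j f x))" by (rule ext)
  then show ?thesis using f' unfolding gderiv_def by simp
qed

lemma smooth_on_continuous_gradient:
  assumes "smooth_on S f"
  shows "continuous_on S (\<lambda>x. \<chi> j. partial_derivative j f x)"
proof -
  have "continuous_on S (\<lambda>x. partial_derivative j f x)" for j
  proof (intro continuous_at_imp_continuous_on ballI differentiable_imp_continuous_within)
    fix x assume "x \<in> S"
    then have "iterated_partial [j] f differentiable (at x)" using assms unfolding smooth_on_def by blast
    then show "(\<lambda>x. partial_derivative j f x) differentiable (at x)" by simp
  qed
  then show ?thesis by (intro continuous_on_vec_lambda)
qed

text \<open>A height function that grows at unit speed in direction \<open>e\<close> has thin strips. The translates of the
  strip \<open>0 < \<psi> < \<delta>\<close> by \<open>k \<delta> e\<close> lie at heights between \<open>k \<delta>\<close> and \<open>(k+1) \<delta>\<close>, so they are disjoint, and about \<open>1/\<delta>\<close> of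
  them fit into a ball whose radius is larger by one.\<close>

lemma measure_strip_le:
  fixes \<psi> :: "'a::euclidean_space \<Rightarrow> real"
  assumes \<psi>: "continuous_on UNIV \<psi>" "\<And>x t. \<psi> (x + t *\<^sub>R e) = \<psi> x + t" and e: "norm e = 1"
    and \<delta>: "\<delta> > 0" and \<rho>: "\<rho> > 0"
  shows "measure lborel {x \<in> ball x\<^sub>0 \<rho>. 0 < \<psi> x \<and> \<psi> x < \<delta>} \<le> 2 * measure lborel (ball x\<^sub>0 (\<rho> + 1)) * \<delta>"
proof -
  define T where "T = {x \<in> ball x\<^sub>0 \<rho>. 0 < \<psi> x \<and> \<psi> x < \<delta>}"
  define B where "B = ball x\<^sub>0 (\<rho> + 1)"
  have "T = ball x\<^sub>0 \<rho> \<inter> {x. 0 < \<psi> x} \<inter> {x. \<psi> x < \<delta>}" by (auto simp: T_def)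
  then have T [measurable]: "T \<in> sets borel"
    using \<psi>(1) by (auto intro!: borel_open open_Int open_Collect_less continuous_intros)
  have TB: "T \<subseteq> B" by (auto simp: T_def B_def)
  have Bm: "B \<in> fmeasurable lborel" unfolding B_def using emeasure_bounded_finite[of "ball x\<^sub>0 (\<rho> + 1)"]
    by (auto simp: fmeasurable_def)
  have Tm: "T \<in> fmeasurable lborel" using fmeasurableI2[OF Bm TB] by simp
  show ?thesis
  proof (cases "\<delta> \<ge> 1 / 2")
    case True
    have "measure lborel T \<le> measure lborel B" by (rule measure_mono_fmeasurable[OF TB _ Bm]) simp
    also have "\<dots> \<le> measure lborel B * (2 * \<delta>)"
      using mult_left_mono[of 1 "2 * \<delta>" "measure lborel B"] True by simp
    finally show ?thesis unfolding T_def B_def by (simp add: mult_ac)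
  next
    case False
    define N where "N = nat \<lfloor>1 / \<delta>\<rfloor>"
    have N: "real N * \<delta> \<le> 1" "1 \<le> 2 * \<delta> * real N"
    proof -
      have rN: "real N = of_int \<lfloor>1 / \<delta>\<rfloor>" using \<delta> by (simp add: N_def)
      have "real N \<le> 1 / \<delta>" unfolding rN by linarith
      then show "real N * \<delta> \<le> 1" using \<delta> by (simp add: field_simps)
      have "real N \<ge> 1 / \<delta> - 1" unfolding rN by linarith
      then have "\<delta> * real N \<ge> \<delta> * (1 / \<delta> - 1)" using \<delta> by (intro mult_left_mono) auto
      then have "\<delta> * real N \<ge> 1 - \<delta>" using \<delta> by (simp add: right_diff_distrib)
      then show "1 \<le> 2 * \<delta> * real N" using False by linarith
    qed
    define A where "A k = (+) ((real k * \<delta>) *\<^sub>R e) ` T" for k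
    have eqT: "emeasure lborel (A k) = emeasure lborel T" and Ab: "A k \<in> sets borel" for k
    proof -
      let ?h = "(real k * \<delta>) *\<^sub>R e"
      have Aeq: "A k = (+) (- ?h) -` T"
        by (auto simp: A_def image_iff intro!: bexI[of _ "_ - ?h"])
      then show "A k \<in> sets borel" using measurable_sets[of "(+) (- ?h)" borel borel T] T by simp
      have "emeasure lborel T = emeasure (distr lborel borel ((+) (- ?h))) T" by (simp add: lborel_distr_plus)
      also have "\<dots> = emeasure lborel (A k)" unfolding Aeq by (subst emeasure_distr) auto
      finally show "emeasure lborel (A k) = emeasure lborel T" by simp
    qed
    have in_A: "real k * \<delta> < \<psi> x \<and> \<psi> x < (real k + 1) * \<delta>" if "x \<in> A k" for x k
    proof -
      obtain y where y: "y \<in> T" "x = y + (real k * \<delta>) *\<^sub>R e" using \<open>x \<in> A k\<close> by (auto simp: A_def add.commute)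
      then show ?thesis by (simp add: \<psi>(2) T_def algebra_simps)
    qed
    have disj: "disjoint_family_on A {..<N}"
    proof (clarsimp simp: disjoint_family_on_def set_eq_iff)
      fix m n x assume "m \<noteq> n" "x \<in> A m" "x \<in> A n"
      then have "real m * \<delta> < (real n + 1) * \<delta>" "real n * \<delta> < (real m + 1) * \<delta>"
        using in_A[of x m] in_A[of x n] by linarith+
      then have "real m < real n + 1" "real n < real m + 1" using \<delta> by simp_all
      then show False using \<open>m \<noteq> n\<close> by linarith
    qed
    have sub: "(\<Union>k<N. A k) \<subseteq> B"
    proof (clarify)
      fix x k assume k: "k < N" "x \<in> A k"
      obtain y where y: "y \<in> T" "x = y + (real k * \<delta>) *\<^sub>R e" using \<open>x \<in> A k\<close> by (auto simp: A_def add.commute)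
      have "real k * \<delta> \<le> 1"
        using N(1) k \<delta> mult_right_mono[of "real k" "real N" \<delta>] by linarith
      then have "norm ((real k * \<delta>) *\<^sub>R e) \<le> 1" using e \<delta> by simp
      moreover have "dist x\<^sub>0 x \<le> dist x\<^sub>0 y + dist y x" by (rule dist_triangle)
      moreover have "dist y x = norm ((real k * \<delta>) *\<^sub>R e)" using y by (simp add: dist_norm)
      ultimately show "x \<in> B" using y by (simp add: B_def T_def)
    qed
    have "ennreal (real N * measure lborel T) = of_nat N * emeasure lborel T"
      using Tm by (simp add: emeasure_eq_measure2 ennreal_mult ennreal_of_nat_eq_real_of_nat)
    also have "\<dots> = (\<Sum>k<N. emeasure lborel (A k))" by (simp add: eqT)
    also have "\<dots> = emeasure lborel (\<Union>k<N. A k)"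
      by (rule sum_emeasure) (use Ab disj in auto)
    also have "\<dots> \<le> emeasure lborel B" by (rule emeasure_mono[OF sub]) (simp add: B_def)
    also have "\<dots> = ennreal (measure lborel B)" using Bm by (simp add: emeasure_eq_measure2)
    finally have NT: "real N * measure lborel T \<le> measure lborel B" by simp
    have "measure lborel T = 1 * measure lborel T" by simp
    also have "\<dots> \<le> (2 * \<delta> * real N) * measure lborel T" using N(2) by (intro mult_right_mono) auto
    also have "\<dots> = 2 * \<delta> * (real N * measure lborel T)" by simp
    also have "\<dots> \<le> 2 * \<delta> * measure lborel B" using NT \<delta> by (intro mult_left_mono) auto
    finally show ?thesis unfolding T_def B_def by (simp add: mult_ac)
  qed
qed

text \<open>The Neumann condition for \<open>u\<close>, read as a property of the vector field \<open>\<nabla>u\<close>.\<close>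

definition asymptotically_tangential :: "(real ^ 'n::finite) set \<Rightarrow> (real ^ 'n \<Rightarrow> real ^ 'n) \<Rightarrow> bool" where
  "asymptotically_tangential \<Omega> V \<longleftrightarrow> bounded (V ` \<Omega>) \<and>
     (\<forall>y\<in>frontier \<Omega>. \<forall>\<nu>. outer_unit_normal \<Omega> y \<nu> \<longrightarrow> ((\<lambda>x. V x \<bullet> \<nu>) \<longlongrightarrow> 0) (at y within \<Omega>))"

lemma tendsto_0_inner_bounded:
  fixes V Q :: "'a::metric_space \<Rightarrow> 'b::real_inner"
  assumes V: "bounded (V ` \<Omega>)" and Q: "(Q \<longlongrightarrow> 0) (at y within \<Omega>)"
  shows "((\<lambda>x. V x \<bullet> Q x) \<longlongrightarrow> 0) (at y within \<Omega>)"
proof -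
  obtain M where M: "\<And>x. x \<in> \<Omega> \<Longrightarrow> norm (V x) \<le> M" using V by (auto simp: bounded_iff)
  show ?thesis
  proof (rule Lim_null_comparison)
    show "\<forall>\<^sub>F x in at y within \<Omega>. norm (V x \<bullet> Q x) \<le> M * norm (Q x)"
      unfolding eventually_at_topological
    proof (intro exI[of _ UNIV] conjI ballI impI)
      fix x assume "x \<in> \<Omega>"
      then show "norm (V x \<bullet> Q x) \<le> M * norm (Q x)"
        using Cauchy_Schwarz_ineq2[of "V x" "Q x"] mult_right_mono[OF M[of x] norm_ge_zero[of "Q x"]] by simp
    qed auto
    show "((\<lambda>x. M * norm (Q x)) \<longlongrightarrow> 0) (at y within \<Omega>)"
      using tendsto_mult_left[OF tendsto_norm[OF Q], of M] by simp
  qed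
qed

text \<open>The height above the graph of a chart, \<open>\<psi> x = \<epsilon> x\<^sub>i - \<gamma> x\<close>, is a local defining function that grows at
  unit speed in the direction \<open>\<epsilon> e\<^sub>i\<close>.\<close>

lemma boundary_chart_height:
  fixes \<Omega> :: "(real ^ 'n::finite) set"
  assumes chart: "boundary_chart \<Omega> x\<^sub>0 \<rho> i \<epsilon> \<gamma>"
  shows "GDERIV (\<lambda>x. \<epsilon> * x $ i - \<gamma> x) x :> \<epsilon> *\<^sub>R axis i 1 - (\<chi> j. partial_derivative j \<gamma> x)"
    and "continuous_on UNIV (\<lambda>x. \<epsilon> *\<^sub>R axis i 1 - (\<chi> j. partial_derivative j \<gamma> x))"
    and "y \<in> ball x\<^sub>0 \<rho> \<Longrightarrow> y \<in> \<Omega> \<longleftrightarrow> \<epsilon> * y $ i - \<gamma> y > 0"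
    and "\<epsilon> * (x + t *\<^sub>R \<epsilon> *\<^sub>R axis i 1) $ i - \<gamma> (x + t *\<^sub>R \<epsilon> *\<^sub>R axis i 1) = \<epsilon> * x $ i - \<gamma> x + t"
    and "norm (\<epsilon> *\<^sub>R axis i 1 :: real ^ 'n) = 1"
proof -
  have \<epsilon>: "\<epsilon> = 1 \<or> \<epsilon> = - 1" and \<gamma>: "smooth_on UNIV \<gamma>"
    and inv: "\<And>x t. \<gamma> (x + t *\<^sub>R axis i 1) = \<gamma> x"
    and dom: "\<Omega> \<inter> ball x\<^sub>0 \<rho> = {x \<in> ball x\<^sub>0 \<rho>. \<epsilon> * x $ i > \<gamma> x}"
    using chart by (auto simp: boundary_chart_def)
  have "GDERIV \<gamma> x :> (\<chi> j. partial_derivative j \<gamma> x)"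
    using \<gamma>[unfolded smooth_on_def, rule_format, of x "[]"] by (intro differentiable_imp_GDERIV) simp
  moreover have "GDERIV (\<lambda>x. \<epsilon> * x $ i) x :> \<epsilon> *\<^sub>R axis i 1"
  proof -
    have "((\<lambda>x. x \<bullet> \<epsilon> *\<^sub>R axis i 1) has_derivative (\<lambda>h. h \<bullet> \<epsilon> *\<^sub>R axis i 1)) (at x)"
      by (intro derivative_intros)
    then show ?thesis by (simp add: gderiv_def inner_axis)
  qed
  ultimately show "GDERIV (\<lambda>x. \<epsilon> * x $ i - \<gamma> x) x :> \<epsilon> *\<^sub>R axis i 1 - (\<chi> j. partial_derivative j \<gamma> x)"
    by (rule GDERIV_diff[rotated])
  show "continuous_on UNIV (\<lambda>x. \<epsilon> *\<^sub>R axis i 1 - (\<chi> j. partial_derivative j \<gamma> x))"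
    by (intro continuous_intros smooth_on_continuous_gradient \<gamma>)
  show "y \<in> \<Omega> \<longleftrightarrow> \<epsilon> * y $ i - \<gamma> y > 0" if "y \<in> ball x\<^sub>0 \<rho>"
    using dom that by (auto simp: set_eq_iff)
  show "\<epsilon> * (x + t *\<^sub>R \<epsilon> *\<^sub>R axis i 1) $ i - \<gamma> (x + t *\<^sub>R \<epsilon> *\<^sub>R axis i 1) = \<epsilon> * x $ i - \<gamma> x + t"
    using inv[of x "t * \<epsilon>"] \<epsilon> by (auto simp: algebra_simps)
  show "norm (\<epsilon> *\<^sub>R axis i 1 :: real ^ 'n) = 1" using \<epsilon> by auto
qed

text \<open>A chart at one boundary point serves all boundary points nearby. This is what ties the gradient of the
  height function to the outer normal at each of them.\<close>

lemma boundary_chart_recenter: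
  assumes chart: "boundary_chart \<Omega> x\<^sub>0 \<rho> i \<epsilon> \<gamma>" and y: "y \<in> ball x\<^sub>0 \<rho>"
  shows "boundary_chart \<Omega> y (\<rho> - dist x\<^sub>0 y) i \<epsilon> \<gamma>"
proof -
  have sub: "ball y (\<rho> - dist x\<^sub>0 y) \<subseteq> ball x\<^sub>0 \<rho>"
  proof
    fix z assume "z \<in> ball y (\<rho> - dist x\<^sub>0 y)"
    then show "z \<in> ball x\<^sub>0 \<rho>" using dist_triangle[of x\<^sub>0 z y] by simp
  qed
  have dom: "\<Omega> \<inter> ball x\<^sub>0 \<rho> = {x \<in> ball x\<^sub>0 \<rho>. \<epsilon> * x $ i > \<gamma> x}"
    using chart by (simp add: boundary_chart_def)
  have "z \<in> \<Omega> \<longleftrightarrow> \<epsilon> * z $ i > \<gamma> z" if "z \<in> ball y (\<rho> - dist x\<^sub>0 y)" for z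
  proof -
    have "z \<in> ball x\<^sub>0 \<rho>" using sub that by (rule subsetD)
    then show ?thesis using dom by blast
  qed
  then have "\<Omega> \<inter> ball y (\<rho> - dist x\<^sub>0 y) = {x \<in> ball y (\<rho> - dist x\<^sub>0 y). \<epsilon> * x $ i > \<gamma> x}"
    by blast
  then show ?thesis using chart y by (simp add: boundary_chart_def)
qed

text \<open>At a boundary point this is the height function of a chart; in the interior the constant \<open>1\<close> serves.
  For the last clause, \<open>P y\<close> is a negative multiple of the outer normal at \<open>y\<close>, and \<open>P x - P y\<close> tends to zero while \<open>V\<close>
  is bounded.\<close>

lemma local_defining_function:
  fixes \<Omega> :: "(real ^ 'n::finite) set"
  assumes \<Omega>: "bounded_smooth_domain \<Omega>" and x0: "x\<^sub>0 \<in> closure \<Omega>"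
  shows "\<exists>\<rho> \<psi> P K. \<rho> > 0 \<and> (\<forall>x. GDERIV \<psi> x :> P x) \<and> continuous_on UNIV P \<and>
     (\<forall>x\<in>\<Omega> \<inter> ball x\<^sub>0 \<rho>. \<psi> x > 0) \<and> (\<forall>x\<in>ball x\<^sub>0 \<rho> - \<Omega>. \<psi> x \<le> 0) \<and>
     (\<forall>\<delta>>0. measure lborel {x\<in>\<Omega> \<inter> ball x\<^sub>0 \<rho>. \<psi> x < \<delta>} \<le> K * \<delta>) \<and>
     (\<forall>V. asymptotically_tangential \<Omega> V \<longrightarrow>
        (\<forall>y\<in>frontier \<Omega> \<inter> ball x\<^sub>0 \<rho>. ((\<lambda>x. V x \<bullet> P x) \<longlongrightarrow> 0) (at y within \<Omega>)))"
proof (cases "x\<^sub>0 \<in> \<Omega>")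
  case True
  have op: "open \<Omega>" using \<Omega> by (simp add: bounded_smooth_domain_def)
  then obtain \<rho> where \<rho>: "\<rho> > 0" "ball x\<^sub>0 \<rho> \<subseteq> \<Omega>" using True by (auto simp: open_contains_ball)
  have "frontier \<Omega> \<inter> ball x\<^sub>0 \<rho> = {}" using \<rho> op by (auto simp: frontier_def interior_open)
  moreover have "measure lborel {x\<in>\<Omega> \<inter> ball x\<^sub>0 \<rho>. (1::real) < \<delta>} \<le> measure lborel (ball x\<^sub>0 \<rho>) * \<delta>" if "\<delta> > 0" for \<delta>
  proof (cases "1 < \<delta>")
    case True
    have "{x\<in>\<Omega> \<inter> ball x\<^sub>0 \<rho>. (1::real) < \<delta>} = ball x\<^sub>0 \<rho>" using True \<rho> by auto
    moreover have "measure lborel (ball x\<^sub>0 \<rho>) * 1 \<le> measure lborel (ball x\<^sub>0 \<rho>) * \<delta>"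
      using True by (intro mult_left_mono) auto
    ultimately show ?thesis by simp
  qed (use that in simp)
  ultimately show ?thesis using \<rho>
    by (intro exI[of _ \<rho>] exI[of _ "\<lambda>_. 1"] exI[of _ "\<lambda>_. 0"] exI[of _ "measure lborel (ball x\<^sub>0 \<rho>)"])
       (auto simp: GDERIV_const)
next
  case False
  then have "x\<^sub>0 \<in> frontier \<Omega>" using x0 \<Omega> by (simp add: bounded_smooth_domain_def frontier_def interior_open)
  then obtain \<rho> i \<epsilon> \<gamma> where chart: "boundary_chart \<Omega> x\<^sub>0 \<rho> i \<epsilon> \<gamma>"
    using \<Omega> unfolding bounded_smooth_domain_def by blast
  then have \<rho>: "\<rho> > 0" and dom: "\<Omega> \<inter> ball x\<^sub>0 \<rho> = {x \<in> ball x\<^sub>0 \<rho>. \<epsilon> * x $ i > \<gamma> x}"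
    by (auto simp: boundary_chart_def)
  define e where "e = \<epsilon> *\<^sub>R (axis i 1 :: real ^ 'n)"
  define \<psi> where "\<psi> x = \<epsilon> * x $ i - \<gamma> x" for x
  define P where "P x = e - (\<chi> j. partial_derivative j \<gamma> x)" for x
  note height = boundary_chart_height[OF chart, folded e_def, folded P_def, folded \<psi>_def]
  note d\<psi> = height(1) and cP = height(2) and sign = height(3) and \<psi>t = height(4) and ne = height(5)
  have c\<psi>: "continuous_on UNIV \<psi>" by (rule GDERIV_imp_continuous_on[OF d\<psi>])
  have strip: "measure lborel {x\<in>\<Omega> \<inter> ball x\<^sub>0 \<rho>. \<psi> x < \<delta>} \<le> 2 * measure lborel (ball x\<^sub>0 (\<rho> + 1)) * \<delta>"
    if "\<delta> > 0" for \<delta>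
  proof -
    have "{x\<in>\<Omega> \<inter> ball x\<^sub>0 \<rho>. \<psi> x < \<delta>} = {x\<in>ball x\<^sub>0 \<rho>. 0 < \<psi> x \<and> \<psi> x < \<delta>}" using sign by auto
    then show ?thesis using measure_strip_le[OF c\<psi> \<psi>t ne that \<rho>] by simp
  qed
  have tan: "((\<lambda>x. V x \<bullet> P x) \<longlongrightarrow> 0) (at y within \<Omega>)"
    if V: "asymptotically_tangential \<Omega> V" and y: "y \<in> frontier \<Omega>" "y \<in> ball x\<^sub>0 \<rho>" for V y
  proof -
    have "boundary_chart \<Omega> y (\<rho> - dist x\<^sub>0 y) i \<epsilon> \<gamma>"
      by (rule boundary_chart_recenter[OF chart y(2)])
    then have "outer_unit_normal \<Omega> y (sgn ((\<chi> j. partial_derivative j \<gamma> y) - \<epsilon> *\<^sub>R axis i 1))"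
      using y unfolding outer_unit_normal_def by blast
    then have "outer_unit_normal \<Omega> y (sgn (- P y))" by (simp add: P_def e_def)
    then have "((\<lambda>x. V x \<bullet> sgn (- P y)) \<longlongrightarrow> 0) (at y within \<Omega>)"
      using V y by (auto simp: asymptotically_tangential_def)
    then have "((\<lambda>x. (- norm (P y)) * (V x \<bullet> sgn (- P y))) \<longlongrightarrow> 0) (at y within \<Omega>)"
      using tendsto_mult_left[of _ 0 _ "- norm (P y)"] by simp
    moreover have "(- norm (P y)) * (w \<bullet> sgn (- P y)) = w \<bullet> P y" for w
      by (cases "P y = 0") (simp_all add: sgn_div_norm)
    ultimately have 1: "((\<lambda>x. V x \<bullet> P y) \<longlongrightarrow> 0) (at y within \<Omega>)" by simp
    have "(P \<longlongrightarrow> P y) (at y within \<Omega>)"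
      using cP by (meson continuous_on_eq_continuous_within continuous_within_subset continuous_within subset_UNIV UNIV_I)
    then have "((\<lambda>x. P x - P y) \<longlongrightarrow> 0) (at y within \<Omega>)" by (simp add: LIM_zero)
    then have 2: "((\<lambda>x. V x \<bullet> (P x - P y)) \<longlongrightarrow> 0) (at y within \<Omega>)"
      using V by (intro tendsto_0_inner_bounded) (auto simp: asymptotically_tangential_def)
    show ?thesis using tendsto_add[OF 1 2] by (simp flip: inner_add_right)
  qed
  show ?thesis
    by (rule exI[of _ \<rho>], rule exI[of _ \<psi>], rule exI[of _ P], rule exI[of _ "2 * measure lborel (ball x\<^sub>0 (\<rho> + 1))"])
      (use \<rho> d\<psi> cP sign strip tan in \<open>auto simp: not_less[symmetric]\<close>)
qed

text \<open>Translation in the direction of the chart increases the height, hence leads into \<open>\<Omega>\<close>.\<close>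

lemma boundary_segment:
  fixes \<Omega> :: "(real ^ 'n::finite) set"
  assumes \<Omega>: "bounded_smooth_domain \<Omega>" and x: "x \<in> frontier \<Omega>"
  shows "\<exists>h \<eta>. \<eta> > 0 \<and> x + h \<in> \<Omega> \<and> (\<forall>y\<in>\<Omega> \<inter> ball x \<eta>. \<forall>t\<in>{0..1}. y + t *\<^sub>R h \<in> \<Omega>)"
proof -
  obtain \<rho> i \<epsilon> \<gamma> where chart: "boundary_chart \<Omega> x \<rho> i \<epsilon> \<gamma>"
    using \<Omega> x unfolding bounded_smooth_domain_def by blast
  then have \<rho>: "\<rho> > 0" by (simp add: boundary_chart_def)
  define e where "e = \<epsilon> *\<^sub>R (axis i 1 :: real ^ 'n)"
  define \<psi> where "\<psi> x = \<epsilon> * x $ i - \<gamma> x" for x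
  note height = boundary_chart_height[OF chart, folded e_def, folded \<psi>_def]
  note sign = height(3) and \<psi>t = height(4) and ne = height(5)
  have c\<psi>: "continuous_on UNIV \<psi>" by (rule GDERIV_imp_continuous_on[OF height(1)])
  have inb: "y + t *\<^sub>R ((\<rho>/2) *\<^sub>R e) \<in> ball x \<rho>" if "y \<in> ball x (\<rho>/2)" "t \<in> {0..1}" for y t
  proof -
    have "norm (t *\<^sub>R ((\<rho>/2) *\<^sub>R e)) \<le> \<rho>/2" using that \<rho> ne mult_left_le_one_le[of "\<rho>/2" t] by simp
    moreover have "dist x (y + t *\<^sub>R ((\<rho>/2) *\<^sub>R e)) \<le> dist x y + dist y (y + t *\<^sub>R ((\<rho>/2) *\<^sub>R e))"
      by (rule dist_triangle)
    ultimately show ?thesis using that by (simp add: dist_norm)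
  qed
  have "\<psi> x \<ge> 0"
  proof (rule ccontr)
    assume "\<not> \<psi> x \<ge> 0"
    define U where "U = {y. \<psi> y < 0} \<inter> ball x \<rho>"
    have "open U" unfolding U_def by (intro open_Int open_ball open_Collect_less c\<psi> continuous_intros)
    moreover have "x \<in> U" using \<open>\<not> \<psi> x \<ge> 0\<close> \<rho> by (simp add: U_def)
    moreover have "U \<inter> \<Omega> = {}" using sign by (force simp: U_def)
    ultimately have "x \<notin> closure \<Omega>" using open_Int_closure_eq_empty[of U \<Omega>] by auto
    then show False using x by (simp add: frontier_def)
  qed
  show ?thesis
  proof (rule exI[of _ "(\<rho>/2) *\<^sub>R e"], rule exI[of _ "\<rho>/2"], intro conjI ballI)
    show "\<rho> / 2 > 0" using \<rho> by simp
    show "x + (\<rho>/2) *\<^sub>R e \<in> \<Omega>"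
      using inb[of x 1] sign[of "x + (\<rho>/2) *\<^sub>R e"] \<psi>t[of x "\<rho>/2"] \<open>\<psi> x \<ge> 0\<close> \<rho> by simp
    fix y t assume y: "y \<in> \<Omega> \<inter> ball x (\<rho>/2)" and t: "t \<in> {0..1::real}"
    have "\<psi> y > 0" using sign[of y] y \<rho> by auto
    moreover have "\<psi> (y + t *\<^sub>R (\<rho>/2) *\<^sub>R e) = \<psi> y + t * (\<rho>/2)" using \<psi>t[of y "t * (\<rho>/2)"] by simp
    ultimately have "\<psi> (y + t *\<^sub>R (\<rho>/2) *\<^sub>R e) > 0" using t \<rho> by (simp add: add_pos_nonneg)
    then show "y + t *\<^sub>R (\<rho>/2) *\<^sub>R e \<in> \<Omega>" using sign inb[of y t] y t by auto
  qed
qed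

definition bump :: "'a::euclidean_space \<Rightarrow> real \<Rightarrow> 'a \<Rightarrow> real" where
  "bump a \<rho> x = (max 0 (\<rho>\<^sup>2 - (norm (x - a))\<^sup>2))\<^sup>2"

definition bump_gradient :: "'a::euclidean_space \<Rightarrow> real \<Rightarrow> 'a \<Rightarrow> 'a" where
  "bump_gradient a \<rho> x = (2 * max 0 (\<rho>\<^sup>2 - (norm (x - a))\<^sup>2)) *\<^sub>R (- 2 *\<^sub>R (x - a))"

lemma GDERIV_bump: "GDERIV (bump a \<rho>) x :> bump_gradient a \<rho> x"
proof -
  have "((\<lambda>x. \<rho>\<^sup>2 - (x - a) \<bullet> (x - a)) has_derivative (\<lambda>h. h \<bullet> (- 2 *\<^sub>R (x - a)))) (at x)"
    by (auto intro!: derivative_eq_intros simp: inner_commute algebra_simps)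
  then have "GDERIV (\<lambda>x. \<rho>\<^sup>2 - (norm (x - a))\<^sup>2) x :> - 2 *\<^sub>R (x - a)"
    by (simp add: gderiv_def power2_norm_eq_inner)
  from GDERIV_DERIV_compose[OF this DERIV_pos_part_square] show ?thesis
    by (simp add: bump_def[abs_def] bump_gradient_def)
qed

lemma continuous_bump [continuous_intros]: "continuous_on S (bump a \<rho>)" "continuous_on S (bump_gradient a \<rho>)"
  unfolding bump_def[abs_def] bump_gradient_def[abs_def] by (intro continuous_intros)+

lemma bump_nonneg: "bump a \<rho> x \<ge> 0"
  by (simp add: bump_def)

lemma bump_eq_0: assumes "x \<notin> ball a \<rho>" "\<rho> > 0" shows "bump a \<rho> x = 0" "bump_gradient a \<rho> x = 0"
proof -
  have "\<rho>\<^sup>2 \<le> (norm (x - a))\<^sup>2" using assms by (intro power_mono) (auto simp: dist_norm norm_minus_commute)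
  then show "bump a \<rho> x = 0" "bump_gradient a \<rho> x = 0" by (auto simp: bump_def bump_gradient_def)
qed

lemma bump_ge: assumes "x \<in> ball a (\<rho>/2)" "\<rho> > 0" shows "bump a \<rho> x \<ge> (\<rho>\<^sup>2 / 2)\<^sup>2"
proof -
  have "(norm (x - a))\<^sup>2 \<le> (\<rho>/2)\<^sup>2" using assms by (intro power_mono) (auto simp: dist_norm norm_minus_commute)
  then have "(norm (x - a))\<^sup>2 \<le> \<rho>\<^sup>2 / 4" by (simp add: power_divide)
  then have "\<rho>\<^sup>2 - (norm (x - a))\<^sup>2 \<ge> \<rho>\<^sup>2 / 2" using zero_le_power2[of \<rho>] by linarith
  then show ?thesis unfolding bump_def by (intro power_mono max.coboundedI2) auto
qed

text \<open>Local defining functions are glued with bumps over a finite cover, \<open>\<Psi> = \<Sum> b\<^sub>a \<psi>\<^sub>a\<close>. All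
  summands are nonnegative in \<open>\<Omega>\<close>, so \<open>\<Psi> < \<delta>\<close> forces \<open>b\<^sub>a \<psi>\<^sub>a < \<delta>\<close> for each \<open>a\<close>, and
  where \<open>b\<^sub>a\<close> is bounded below this is a strip of the local function. At the boundary
  \<open>\<nabla>\<Psi> = \<Sum> b\<^sub>a \<nabla>\<psi>\<^sub>a\<close>, because there \<open>\<psi>\<^sub>a = 0\<close> wherever \<open>b\<^sub>a\<close> lives, and each summand is normal.\<close>

theorem global_defining_function:
  fixes \<Omega> :: "(real ^ 'n::finite) set"
  assumes \<Omega>: "bounded_smooth_domain \<Omega>"
  obtains \<Psi> P K where "\<And>x. GDERIV \<Psi> x :> P x" "continuous_on UNIV P"
    "\<And>x. x \<in> \<Omega> \<Longrightarrow> \<Psi> x > 0" "\<And>x. x \<notin> \<Omega> \<Longrightarrow> \<Psi> x \<le> 0"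
    "\<And>\<delta>. \<delta> > 0 \<Longrightarrow> measure lborel {x\<in>\<Omega>. \<Psi> x < \<delta>} \<le> K * \<delta>"
    "\<And>V y. asymptotically_tangential \<Omega> V \<Longrightarrow> y \<in> frontier \<Omega> \<Longrightarrow>
        ((\<lambda>x. V x \<bullet> P x) \<longlongrightarrow> 0) (at y within \<Omega>)"
proof -
  have op: "open \<Omega>" and bd: "bounded \<Omega>" using \<Omega> by (auto simp: bounded_smooth_domain_def)
  define Q where "Q a \<rho> \<psi> P K \<longleftrightarrow> \<rho> > 0 \<and> (\<forall>x. GDERIV \<psi> x :> P x) \<and> continuous_on UNIV P \<and>
     (\<forall>x\<in>\<Omega> \<inter> ball a \<rho>. \<psi> x > 0) \<and> (\<forall>x\<in>ball a \<rho> - \<Omega>. \<psi> x \<le> 0) \<and>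
     (\<forall>\<delta>>0. measure lborel {x\<in>\<Omega> \<inter> ball a \<rho>. \<psi> x < \<delta>} \<le> K * \<delta>) \<and>
     (\<forall>V. asymptotically_tangential \<Omega> V \<longrightarrow>
        (\<forall>y\<in>frontier \<Omega> \<inter> ball a \<rho>. ((\<lambda>x. V x \<bullet> P x) \<longlongrightarrow> 0) (at y within \<Omega>)))" for a \<rho> \<psi> P K
  have "\<forall>a\<in>closure \<Omega>. \<exists>\<rho> \<psi> P K. Q a \<rho> \<psi> P K"
    using local_defining_function[OF \<Omega>] unfolding Q_def by (rule ballI)
  then obtain \<rho> \<psi> P K where Q: "\<And>a. a \<in> closure \<Omega> \<Longrightarrow> Q a (\<rho> a) (\<psi> a) (P a) (K a)" by metis
  have "compact (closure \<Omega>)" using bd by (simp add: compact_closure)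
  moreover have "closure \<Omega> \<subseteq> (\<Union>a\<in>closure \<Omega>. ball a (\<rho> a / 2))"
  proof
    fix a assume a: "a \<in> closure \<Omega>"
    have "\<rho> a > 0" using Q[OF a] unfolding Q_def by (rule conjunct1)
    then have "a \<in> ball a (\<rho> a / 2)" by simp
    then show "a \<in> (\<Union>a\<in>closure \<Omega>. ball a (\<rho> a / 2))" using a by (rule UN_I[rotated])
  qed
  ultimately obtain X where X: "X \<subseteq> closure \<Omega>" "finite X" "closure \<Omega> \<subseteq> (\<Union>a\<in>X. ball a (\<rho> a / 2))"
    by (elim compactE_image) auto
  have coverE: thesis if "x \<in> \<Omega>" "\<And>a. a \<in> X \<Longrightarrow> x \<in> ball a (\<rho> a / 2) \<Longrightarrow> thesis" for x thesis
  proof -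
    have "x \<in> (\<Union>a\<in>X. ball a (\<rho> a / 2))" using X(3) closure_subset that(1) by (meson subsetD)
    then show thesis by (rule UN_E) (rule that(2))
  qed
  have QX: "Q a (\<rho> a) (\<psi> a) (P a) (K a)" if "a \<in> X" for a using Q X that by auto
  note q = QX[unfolded Q_def]
  note \<rho> = q[THEN conjunct1]
    and d\<psi> = q[THEN conjunct2, THEN conjunct1, THEN spec]
    and cP = q[THEN conjunct2, THEN conjunct2, THEN conjunct1]
    and \<psi>pos = q[THEN conjunct2, THEN conjunct2, THEN conjunct2, THEN conjunct1, THEN bspec, OF _ IntI]
    and \<psi>neg = q[THEN conjunct2, THEN conjunct2, THEN conjunct2, THEN conjunct2, THEN conjunct1,
      THEN bspec, OF _ DiffI]
    and strip = q[THEN conjunct2, THEN conjunct2, THEN conjunct2, THEN conjunct2, THEN conjunct2,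
      THEN conjunct1, THEN spec, THEN mp]
    and tan = q[THEN conjunct2, THEN conjunct2, THEN conjunct2, THEN conjunct2, THEN conjunct2,
      THEN conjunct2, THEN spec, THEN mp, THEN bspec, OF _ _ IntI]
  have c\<psi>: "continuous_on UNIV (\<psi> a)" if "a \<in> X" for a
    by (rule GDERIV_imp_continuous_on[OF d\<psi>[OF that]])
  define b where "b a = bump a (\<rho> a)" for a
  define b' where "b' a = bump_gradient a (\<rho> a)" for a
  define \<beta> where "\<beta> a = ((\<rho> a)\<^sup>2 / 2)\<^sup>2" for a
  have \<beta>: "\<beta> a > 0" if "a \<in> X" for a using \<rho>[OF that] by (simp add: \<beta>_def)
  have b_ge: "\<beta> a \<le> b a x" if "a \<in> X" "x \<in> ball a (\<rho> a / 2)" for a x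
    unfolding b_def \<beta>_def by (rule bump_ge[OF that(2) \<rho>[OF that(1)]])
  define \<Psi> where "\<Psi> x = (\<Sum>a\<in>X. b a x * \<psi> a x)" for x
  define R where "R x = (\<Sum>a\<in>X. b a x *\<^sub>R P a x + \<psi> a x *\<^sub>R b' a x)" for x
  have summand_nonneg: "b a x * \<psi> a x \<ge> 0" if "a \<in> X" "x \<in> \<Omega>" for a x
    using \<psi>pos[OF that] bump_nonneg[of a "\<rho> a" x] bump_eq_0(1)[OF _ \<rho>[OF that(1)], of x]
    by (cases "x \<in> ball a (\<rho> a)") (auto simp: b_def)
  have d\<Psi>: "GDERIV \<Psi> x :> R x" for x
  proof -
    have "((\<lambda>x. \<Sum>a\<in>X. b a x * \<psi> a x) has_derivative (\<lambda>h. \<Sum>a\<in>X. h \<bullet> (b a x *\<^sub>R P a x + \<psi> a x *\<^sub>R b' a x))) (at x)"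
      using GDERIV_mult[OF GDERIV_bump d\<psi>] unfolding gderiv_def b_def b'_def
      by (intro has_derivative_sum) blast
    then show ?thesis by (simp add: gderiv_def \<Psi>_def[abs_def] R_def inner_sum_right)
  qed
  have cR: "continuous_on UNIV R"
    unfolding R_def b_def b'_def by (intro continuous_intros cP c\<psi>)
  have pos: "\<forall>x\<in>\<Omega>. \<Psi> x > 0"
  proof
    fix x assume x: "x \<in> \<Omega>"
    obtain a where a: "a \<in> X" "x \<in> ball a (\<rho> a / 2)" by (rule coverE) (use x in auto)
    have "x \<in> ball a (\<rho> a)" using a(2) \<rho>[OF a(1)] by simp
    then have "\<psi> a x > 0" by (rule \<psi>pos[OF a(1) x])
    moreover have "\<beta> a \<le> b a x" by (rule b_ge[OF a])
    moreover have "\<beta> a > 0" by (rule \<beta>[OF a(1)])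
    ultimately have "b a x * \<psi> a x > 0" by (intro mult_pos_pos) linarith+
    then show "\<Psi> x > 0" unfolding \<Psi>_def by (rule sum_pos2[OF X(2) a(1)]) (rule summand_nonneg[OF _ x])
  qed
  have neg: "\<Psi> x \<le> 0" if "x \<notin> \<Omega>" for x
    unfolding \<Psi>_def
  proof (rule sum_nonpos)
    fix a assume a: "a \<in> X"
    show "b a x * \<psi> a x \<le> 0"
    proof (cases "x \<in> ball a (\<rho> a)")
      case True
      show ?thesis unfolding b_def by (rule mult_nonneg_nonpos[OF bump_nonneg \<psi>neg[OF a True that]])
    next
      case False
      then show ?thesis using bump_eq_0(1)[OF False \<rho>[OF a]] by (simp add: b_def)
    qed
  qed
  have thin: "measure lborel {x\<in>\<Omega>. \<Psi> x < \<delta>} \<le> (\<Sum>a\<in>X. K a / \<beta> a) * \<delta>" if \<delta>: "\<delta> > 0" for \<delta>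
  proof -
    define S where "S a = {x\<in>\<Omega> \<inter> ball a (\<rho> a). \<psi> a x < \<delta> / \<beta> a}" for a
    have Sm: "S a \<in> fmeasurable lborel" if "a \<in> X" for a
    proof -
      have "S a = \<Omega> \<inter> ball a (\<rho> a) \<inter> {x. \<psi> a x < \<delta> / \<beta> a}" by (auto simp: S_def)
      then have "open (S a)" using op by (auto intro!: open_Int open_Collect_less c\<psi> that continuous_intros)
      moreover have "bounded (S a)" by (rule bounded_subset[OF bd]) (auto simp: S_def)
      ultimately show ?thesis using emeasure_bounded_finite by (auto simp: fmeasurable_def)
    qed
    have "{x\<in>\<Omega>. \<Psi> x < \<delta>} \<subseteq> (\<Union>a\<in>X. S a)"
    proof clarify
      fix x assume x: "x \<in> \<Omega>" "\<Psi> x < \<delta>"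
      obtain a where a: "a \<in> X" "x \<in> ball a (\<rho> a / 2)" by (rule coverE) (use x in auto)
      have xb: "x \<in> ball a (\<rho> a)" using a(2) \<rho>[OF a(1)] by simp
      have "\<beta> a * \<psi> a x \<le> b a x * \<psi> a x"
        by (rule mult_right_mono[OF b_ge[OF a] less_imp_le[OF \<psi>pos[OF a(1) x(1) xb]]])
      also have "\<dots> \<le> \<Psi> x" unfolding \<Psi>_def by (rule member_le_sum[OF a(1) _ X(2)]) (simp add: summand_nonneg x)
      finally have "\<beta> a * \<psi> a x < \<delta>" using x by simp
      then have "\<psi> a x < \<delta> / \<beta> a" using \<beta>[OF a(1)] by (simp add: pos_less_divide_eq mult.commute)
      then show "x \<in> (\<Union>a\<in>X. S a)" using a xb x by (auto simp: S_def)
    qed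
    moreover have "{x\<in>\<Omega>. \<Psi> x < \<delta>} \<in> sets lborel"
    proof -
      have "{x\<in>\<Omega>. \<Psi> x < \<delta>} = \<Omega> \<inter> {x. \<Psi> x < \<delta>}" by auto
      moreover have "open {x. \<Psi> x < \<delta>}"
        unfolding \<Psi>_def b_def by (intro open_Collect_less continuous_intros c\<psi>)
      ultimately show ?thesis using op by simp
    qed
    ultimately have "measure lborel {x\<in>\<Omega>. \<Psi> x < \<delta>} \<le> measure lborel (\<Union>a\<in>X. S a)"
      using Sm X by (intro measure_mono_fmeasurable fmeasurable.finite_UN) auto
    also have "\<dots> \<le> (\<Sum>a\<in>X. measure lborel (S a))"
      using Sm X by (intro measure_UNION_le) (auto simp: fmeasurable_def)
    also have "\<dots> \<le> (\<Sum>a\<in>X. K a * (\<delta> / \<beta> a))"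
      unfolding S_def by (intro sum_mono strip divide_pos_pos \<delta> \<beta>)
    also have "\<dots> = (\<Sum>a\<in>X. K a / \<beta> a) * \<delta>" by (simp only: sum_distrib_right times_divide_eq_left times_divide_eq_right)
    finally show ?thesis .
  qed
  have tangent: "((\<lambda>x. V x \<bullet> R x) \<longlongrightarrow> 0) (at y within \<Omega>)"
    if V: "asymptotically_tangential \<Omega> V" and y: "y \<in> frontier \<Omega>" for V y
  proof -
    have bV: "bounded (V ` \<Omega>)" using V by (simp add: asymptotically_tangential_def)
    have lim: "(h \<longlongrightarrow> h y) (at y within \<Omega>)" if "continuous_on UNIV h" for h :: "real ^ 'n \<Rightarrow> 'c::topological_space"
      using that by (meson continuous_on_eq_continuous_within continuous_within_subset continuous_within subset_UNIV UNIV_I)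
    have "((\<lambda>x. V x \<bullet> (b a x *\<^sub>R P a x + \<psi> a x *\<^sub>R b' a x)) \<longlongrightarrow> 0) (at y within \<Omega>)" if a: "a \<in> X" for a
    proof (cases "y \<in> ball a (\<rho> a)")
      case True
      have y\<Omega>: "y \<notin> \<Omega>" "y \<in> closure \<Omega>" using y op by (auto simp: frontier_def interior_open)
      have "\<psi> a y \<ge> 0"
      proof (rule ccontr)
        assume "\<not> \<psi> a y \<ge> 0"
        define U where "U = {x. \<psi> a x < 0} \<inter> ball a (\<rho> a)"
        have "open U" unfolding U_def by (intro open_Int open_ball open_Collect_less c\<psi> a continuous_intros)
        moreover have "y \<in> U" using \<open>\<not> \<psi> a y \<ge> 0\<close> True by (simp add: U_def)
        moreover have "U \<inter> \<Omega> = {}" using \<psi>pos[OF a] by (force simp: U_def)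
        ultimately show False using y\<Omega>(2) open_Int_closure_eq_empty[of U \<Omega>] by auto
      qed
      with \<psi>neg[OF a True y\<Omega>(1)] have "\<psi> a y = 0" by simp
      then have "(\<psi> a \<longlongrightarrow> 0) (at y within \<Omega>)" using lim[OF c\<psi>[OF a]] by simp
      from tendsto_scaleR[OF this lim[of "b' a"]]
      have "((\<lambda>x. \<psi> a x *\<^sub>R b' a x) \<longlongrightarrow> 0) (at y within \<Omega>)" by (simp add: b'_def continuous_bump)
      then have 1: "((\<lambda>x. V x \<bullet> (\<psi> a x *\<^sub>R b' a x)) \<longlongrightarrow> 0) (at y within \<Omega>)"
        by (rule tendsto_0_inner_bounded[OF bV])
      have 2: "((\<lambda>x. b a x * (V x \<bullet> P a x)) \<longlongrightarrow> 0) (at y within \<Omega>)"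
        using tendsto_mult[OF lim[of "b a"] tan[OF a V y True]] by (simp add: b_def continuous_bump)
      show ?thesis using tendsto_add[OF 2 1] by (simp add: inner_add_right)
    next
      case False
      have "continuous_on UNIV (\<lambda>x. b a x *\<^sub>R P a x + \<psi> a x *\<^sub>R b' a x)"
        unfolding b_def b'_def by (intro continuous_intros cP c\<psi> a)
      from lim[OF this] have "((\<lambda>x. b a x *\<^sub>R P a x + \<psi> a x *\<^sub>R b' a x) \<longlongrightarrow> 0) (at y within \<Omega>)"
        using bump_eq_0[OF False \<rho>[OF a]] by (simp add: b_def b'_def)
      then show ?thesis by (rule tendsto_0_inner_bounded[OF bV])
    qed
    then have "((\<lambda>x. \<Sum>a\<in>X. V x \<bullet> (b a x *\<^sub>R P a x + \<psi> a x *\<^sub>R b' a x)) \<longlongrightarrow> (\<Sum>a\<in>X. 0)) (at y within \<Omega>)"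
      by (rule tendsto_sum)
    then show ?thesis unfolding R_def inner_sum_right by simp
  qed
  show thesis
    by (rule that[OF d\<Psi> cR pos[rule_format] neg thin tangent])
qed

section \<open>Green's identity under the Neumann condition\<close>

abbreviation gradient :: "(real ^ 'n::finite \<Rightarrow> real) \<Rightarrow> real ^ 'n \<Rightarrow> real ^ 'n" where
  "gradient f x \<equiv> (\<chi> j. partial_derivative j f x)"

lemma iterated_partial_append: "iterated_partial (ks @ js) f = iterated_partial ks (iterated_partial js f)"
  by (induction ks) auto

lemma smooth_on_iterated_partial: "smooth_on S f \<Longrightarrow> smooth_on S (iterated_partial js f)"
  unfolding smooth_on_def by (simp flip: iterated_partial_append)

lemma smooth_up_to_boundary_iterated_partial:
  fixes \<Omega> :: "(real ^ 'n::finite) set"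
  assumes u: "smooth_up_to_boundary \<Omega> u" and \<Omega>: "open \<Omega>" "bounded \<Omega>"
  shows "bounded (iterated_partial js u ` \<Omega>)"
    and "\<And>x. x \<in> \<Omega> \<Longrightarrow> GDERIV (iterated_partial js u) x :> gradient (iterated_partial js u) x"
    and "continuous_on \<Omega> (gradient (iterated_partial js u))"
    and "bounded (gradient (iterated_partial js u) ` \<Omega>)"
proof -
  have sm: "smooth_on \<Omega> u" using u by (simp add: smooth_up_to_boundary_def)
  have bdd: "bounded (iterated_partial ks u ` \<Omega>)" for ks
  proof -
    obtain g where g: "continuous_on (closure \<Omega>) g" "\<forall>x\<in>\<Omega>. g x = iterated_partial ks u x"
      using u unfolding smooth_up_to_boundary_def by blast
    have "compact (g ` closure \<Omega>)"
      using g(1) \<Omega> by (intro compact_continuous_image) (simp_all add: compact_closure)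
    then have "bounded (g ` closure \<Omega>)" by (rule compact_imp_bounded)
    moreover have "iterated_partial ks u ` \<Omega> \<subseteq> g ` closure \<Omega>"
      using g(2) closure_subset[of \<Omega>] by (auto intro!: image_eqI[where f=g])
    ultimately show ?thesis by (rule bounded_subset)
  qed
  show "bounded (iterated_partial js u ` \<Omega>)" by (rule bdd)
  show "GDERIV (iterated_partial js u) x :> gradient (iterated_partial js u) x" if "x \<in> \<Omega>" for x
    using sm that unfolding smooth_on_def by (intro differentiable_imp_GDERIV) blast
  show "continuous_on \<Omega> (gradient (iterated_partial js u))"
    by (rule smooth_on_continuous_gradient[OF smooth_on_iterated_partial[OF sm]])
  have "\<forall>j. \<exists>M. \<forall>x\<in>\<Omega>. \<bar>partial_derivative j (iterated_partial js u) x\<bar> \<le> M"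
    using bdd[of "_ # js"] by (auto simp: bounded_iff)
  then obtain M where M: "\<And>j x. x \<in> \<Omega> \<Longrightarrow> \<bar>partial_derivative j (iterated_partial js u) x\<bar> \<le> M j" by metis
  have "norm (gradient (iterated_partial js u) x) \<le> (\<Sum>j\<in>UNIV. M j)" if "x \<in> \<Omega>" for x
    using norm_le_l1_cart[of "gradient (iterated_partial js u) x"]
      sum_mono[of UNIV "\<lambda>j. \<bar>partial_derivative j (iterated_partial js u) x\<bar>" M] M[OF that]
    by simp
  then show "bounded (gradient (iterated_partial js u) ` \<Omega>)" by (auto simp: bounded_iff)
qed

lemma bounded_image_mult:
  fixes f g :: "'a \<Rightarrow> real"
  assumes "bounded (f ` S)" "bounded (g ` S)"
  shows "bounded ((\<lambda>x. f x * g x) ` S)"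
proof -
  obtain A B where "\<And>x. x \<in> S \<Longrightarrow> \<bar>f x\<bar> \<le> A" "\<And>x. x \<in> S \<Longrightarrow> \<bar>g x\<bar> \<le> B"
    using assms by (auto simp: bounded_iff)
  then have "\<bar>f x * g x\<bar> \<le> A * B" if "x \<in> S" for x
    using that unfolding abs_mult by (intro mult_mono) (auto intro: order_trans[OF abs_ge_zero])
  then show ?thesis by (auto simp: bounded_iff)
qed

lemma bounded_image_scaleR:
  fixes f :: "'a \<Rightarrow> real" and g :: "'a \<Rightarrow> 'b::real_normed_vector"
  assumes "bounded (f ` S)" "bounded (g ` S)"
  shows "bounded ((\<lambda>x. f x *\<^sub>R g x) ` S)"
proof -
  obtain A B where "\<And>x. x \<in> S \<Longrightarrow> \<bar>f x\<bar> \<le> A" "\<And>x. x \<in> S \<Longrightarrow> norm (g x) \<le> B"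
    using assms by (auto simp: bounded_iff)
  then have "norm (f x *\<^sub>R g x) \<le> A * B" if "x \<in> S" for x
    using that unfolding norm_scaleR by (intro mult_mono) (auto intro: order_trans[OF abs_ge_zero])
  then show ?thesis by (auto simp: bounded_iff)
qed

lemma set_integrable_continuous_bounded:
  fixes f :: "'a::euclidean_space \<Rightarrow> real"
  assumes \<Omega>: "open \<Omega>" "bounded \<Omega>" and f: "continuous_on \<Omega> f" "bounded (f ` \<Omega>)"
  shows "set_integrable lborel \<Omega> f"
proof -
  obtain M where M: "\<And>x. x \<in> \<Omega> \<Longrightarrow> \<bar>f x\<bar> \<le> M" using f(2) by (auto simp: bounded_iff)
  show ?thesis unfolding set_integrable_def
  proof (rule Bochner_Integration.integrable_bound)
    show "integrable lborel (\<lambda>x. M * indicator \<Omega> x)"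
      using emeasure_bounded_finite[OF \<Omega>(2)] \<Omega>(1) by auto
    show "(\<lambda>x. indicator \<Omega> x *\<^sub>R f x) \<in> borel_measurable lborel"
      using borel_measurable_continuous_on_indicator[OF _ f(1)] \<Omega>(1) by simp
  qed (use M in \<open>auto simp: indicator_def intro: order_trans[OF _ abs_ge_self]\<close>)
qed

text \<open>The divergence theorem for the field \<open>(u - c) \<nabla>u\<close>, which is tangential by the Neumann condition. Having
  it for every constant \<open>c\<close> provides the identities tested with \<open>u - m\<close> and with \<open>v - w\<close>.\<close>

lemma green_identity:
  fixes \<Omega> :: "(real ^ 'n::finite) set"
  assumes \<Omega>: "bounded_smooth_domain \<Omega>" and u: "smooth_up_to_boundary \<Omega> u" "neumann_condition \<Omega> u"
  shows "(LINT x:\<Omega>|lborel. (norm (gradient u x))\<^sup>2 + (u x - c) * laplacian u x) = 0"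
proof -
  have op: "open \<Omega>" and bd: "bounded \<Omega>" using \<Omega> by (auto simp: bounded_smooth_domain_def)
  note it = smooth_up_to_boundary_iterated_partial[OF u(1) op bd]
  have u0: "bounded (u ` \<Omega>)" "\<And>x. x \<in> \<Omega> \<Longrightarrow> GDERIV u x :> gradient u x"
      "continuous_on \<Omega> (gradient u)" "bounded (gradient u ` \<Omega>)"
    using it[where js="[]"] by simp_all
  have u1: "bounded (partial_derivative j u ` \<Omega>)"
      "\<And>x. x \<in> \<Omega> \<Longrightarrow> GDERIV (partial_derivative j u) x :> gradient (partial_derivative j u) x"
      "continuous_on \<Omega> (gradient (partial_derivative j u))" "bounded (gradient (partial_derivative j u) ` \<Omega>)" for j
    using it[where js="[j]"] by simp_all
  have cu: "continuous_on \<Omega> u" by (rule GDERIV_imp_continuous_on[OF u0(2)])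
  have cpu: "continuous_on \<Omega> (partial_derivative j u)" for j by (rule GDERIV_imp_continuous_on[OF u1(2)])
  have bc: "bounded ((\<lambda>x. u x - c) ` \<Omega>)"
    using bounded_translation[OF u0(1), of "-c"] by (simp add: image_image)
  obtain \<Psi> P K
    where \<Psi>: "\<And>x. GDERIV \<Psi> x :> P x" "continuous_on UNIV P"
    and pos: "\<And>x. x \<in> \<Omega> \<Longrightarrow> \<Psi> x > 0" and neg: "\<And>x. x \<notin> \<Omega> \<Longrightarrow> \<Psi> x \<le> 0"
    and strip: "\<And>\<delta>. \<delta> > 0 \<Longrightarrow> measure lborel {x\<in>\<Omega>. \<Psi> x < \<delta>} \<le> K * \<delta>"
    and tan: "\<And>V y. asymptotically_tangential \<Omega> V \<Longrightarrow> y \<in> frontier \<Omega> \<Longrightarrow>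
        ((\<lambda>x. V x \<bullet> P x) \<longlongrightarrow> 0) (at y within \<Omega>)"
    by (rule global_defining_function[OF \<Omega>], rule that)
  define F where "F x = (u x - c) *\<^sub>R gradient u x" for x
  define G where "G j x = (u x - c) *\<^sub>R gradient (partial_derivative j u) x + partial_derivative j u x *\<^sub>R gradient u x" for j x
  have at: "asymptotically_tangential \<Omega> (gradient u)"
    using u0(4) u(2) by (simp add: asymptotically_tangential_def neumann_condition_def has_normal_derivative_def)
  have "(\<integral>x. indicator \<Omega> x * (\<Sum>j\<in>UNIV. G j x $ j) \<partial>lborel) = 0"
  proof (rule integral_divergence_eq_0[OF op bd \<Psi> pos neg strip])
    fix x j assume x: "x \<in> \<Omega>"
    have "GDERIV (\<lambda>y. u y - c) x :> gradient u x - 0" by (rule GDERIV_diff[OF u0(2)[OF x] GDERIV_const])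
    from GDERIV_mult[OF this u1(2)[OF x, of j]]
    show "GDERIV (\<lambda>y. F y $ j) x :> G j x" by (simp add: F_def G_def)
  next
    show "bounded (F ` \<Omega>)" unfolding F_def by (rule bounded_image_scaleR[OF bc u0(4)])
    show "bounded (G j ` \<Omega>)" for j
      unfolding G_def[abs_def]
      by (rule bounded_plus_comp[OF bounded_image_scaleR[OF bc u1(4)] bounded_image_scaleR[OF u1(1) u0(4)]])
    show "continuous_on \<Omega> (G j)" for j
      unfolding G_def by (intro continuous_on_add continuous_on_scaleR continuous_on_diff continuous_on_const cu cpu u0(3) u1(3))
    fix x assume x: "x \<in> frontier \<Omega>"
    have "((\<lambda>y. (u y - c) \<bullet> (gradient u y \<bullet> P y)) \<longlongrightarrow> 0) (at x within \<Omega>)"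
      by (rule tendsto_0_inner_bounded[OF bc tan[OF at x]])
    then show "((\<lambda>y. F y \<bullet> P y) \<longlongrightarrow> 0) (at x within \<Omega>)" by (simp add: F_def)
  qed
  moreover have "(\<Sum>j\<in>UNIV. G j x $ j) = (norm (gradient u x))\<^sup>2 + (u x - c) * laplacian u x" for x
    by (simp add: G_def laplacian_def sum.distrib sum_distrib_left power2_norm_eq_inner inner_vec_def)
  ultimately show ?thesis by (simp add: set_lebesgue_integral_def)
qed

lemma set_integral_zero_imp_zero:
  fixes h :: "'a::euclidean_space \<Rightarrow> real"
  assumes \<Omega>: "open \<Omega>" and h: "continuous_on \<Omega> h" "set_integrable lborel \<Omega> h" "\<And>x. x \<in> \<Omega> \<Longrightarrow> h x \<ge> 0"
    and le: "(LINT x:\<Omega>|lborel. h x) \<le> 0" and x: "x \<in> \<Omega>"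
  shows "h x = 0"
proof (rule ccontr)
  assume "h x \<noteq> 0"
  define U where "U = \<Omega> \<inter> h -` {0<..}"
  have U: "open U" unfolding U_def by (rule continuous_open_preimage[OF h(1) \<Omega>]) simp
  have "x \<in> U" using \<open>h x \<noteq> 0\<close> h(3)[OF x] x by (simp add: U_def)
  have "0 \<le> (LINT x:\<Omega>|lborel. h x)"
    unfolding set_lebesgue_integral_def using h(3) by (intro Bochner_Integration.integral_nonneg) (auto simp: indicator_def)
  with le have "(\<integral>x. indicator \<Omega> x *\<^sub>R h x \<partial>lborel) = 0" by (simp add: set_lebesgue_integral_def)
  then have "AE x in lborel. indicator \<Omega> x *\<^sub>R h x = 0"
    using h(2,3) unfolding set_integrable_def
    by (subst (asm) integral_nonneg_eq_0_iff_AE) (auto simp: indicator_def)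
  then have "AE x in lborel. x \<notin> U"
    by eventually_elim (auto simp: U_def indicator_def split: if_splits)
  then have "U \<in> null_sets lborel" using U by (subst (asm) AE_iff_null_sets[symmetric]) auto
  then have "negligible U" by (simp add: negligible_iff_null_sets null_sets_completionI)
  then show False using open_not_negligible[OF U] \<open>x \<in> U\<close> by auto
qed

section \<open>Large diffusion forces constant solutions\<close>

definition average :: "'a::euclidean_space set \<Rightarrow> ('a \<Rightarrow> real) \<Rightarrow> real" where
  "average \<Omega> u = (LINT x:\<Omega>|lborel. u x) / measure lborel \<Omega>"

lemma set_integral_const_lborel:
  assumes "open \<Omega>" "bounded \<Omega>"
  shows "(LINT x:\<Omega>|lborel. c) = c * measure lborel \<Omega>" "set_integrable lborel \<Omega> (\<lambda>_. c :: real)"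
  using assms emeasure_bounded_finite[OF assms(2)]
  by (auto simp: set_lebesgue_integral_def set_integrable_def)

lemma measure_open_bounded_pos:
  fixes \<Omega> :: "'a::euclidean_space set"
  assumes "open \<Omega>" "bounded \<Omega>" "\<Omega> \<noteq> {}"
  shows "measure lborel \<Omega> > 0"
proof -
  obtain z where "z \<in> \<Omega>" using assms by blast
  then obtain r where "r > 0" "ball z r \<subseteq> \<Omega>" using assms unfolding open_contains_ball by blast
  have "0 < measure lborel (ball z r)" using content_ball_pos[OF \<open>r > 0\<close>] by simp
  also have "\<dots> \<le> measure lborel \<Omega>"
    by (rule measure_mono_fmeasurable[OF \<open>ball z r \<subseteq> \<Omega>\<close>])
      (use assms emeasure_bounded_finite[OF assms(2)] in \<open>auto simp: fmeasurable_def\<close>)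
  finally show ?thesis .
qed

lemma set_integral_minus_average:
  fixes \<Omega> :: "'a::euclidean_space set"
  assumes "open \<Omega>" "bounded \<Omega>" "\<Omega> \<noteq> {}" "set_integrable lborel \<Omega> u"
  shows "(LINT x:\<Omega>|lborel. u x - average \<Omega> u) = 0"
  using set_integral_diff(2)[OF assms(4) set_integral_const_lborel(2)[OF assms(1,2)]]
    measure_open_bounded_pos[OF assms(1-3)]
  by (simp add: set_integral_const_lborel[OF assms(1,2)] average_def)

lemma average_in_interval:
  fixes \<Omega> :: "'a::euclidean_space set"
  assumes \<Omega>: "open \<Omega>" "bounded \<Omega>" "\<Omega> \<noteq> {}" and u: "set_integrable lborel \<Omega> u"
    and ab: "\<And>x. x \<in> \<Omega> \<Longrightarrow> u x \<in> {a..b}"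
  shows "average \<Omega> u \<in> {a..b}"
proof -
  have "a * measure lborel \<Omega> \<le> (LINT x:\<Omega>|lborel. u x)"
    using set_integral_mono[OF set_integral_const_lborel(2)[OF \<Omega>(1,2)] u, of a] ab
    by (simp add: set_integral_const_lborel[OF \<Omega>(1,2)])
  moreover have "(LINT x:\<Omega>|lborel. u x) \<le> b * measure lborel \<Omega>"
    using set_integral_mono[OF u set_integral_const_lborel(2)[OF \<Omega>(1,2)], of b] ab
    by (simp add: set_integral_const_lborel[OF \<Omega>(1,2)])
  ultimately show ?thesis
    using measure_open_bounded_pos[OF \<Omega>] by (simp add: average_def field_simps)
qed

lemma nn_set_integral_eq:
  assumes "set_integrable M A h" "\<And>x. x \<in> A \<Longrightarrow> h x \<ge> 0"
  shows "(\<integral>\<^sup>+x\<in>A. ennreal (h x) \<partial>M) = ennreal (LINT x:A|M. h x)"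
proof -
  have "(\<integral>\<^sup>+x\<in>A. ennreal (h x) \<partial>M) = (\<integral>\<^sup>+x. ennreal (indicator A x *\<^sub>R h x) \<partial>M)"
    by (intro nn_integral_cong) (auto simp: indicator_def)
  also have "\<dots> = ennreal (LINT x:A|M. h x)"
    unfolding set_lebesgue_integral_def
    by (rule nn_integral_eq_integral) (use assms in \<open>auto simp: set_integrable_def indicator_def\<close>)
  finally show ?thesis .
qed

lemma smooth_up_to_boundary_set_integrable:
  fixes \<Omega> :: "(real ^ 'n::finite) set"
  assumes w: "smooth_up_to_boundary \<Omega> w" and \<Omega>: "open \<Omega>" "bounded \<Omega>"
  shows "set_integrable lborel \<Omega> (\<lambda>x. w x - a)"
    and "set_integrable lborel \<Omega> (\<lambda>x. (w x - a)\<^sup>2)"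
    and "set_integrable lborel \<Omega> (\<lambda>x. (norm (gradient w x))\<^sup>2)"
    and "set_integrable lborel \<Omega> (\<lambda>x. (w x - a) * laplacian w x)"
    and "continuous_on \<Omega> w"
proof -
  note it = smooth_up_to_boundary_iterated_partial[OF w \<Omega>]
  note it0 = it[where js="[]", simplified]
  show cw: "continuous_on \<Omega> w" by (rule GDERIV_imp_continuous_on[OF it0(2)])
  have bw: "bounded ((\<lambda>x. w x - a) ` \<Omega>)"
    using bounded_translation[OF it0(1), of "-a"] by (simp add: image_image)
  show "set_integrable lborel \<Omega> (\<lambda>x. w x - a)"
    by (intro set_integrable_continuous_bounded \<Omega> bw continuous_intros cw)
  show "set_integrable lborel \<Omega> (\<lambda>x. (w x - a)\<^sup>2)"
    unfolding power2_eq_square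
    by (intro set_integrable_continuous_bounded \<Omega> bounded_image_mult bw continuous_intros cw)
  have "bounded ((\<lambda>x. norm (gradient w x)) ` \<Omega>)" using it0(4) by (auto simp: bounded_iff)
  then show "set_integrable lborel \<Omega> (\<lambda>x. (norm (gradient w x))\<^sup>2)"
    unfolding power2_eq_square
    by (intro set_integrable_continuous_bounded \<Omega> bounded_image_mult continuous_intros it0(3))
  have 1: "set_integrable lborel \<Omega> (\<lambda>x. (w x - a) * iterated_partial [i, i] w x)" for i
    by (intro set_integrable_continuous_bounded \<Omega> bounded_image_mult bw continuous_on_mult
        continuous_on_diff continuous_on_const cw GDERIV_imp_continuous_on[OF it(2)] it(1))
  have "set_integrable lborel \<Omega> (\<lambda>x. \<Sum>i\<in>UNIV. (w x - a) * iterated_partial [i, i] w x)"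
    using 1 unfolding set_integrable_def scaleR_sum_right by (rule Bochner_Integration.integrable_sum)
  then show "set_integrable lborel \<Omega> (\<lambda>x. (w x - a) * laplacian w x)"
    by (simp add: laplacian_def sum_distrib_left)
qed

text \<open>Among all constants, the average minimises the mean square deviation, so the unspecified constant of the
  Poincare inequality may be replaced by it.\<close>

lemma poincare_average:
  fixes \<Omega> :: "(real ^ 'n::finite) set"
  assumes \<Omega>: "bounded_smooth_domain \<Omega>"
  shows "\<exists>K>0. \<forall>u. smooth_up_to_boundary \<Omega> u \<longrightarrow>
     (LINT x:\<Omega>|lborel. (u x - average \<Omega> u)\<^sup>2) \<le> K * (LINT x:\<Omega>|lborel. (norm (gradient u x))\<^sup>2)"
proof -
  have op: "open \<Omega>" and bd: "bounded \<Omega>" and co: "connected \<Omega>" and ne: "\<Omega> \<noteq> {}"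
    using \<Omega> by (auto simp: bounded_smooth_domain_def)
  obtain K where K: "K > 0" and poincare: "\<And>u g. (\<forall>x\<in>\<Omega>. GDERIV u x :> g x) \<and> continuous_on \<Omega> g \<longrightarrow>
     (\<exists>c. (\<integral>\<^sup>+x\<in>\<Omega>. ennreal ((u x - c)\<^sup>2) \<partial>lborel)
        \<le> ennreal K * (\<integral>\<^sup>+x\<in>\<Omega>. ennreal ((norm (g x))\<^sup>2) \<partial>lborel))"
    using poincare_inequality[OF op co bd ne boundary_segment[OF \<Omega>]] by blast
  show ?thesis
  proof (rule exI[of _ K], intro conjI K allI impI)
    fix u assume u: "smooth_up_to_boundary \<Omega> u"
    note it = smooth_up_to_boundary_iterated_partial[OF u op bd, where js="[]", simplified]
    note integrable = smooth_up_to_boundary_set_integrable[OF u op bd]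
    note iu = integrable(1) and iu2 = integrable(2) and ig = integrable(3)
    define m where "m = average \<Omega> u"
    from poincare[rule_format, of u "gradient u"] it(2,3)
    obtain c where "(\<integral>\<^sup>+x\<in>\<Omega>. ennreal ((u x - c)\<^sup>2) \<partial>lborel)
        \<le> ennreal K * (\<integral>\<^sup>+x\<in>\<Omega>. ennreal ((norm (gradient u x))\<^sup>2) \<partial>lborel)" by auto
    moreover have E0: "(LINT x:\<Omega>|lborel. (norm (gradient u x))\<^sup>2) \<ge> 0"
      unfolding set_lebesgue_integral_def by (intro Bochner_Integration.integral_nonneg) auto
    ultimately have 1: "(LINT x:\<Omega>|lborel. (u x - c)\<^sup>2) \<le> K * (LINT x:\<Omega>|lborel. (norm (gradient u x))\<^sup>2)"
      using K by (simp add: nn_set_integral_eq iu2 ig flip: ennreal_mult)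
    have "(LINT x:\<Omega>|lborel. (u x - m)\<^sup>2)
        = (LINT x:\<Omega>|lborel. (u x - m)\<^sup>2 + (2 * (m - c)) * (u x - m))"
      using set_integral_minus_average[OF op bd ne, of u] iu[of 0] iu[of m] iu2[of m]
      by (simp add: m_def)
    also have "\<dots> \<le> (LINT x:\<Omega>|lborel. (u x - c)\<^sup>2)"
    proof (rule set_integral_mono)
      show "set_integrable lborel \<Omega> (\<lambda>x. (u x - m)\<^sup>2 + (2 * (m - c)) * (u x - m))"
        by (intro set_integral_add iu2 set_integrable_mult_right iu)
      fix x
      have "(u x - c)\<^sup>2 = (u x - m)\<^sup>2 + (2 * (m - c)) * (u x - m) + (m - c)\<^sup>2"
        by (simp add: power2_eq_square algebra_simps)
      then show "(u x - m)\<^sup>2 + (2 * (m - c)) * (u x - m) \<le> (u x - c)\<^sup>2" by simp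
    qed (rule iu2)
    finally show "(LINT x:\<Omega>|lborel. (u x - average \<Omega> u)\<^sup>2) \<le> K * (LINT x:\<Omega>|lborel. (norm (gradient u x))\<^sup>2)"
      using 1 by (simp add: m_def)
  qed
qed

text \<open>The energy argument for a general two-component system. The hypothesis \<open>mono\<close> combines a Lipschitz bound for
  \<open>g\<close> in the first variable with strict monotonicity in the second. The interval \<open>I\<close> may be larger than
  the range \<open>[\<alpha>,\<beta>]\<close> of the solutions, because the zero \<open>w\<close> of \<open>g(m, \<cdot>)\<close> can lie outside that range.\<close>

theorem large_diffusion_forces_constants:
  fixes \<Omega> :: "(real ^ 'n::finite) set" and f g :: "real \<Rightarrow> real \<Rightarrow> real"
  assumes \<Omega>: "bounded_smooth_domain \<Omega>" and L: "L \<ge> 0"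
    and lip: "\<And>a a' b b'. {a, a', b, b'} \<subseteq> I \<Longrightarrow> \<bar>f a b - f a' b'\<bar> \<le> L * (\<bar>a - a'\<bar> + \<bar>b - b'\<bar>)"
    and mono: "\<And>a a' b b'. {a, a', b, b'} \<subseteq> I \<Longrightarrow>
        (b - b') * (g a b - g a' b') \<le> L * (\<bar>a - a'\<bar> * \<bar>b - b'\<bar>) - (b - b')\<^sup>2"
    and I: "{\<alpha>..\<beta>} \<subseteq> I" and root: "\<And>a. a \<in> {\<alpha>..\<beta>} \<Longrightarrow> \<exists>b\<in>I. g a b = 0"
  shows "\<exists>C>0. \<forall>d\<^sub>1 d\<^sub>2 u v. d\<^sub>1 \<ge> C \<and> d\<^sub>2 > 0 \<and>
      smooth_up_to_boundary \<Omega> u \<and> smooth_up_to_boundary \<Omega> v \<and> neumann_condition \<Omega> u \<and> neumann_condition \<Omega> v \<and>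
      (\<forall>x\<in>\<Omega>. u x \<in> {\<alpha>..\<beta>} \<and> v x \<in> {\<alpha>..\<beta>} \<and>
        d\<^sub>1 * laplacian u x + f (u x) (v x) = 0 \<and> d\<^sub>2 * laplacian v x + g (u x) (v x) = 0)
      \<longrightarrow> (\<exists>a b. \<forall>x\<in>\<Omega>. u x = a \<and> v x = b)"
proof -
  have op: "open \<Omega>" and bd: "bounded \<Omega>" and ne: "\<Omega> \<noteq> {}"
    using \<Omega> by (auto simp: bounded_smooth_domain_def)
  obtain K where K: "K > 0" and poincare: "\<And>u. smooth_up_to_boundary \<Omega> u \<Longrightarrow>
     (LINT x:\<Omega>|lborel. (u x - average \<Omega> u)\<^sup>2) \<le> K * (LINT x:\<Omega>|lborel. (norm (gradient u x))\<^sup>2)"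
    using poincare_average[OF \<Omega>] by blast
  \<comment> \<open>From \<open>L (U + (U + V)/2)\<close> with \<open>V \<le> L\<^sup>2 U\<close>, where \<open>U\<close> and \<open>V\<close> are the integrals of the squared deviations below.\<close>
  define \<Lambda> where "\<Lambda> = L * (3 / 2 + L\<^sup>2 / 2)"
  have \<Lambda>: "\<Lambda> \<ge> 0" using L by (simp add: \<Lambda>_def)
  define C where "C = \<Lambda> * K + 1"
  have C: "C > 0" using \<Lambda> K by (simp add: C_def add_nonneg_pos)
  show ?thesis
  proof (rule exI[of _ C], intro conjI C allI impI, elim conjE)
    fix d\<^sub>1 d\<^sub>2 :: real and u v
    assume d1: "d\<^sub>1 \<ge> C" and d2: "d\<^sub>2 > 0"
      and u: "smooth_up_to_boundary \<Omega> u" and v: "smooth_up_to_boundary \<Omega> v"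
      and nu: "neumann_condition \<Omega> u" and nv: "neumann_condition \<Omega> v"
      and eqs: "\<forall>x\<in>\<Omega>. u x \<in> {\<alpha>..\<beta>} \<and> v x \<in> {\<alpha>..\<beta>} \<and>
        d\<^sub>1 * laplacian u x + f (u x) (v x) = 0 \<and> d\<^sub>2 * laplacian v x + g (u x) (v x) = 0"
    note integrable = smooth_up_to_boundary_set_integrable[OF _ op bd]
    have energy: "(LINT x:\<Omega>|lborel. (norm (gradient w x))\<^sup>2) = - (LINT x:\<Omega>|lborel. (w x - a) * laplacian w x)"
      if "smooth_up_to_boundary \<Omega> w" "neumann_condition \<Omega> w" for w a
      using green_identity[OF \<Omega> that, of a] integrable(3,4)[OF that(1)] by simp
    define E where "E w = (LINT x:\<Omega>|lborel. (norm (gradient w x))\<^sup>2)" for w :: "real ^ 'n \<Rightarrow> real"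
    have E0: "E w \<ge> 0" for w
      unfolding E_def set_lebesgue_integral_def by (intro Bochner_Integration.integral_nonneg) auto
    define m where "m = average \<Omega> u"
    have m: "m \<in> {\<alpha>..\<beta>}"
      unfolding m_def using average_in_interval[OF op bd ne, of u] integrable(1)[OF u, of 0] eqs by auto
    then obtain w where w: "w \<in> I" "g m w = 0" using root by blast
    have inI: "{u x, m, v x, w} \<subseteq> I" if "x \<in> \<Omega>" for x using eqs that I m w by blast
    define U where "U = (LINT x:\<Omega>|lborel. (u x - m)\<^sup>2)"
    define V where "V = (LINT x:\<Omega>|lborel. (v x - w)\<^sup>2)"
    note iU = integrable(2)[OF u, of m] and iV = integrable(2)[OF v, of w]
    have young: "L * (s * t) \<le> L\<^sup>2 / 2 * s\<^sup>2 + 1 / 2 * t\<^sup>2" for s t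
      using zero_le_power2[of "L * s - t"] by (simp add: power2_eq_square algebra_simps)
    have young1: "s * t \<le> s\<^sup>2 / 2 + t\<^sup>2 / 2" for s t :: real
      using zero_le_power2[of "s - t"] by (simp add: power2_eq_square algebra_simps)
    have VU: "V \<le> L\<^sup>2 * U"
    proof -
      have "0 \<le> d\<^sub>2 * E v" using d2 E0 by simp
      also have "d\<^sub>2 * E v = (LINT x:\<Omega>|lborel. (- d\<^sub>2) * ((v x - w) * laplacian v x))"
        unfolding E_def energy[OF v nv, of w] set_integral_mult_right by simp
      also have "\<dots> \<le> (LINT x:\<Omega>|lborel. (L\<^sup>2 / 2) * (u x - m)\<^sup>2 + (- 1 / 2) * (v x - w)\<^sup>2)"
      proof (rule set_integral_mono)
        fix x assume x: "x \<in> \<Omega>"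
        have "- d\<^sub>2 * laplacian v x = g (u x) (v x) - g m w" using eqs x w by auto
        then have "(- d\<^sub>2) * ((v x - w) * laplacian v x) = (v x - w) * (g (u x) (v x) - g m w)"
          by (metis mult.left_commute)
        also have "\<dots> \<le> L * (\<bar>u x - m\<bar> * \<bar>v x - w\<bar>) - (v x - w)\<^sup>2" by (rule mono[OF inI[OF x]])
        also have "\<dots> \<le> (L\<^sup>2 / 2) * (u x - m)\<^sup>2 + (- 1 / 2) * (v x - w)\<^sup>2"
          using young[of "\<bar>u x - m\<bar>" "\<bar>v x - w\<bar>"] by simp
        finally show "(- d\<^sub>2) * ((v x - w) * laplacian v x) \<le> (L\<^sup>2 / 2) * (u x - m)\<^sup>2 + (- 1 / 2) * (v x - w)\<^sup>2" .
      qed (intro set_integral_add set_integrable_mult_right iU iV integrable(4)[OF v])+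
      also have "\<dots> = (L\<^sup>2 / 2) * U + (- 1 / 2) * V"
        using iU iV unfolding U_def V_def
        by (subst set_integral_add) (simp_all only: set_integral_mult_right set_integrable_mult_right)
      finally show ?thesis by simp
    qed
    have "d\<^sub>1 * E u \<le> \<Lambda> * U"
    proof -
      have "d\<^sub>1 * E u = (LINT x:\<Omega>|lborel. (- d\<^sub>1) * ((u x - m) * laplacian u x))"
        unfolding E_def energy[OF u nu, of m] set_integral_mult_right by simp
      also have "\<dots> \<le> (LINT x:\<Omega>|lborel. (L * (3 / 2)) * (u x - m)\<^sup>2 + (L / 2) * (v x - w)\<^sup>2 + f m w * (u x - m))"
      proof (rule set_integral_mono)
        fix x assume x: "x \<in> \<Omega>"
        have "- d\<^sub>1 * laplacian u x = f (u x) (v x)" using eqs x by auto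
        then have "(- d\<^sub>1) * ((u x - m) * laplacian u x) = (u x - m) * f (u x) (v x)"
          by (metis mult.left_commute)
        also have "\<dots> = (u x - m) * (f (u x) (v x) - f m w) + f m w * (u x - m)"
          by (simp add: algebra_simps)
        also have "(u x - m) * (f (u x) (v x) - f m w) \<le> \<bar>u x - m\<bar> * \<bar>f (u x) (v x) - f m w\<bar>"
          by (metis abs_ge_self abs_mult)
        also have "\<dots> \<le> \<bar>u x - m\<bar> * (L * (\<bar>u x - m\<bar> + \<bar>v x - w\<bar>))"
          by (intro mult_left_mono lip inI[OF x]) auto
        also have "\<dots> = L * ((u x - m)\<^sup>2 + \<bar>u x - m\<bar> * \<bar>v x - w\<bar>)"
          by (simp add: power2_eq_square algebra_simps flip: abs_mult_self_eq[of "u x - m"])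
        also have "\<dots> \<le> L * ((u x - m)\<^sup>2 + ((u x - m)\<^sup>2 / 2 + (v x - w)\<^sup>2 / 2))"
          using young1[of "\<bar>u x - m\<bar>" "\<bar>v x - w\<bar>"] L by (intro mult_left_mono add_left_mono) auto
        also have "\<dots> = (L * (3 / 2)) * (u x - m)\<^sup>2 + (L / 2) * (v x - w)\<^sup>2" by (simp add: field_simps)
        finally show "(- d\<^sub>1) * ((u x - m) * laplacian u x)
            \<le> (L * (3 / 2)) * (u x - m)\<^sup>2 + (L / 2) * (v x - w)\<^sup>2 + f m w * (u x - m)" by simp
      qed (intro set_integral_add set_integrable_mult_right iU iV integrable(4)[OF u] integrable(1)[OF u])+
      also have "\<dots> = (LINT x:\<Omega>|lborel. (L * (3 / 2)) * (u x - m)\<^sup>2 + (L / 2) * (v x - w)\<^sup>2)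
            + (LINT x:\<Omega>|lborel. f m w * (u x - m))"
        by (intro set_integral_add(2) set_integral_add(1) set_integrable_mult_right iU iV integrable(1)[OF u])
      also have "(LINT x:\<Omega>|lborel. f m w * (u x - m)) = 0"
        using set_integral_minus_average[OF op bd ne, of u] integrable(1)[OF u, of 0] by (simp add: m_def)
      also have "(LINT x:\<Omega>|lborel. (L * (3 / 2)) * (u x - m)\<^sup>2 + (L / 2) * (v x - w)\<^sup>2)
          = (L * (3 / 2)) * U + (L / 2) * V"
        using iU iV unfolding U_def V_def
        by (subst set_integral_add) (simp_all only: set_integral_mult_right set_integrable_mult_right)
      also have "(L * (3 / 2)) * U + (L / 2) * V \<le> (L * (3 / 2)) * U + (L / 2) * (L\<^sup>2 * U)"
        using VU L by (intro add_left_mono mult_left_mono) auto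
      finally show ?thesis by (simp add: \<Lambda>_def algebra_simps)
    qed
    also have "\<Lambda> * U \<le> \<Lambda> * (K * E u)"
      unfolding U_def E_def m_def using \<Lambda> by (intro mult_left_mono poincare u)
    finally have "(d\<^sub>1 - \<Lambda> * K) * E u \<le> 0" by (simp add: algebra_simps)
    moreover have "1 * E u \<le> (d\<^sub>1 - \<Lambda> * K) * E u"
      using d1 E0[of u] by (intro mult_right_mono) (auto simp: C_def)
    ultimately have "E u \<le> 0" by simp
    then have "K * E u \<le> 0" using K by (simp add: mult_le_0_iff)
    then have U0: "U \<le> 0" using poincare[OF u] by (simp add: U_def m_def E_def)
    then have V0: "V \<le> 0" using VU mult_nonneg_nonpos[OF zero_le_power2[of L] U0] by linarith
    have "u x = m \<and> v x = w" if x: "x \<in> \<Omega>" for x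
    proof
      have "(u x - m)\<^sup>2 = 0"
        using U0 unfolding U_def
        by (intro set_integral_zero_imp_zero[OF op _ iU _ _ x] continuous_intros integrable(5)[OF u]) auto
      then show "u x = m" by simp
      have "(v x - w)\<^sup>2 = 0"
        using V0 unfolding V_def
        by (intro set_integral_zero_imp_zero[OF op _ iV _ _ x] continuous_intros integrable(5)[OF v]) auto
      then show "v x = w" by simp
    qed
    then show "\<exists>a b. \<forall>x\<in>\<Omega>. u x = a \<and> v x = b" by blast
  qed
qed

section \<open>The kinetics and the constant equilibrium\<close>

lemma powr_lipschitz_on_interval:
  fixes A B e :: real
  assumes A: "A > 0"
  shows "\<exists>L\<ge>0. \<forall>x\<in>{A..B}. \<forall>y\<in>{A..B}. \<bar>x powr e - y powr e\<bar> \<le> L * \<bar>x - y\<bar>"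
proof -
  have "compact ((\<lambda>x. e * x powr (e - 1)) ` {A..B})"
    using A by (intro compact_continuous_image continuous_intros) auto
  then have "bounded ((\<lambda>x. e * x powr (e - 1)) ` {A..B})" by (rule compact_imp_bounded)
  then obtain L where "\<forall>x\<in>{A..B}. \<bar>e * x powr (e - 1)\<bar> \<le> L" by (auto simp: bounded_iff)
  then have L: "\<bar>e * x powr (e - 1)\<bar> \<le> \<bar>L\<bar>" if "x \<in> {A..B}" for x using that by fastforce
  have "\<bar>x powr e - y powr e\<bar> \<le> \<bar>L\<bar> * \<bar>x - y\<bar>" if "x \<in> {A..B}" "y \<in> {A..B}" for x y
  proof -
    have "norm (x powr e - y powr e) \<le> \<bar>L\<bar> * norm (x - y)"
    proof (rule field_differentiable_bound[where S="{A..B}" and f'="\<lambda>x. e * x powr (e - 1)"])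
      show "((\<lambda>x. x powr e) has_field_derivative e * z powr (e - 1)) (at z within {A..B})"
        if "z \<in> {A..B}" for z
        using that A by (intro has_real_derivative_powr has_field_derivative_at_within) auto
    qed (use L that in auto)
    then show ?thesis by simp
  qed
  then show ?thesis by (intro exI[of _ "\<bar>L\<bar>"]) auto
qed

text \<open>A power is monotone, in a direction that depends on the sign of the exponent, so on the interval
  it is at most one of its two end values.\<close>

lemma powr_le_on_interval:
  fixes A B e :: real
  assumes A: "A > 0" and x: "x \<in> {A..B}"
  shows "x powr e \<le> A powr e + B powr e"
proof (cases "e \<ge> 0")
  case True
  then have "x powr e \<le> B powr e" using A x by (intro powr_mono2) auto
  then show ?thesis by (simp add: add_increasing)
next
  case False
  then have "x powr e \<le> A powr e" using A x by (intro powr_mono2') auto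
  then show ?thesis by (simp add: add_increasing2)
qed

lemma activator_kinetics_lipschitz:
  fixes A B p q \<sigma> :: real
  assumes A: "A > 0"
  shows "\<exists>L\<ge>0. \<forall>a a' b b'. {a, a', b, b'} \<subseteq> {A..B} \<longrightarrow>
    \<bar>(- a + a powr p / b powr q + \<sigma>) - (- a' + a' powr p / b' powr q + \<sigma>)\<bar> \<le> L * (\<bar>a - a'\<bar> + \<bar>b - b'\<bar>)"
proof -
  obtain Lp where Lp: "Lp \<ge> 0" "\<And>x y. x \<in> {A..B} \<Longrightarrow> y \<in> {A..B} \<Longrightarrow> \<bar>x powr p - y powr p\<bar> \<le> Lp * \<bar>x - y\<bar>"
    using powr_lipschitz_on_interval[OF A] by blast
  obtain Lq where Lq: "Lq \<ge> 0" "\<And>x y. x \<in> {A..B} \<Longrightarrow> y \<in> {A..B} \<Longrightarrow> \<bar>x powr (- q) - y powr (- q)\<bar> \<le> Lq * \<bar>x - y\<bar>"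
    using powr_lipschitz_on_interval[OF A] by blast
  define Mp where "Mp = A powr p + B powr p"
  define Mq where "Mq = A powr (- q) + B powr (- q)"
  have M: "Mp \<ge> 0" "Mq \<ge> 0" by (auto simp: Mp_def Mq_def)
  define L where "L = 1 + Mq * Lp + Mp * Lq"
  have L: "L \<ge> 0" using M Lp(1) Lq(1) by (simp add: L_def)
  have "\<bar>(- a + a powr p / b powr q + \<sigma>) - (- a' + a' powr p / b' powr q + \<sigma>)\<bar> \<le> L * (\<bar>a - a'\<bar> + \<bar>b - b'\<bar>)"
    if "{a, a', b, b'} \<subseteq> {A..B}" for a a' b b'
  proof -
    have I: "a \<in> {A..B}" "a' \<in> {A..B}" "b \<in> {A..B}" "b' \<in> {A..B}" using that by auto
    have "(- a + a powr p / b powr q + \<sigma>) - (- a' + a' powr p / b' powr q + \<sigma>)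
        = - (a - a') + b powr (- q) * (a powr p - a' powr p) + a' powr p * (b powr (- q) - b' powr (- q))"
      by (simp add: powr_minus divide_inverse algebra_simps)
    also have "\<bar>\<dots>\<bar> \<le> \<bar>a - a'\<bar> + \<bar>b powr (- q) * (a powr p - a' powr p)\<bar> + \<bar>a' powr p * (b powr (- q) - b' powr (- q))\<bar>"
      by linarith
    also have "\<bar>b powr (- q) * (a powr p - a' powr p)\<bar> \<le> Mq * (Lp * \<bar>a - a'\<bar>)"
      unfolding abs_mult Mq_def using powr_le_on_interval[OF A I(3), of "- q"] Lp(2)[OF I(1,2)]
      by (intro mult_mono) auto
    also have "\<bar>a' powr p * (b powr (- q) - b' powr (- q))\<bar> \<le> Mp * (Lq * \<bar>b - b'\<bar>)"
      unfolding abs_mult Mp_def using powr_le_on_interval[OF A I(2), of p] Lq(2)[OF I(3,4)]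
      by (intro mult_mono) auto
    also have "\<bar>a - a'\<bar> + Mq * (Lp * \<bar>a - a'\<bar>) + Mp * (Lq * \<bar>b - b'\<bar>)
        = (1 + Mq * Lp) * \<bar>a - a'\<bar> + (Mp * Lq) * \<bar>b - b'\<bar>" by (simp add: algebra_simps)
    also have "\<dots> \<le> L * \<bar>a - a'\<bar> + L * \<bar>b - b'\<bar>"
      using M Lp(1) Lq(1) by (intro add_mono mult_right_mono) (auto simp: L_def)
    finally show ?thesis by (simp add: distrib_left)
  qed
  then show ?thesis using L by blast
qed

text \<open>The term \<open>-b\<close> contributes \<open>-(b - b')\<^sup>2\<close>, and \<open>b\<^sup>-\<^sup>s\<close> is nonincreasing as \<open>s \<ge> 0\<close>, so only
  the variation of \<open>a\<^sup>r\<close> has to be estimated.\<close>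

lemma inhibitor_kinetics_monotone:
  fixes A B r s :: real
  assumes A: "A > 0" and s: "s \<ge> 0"
  shows "\<exists>L\<ge>0. \<forall>a a' b b'. {a, a', b, b'} \<subseteq> {A..B} \<longrightarrow>
    (b - b') * ((- b + a powr r / b powr s) - (- b' + a' powr r / b' powr s))
      \<le> L * (\<bar>a - a'\<bar> * \<bar>b - b'\<bar>) - (b - b')\<^sup>2"
proof -
  obtain Lr where Lr: "Lr \<ge> 0" "\<And>x y. x \<in> {A..B} \<Longrightarrow> y \<in> {A..B} \<Longrightarrow> \<bar>x powr r - y powr r\<bar> \<le> Lr * \<bar>x - y\<bar>"
    using powr_lipschitz_on_interval[OF A] by blast
  define M where "M = A powr (- s) + B powr (- s)"
  have M: "M \<ge> 0" by (simp add: M_def)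
  have "(b - b') * ((- b + a powr r / b powr s) - (- b' + a' powr r / b' powr s))
      \<le> (M * Lr) * (\<bar>a - a'\<bar> * \<bar>b - b'\<bar>) - (b - b')\<^sup>2"
    if "{a, a', b, b'} \<subseteq> {A..B}" for a a' b b'
  proof -
    have I: "a \<in> {A..B}" "a' \<in> {A..B}" "b \<in> {A..B}" "b' \<in> {A..B}" using that by auto
    have anti: "(b - b') * (b powr (- s) - b' powr (- s)) \<le> 0"
    proof (cases "b \<le> b'")
      case True
      then have "b' powr (- s) \<le> b powr (- s)" using A I s by (intro powr_mono2') auto
      then show ?thesis using True by (simp add: mult_nonpos_nonneg)
    next
      case False
      then have "b powr (- s) \<le> b' powr (- s)" using A I s by (intro powr_mono2') auto
      then show ?thesis using False by (simp add: mult_nonneg_nonpos)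
    qed
    have "(b - b') * ((- b + a powr r / b powr s) - (- b' + a' powr r / b' powr s))
        = - (b - b')\<^sup>2 + (b - b') * (b powr (- s) * (a powr r - a' powr r))
          + a' powr r * ((b - b') * (b powr (- s) - b' powr (- s)))"
      by (simp add: powr_minus divide_inverse power2_eq_square algebra_simps)
    also have "a' powr r * ((b - b') * (b powr (- s) - b' powr (- s))) \<le> 0"
      by (rule mult_nonneg_nonpos[OF _ anti]) simp
    also have "(b - b') * (b powr (- s) * (a powr r - a' powr r)) \<le> \<bar>b - b'\<bar> * (b powr (- s) * \<bar>a powr r - a' powr r\<bar>)"
      by (rule order_trans[OF abs_ge_self]) (simp add: abs_mult)
    also have "\<dots> \<le> \<bar>b - b'\<bar> * (M * (Lr * \<bar>a - a'\<bar>))"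
      unfolding M_def using powr_le_on_interval[OF A I(3), of "- s"] Lr(2)[OF I(1,2)]
      by (intro mult_mono) auto
    finally show ?thesis by (simp add: algebra_simps)
  qed
  then show ?thesis using M Lr(1) by (intro exI[of _ "M * Lr"]) auto
qed

lemma inhibitor_equilibrium_iff:
  fixes a b r s :: real
  assumes "a > 0" "b > 0" "s \<ge> 0"
  shows "- b + a powr r / b powr s = 0 \<longleftrightarrow> b = a powr (r / (s + 1))"
proof -
  have "- b + a powr r / b powr s = 0 \<longleftrightarrow> b * b powr s = a powr r"
    using assms by (auto simp: field_simps)
  also have "b * b powr s = b powr (s + 1)" using assms by (simp add: powr_add)
  also have "b powr (s + 1) = a powr r \<longleftrightarrow> b = a powr (r / (s + 1))"
  proof
    assume "b powr (s + 1) = a powr r"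
    then have "(b powr (s + 1)) powr (1 / (s + 1)) = (a powr r) powr (1 / (s + 1))" by simp
    then show "b = a powr (r / (s + 1))" using assms by (simp add: powr_powr)
  next
    assume "b = a powr (r / (s + 1))"
    then show "b powr (s + 1) = a powr r" using assms by (simp add: powr_powr)
  qed
  finally show ?thesis .
qed

text \<open>The equation reads \<open>a (1 - a\<^sup>\<theta>\<^sup>-\<^sup>1) = \<sigma>\<close>. As \<open>\<sigma> \<ge> 0\<close>, the second factor is nonnegative at a root. Both factors
  increase, so the left-hand side increases strictly from any root on. It vanishes at \<open>1\<close> and is unbounded,
  hence takes the value \<open>\<sigma>\<close>.\<close>

lemma unique_root_sublinear:
  fixes \<theta> \<sigma> :: real
  assumes \<theta>: "\<theta> < 1" and \<sigma>: "\<sigma> \<ge> 0"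
  shows "\<exists>!a. a > 0 \<and> - a + a powr \<theta> + \<sigma> = 0"
proof -
  define h where "h a = a * (1 - a powr (\<theta> - 1))" for a :: real
  have h: "- a + a powr \<theta> + \<sigma> = 0 \<longleftrightarrow> h a = \<sigma>" if "a > 0" for a
  proof -
    have "a * a powr (\<theta> - 1) = a powr \<theta>" using that by (simp add: powr_diff)
    then show ?thesis by (auto simp: h_def right_diff_distrib)
  qed
  have unique: False if a: "a > 0" "h a = \<sigma>" and b: "a < b" "h b = \<sigma>" for a b
  proof -
    have "1 - a powr (\<theta> - 1) \<ge> 0" using a \<sigma> by (auto simp: h_def zero_le_mult_iff)
    moreover have "b powr (\<theta> - 1) < a powr (\<theta> - 1)" using a b \<theta> by (intro powr_less_mono2_neg) auto
    ultimately have "a * (1 - a powr (\<theta> - 1)) < b * (1 - b powr (\<theta> - 1))"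
      using a b by (intro mult_strict_mono') auto
    then show False using a b by (simp add: h_def)
  qed
  define k where "k = 1 - 2 powr (\<theta> - 1)"
  have k: "k > 0" using \<theta> powr_less_mono[of "\<theta> - 1" 0 2] by (simp add: k_def)
  define N where "N = max 2 (\<sigma> / k)"
  have N: "N \<ge> 2" "N \<ge> \<sigma> / k" by (auto simp: N_def)
  have "\<sigma> \<le> N * k" using N(2) k by (simp add: pos_divide_le_eq)
  also have "\<dots> \<le> h N"
    unfolding h_def k_def using N \<theta> by (intro mult_left_mono diff_left_mono powr_mono2') auto
  finally have "\<sigma> \<le> h N" .
  moreover have "h 1 \<le> \<sigma>" using \<sigma> by (simp add: h_def)
  moreover have "continuous_on {1..N} h" unfolding h_def by (intro continuous_intros) auto
  ultimately obtain a where a: "1 \<le> a" "a \<le> N" "h a = \<sigma>" using IVT'[of h 1 \<sigma> N] N by auto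
  show ?thesis
  proof (rule ex1I[of _ a])
    show "a > 0 \<and> - a + a powr \<theta> + \<sigma> = 0" using a h by auto
    fix b assume b: "b > 0 \<and> - b + b powr \<theta> + \<sigma> = 0"
    then have "h b = \<sigma>" using h by auto
    then show "b = a" using unique[of a b] unique[of b a] a b by (cases a b rule: linorder_cases) auto
  qed
qed

lemma unique_constant_equilibrium:
  fixes p q r s \<sigma> :: real
  assumes "\<sigma> \<ge> 0" "r \<ge> 0" "s \<ge> 0" "0 < (p - 1) / r" "(p - 1) / r < q / (s + 1)"
  shows "\<exists>!(a, b). a > 0 \<and> b > 0 \<and> - a + a powr p / b powr q + \<sigma> = 0 \<and> - b + a powr r / b powr s = 0"
proof -
  have r: "r > 0" using assms by (cases "r = 0") auto
  define \<theta> where "\<theta> = p - (r / (s + 1)) * q"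
  have "p - 1 < r * (q / (s + 1))" using assms r by (simp add: pos_divide_less_eq mult.commute)
  then have \<theta>: "\<theta> < 1" by (simp add: \<theta>_def)
  have iff: "a > 0 \<and> b > 0 \<and> - a + a powr p / b powr q + \<sigma> = 0 \<and> - b + a powr r / b powr s = 0
      \<longleftrightarrow> (a > 0 \<and> - a + a powr \<theta> + \<sigma> = 0) \<and> b = a powr (r / (s + 1))" for a b
  proof (cases "a > 0 \<and> b > 0")
    case True
    then have "- b + a powr r / b powr s = 0 \<longleftrightarrow> b = a powr (r / (s + 1))"
      by (intro inhibitor_equilibrium_iff) (use assms in auto)
    moreover have "a powr p / b powr q = a powr \<theta>" if "b = a powr (r / (s + 1))"
      using that by (simp add: powr_powr powr_diff \<theta>_def)
    ultimately show ?thesis using True by auto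
  qed auto
  obtain a where a: "a > 0 \<and> - a + a powr \<theta> + \<sigma> = 0" "\<And>c. c > 0 \<and> - c + c powr \<theta> + \<sigma> = 0 \<Longrightarrow> c = a"
    using unique_root_sublinear[OF \<theta> assms(1)] by (auto simp: Ex1_def)
  show ?thesis
  proof (rule ex1I[of _ "(a, a powr (r / (s + 1)))"])
    show "case (a, a powr (r / (s + 1))) of (a, b) \<Rightarrow>
        a > 0 \<and> b > 0 \<and> - a + a powr p / b powr q + \<sigma> = 0 \<and> - b + a powr r / b powr s = 0"
      unfolding prod.case iff using a(1) by simp
    fix z :: "real \<times> real"
    assume "case z of (a, b) \<Rightarrow> a > 0 \<and> b > 0 \<and> - a + a powr p / b powr q + \<sigma> = 0 \<and> - b + a powr r / b powr s = 0"
    then show "z = (a, a powr (r / (s + 1)))"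
      unfolding case_prod_beta iff using a(2)[of "fst z"] by (auto simp: prod_eq_iff)
  qed
qed

text \<open>The function is constant only on the open set, hence the detour through local derivatives instead of the
  derivative of a globally constant function.\<close>

lemma iterated_partial_of_constant:
  fixes \<Omega> :: "(real ^ 'n::finite) set"
  assumes \<Omega>: "open \<Omega>" and f: "\<And>x. x \<in> \<Omega> \<Longrightarrow> f x = c" and x: "x \<in> \<Omega>"
  shows "iterated_partial js f x = (if js = [] then c else 0)" "iterated_partial js f differentiable (at x)"
proof -
  have der: "(h has_derivative (\<lambda>_. 0)) (at x)" if "\<And>x. x \<in> \<Omega> \<Longrightarrow> h x = k" "x \<in> \<Omega>"
    for h :: "real ^ 'n \<Rightarrow> real" and k x
    by (rule has_derivative_transform_within_open[OF has_derivative_const[of k] \<Omega> that(2)]) (simp add: that(1))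
  have val: "iterated_partial js f x = (if js = [] then c else 0)" if "x \<in> \<Omega>" for x js
    using that
  proof (induction js arbitrary: x)
    case (Cons i js)
    have "(iterated_partial js f has_derivative (\<lambda>_. 0)) (at x)"
      by (rule der[where k="if js = [] then c else 0"]) (use Cons in auto)
    then have "frechet_derivative (iterated_partial js f) (at x) = (\<lambda>_. 0)"
      by (rule frechet_derivative_at[symmetric])
    then show ?case by (simp add: partial_derivative_def)
  qed (use f in simp)
  show "iterated_partial js f x = (if js = [] then c else 0)" by (rule val[OF x])
  show "iterated_partial js f differentiable (at x)"
    using der[of "iterated_partial js f", OF val x] unfolding differentiable_def by blast
qed

lemma constant_smooth_neumann:
  fixes \<Omega> :: "(real ^ 'n::finite) set"
  assumes \<Omega>: "open \<Omega>" and f: "\<And>x. x \<in> closure \<Omega> \<Longrightarrow> f x = c"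
  shows "smooth_up_to_boundary \<Omega> f" "neumann_condition \<Omega> f" "\<And>x. x \<in> \<Omega> \<Longrightarrow> laplacian f x = 0"
proof -
  have f': "\<And>x. x \<in> \<Omega> \<Longrightarrow> f x = c" using f closure_subset by blast
  note it = iterated_partial_of_constant[OF \<Omega> f']
  have "continuous_on (closure \<Omega>) f \<longleftrightarrow> continuous_on (closure \<Omega>) (\<lambda>_. c)"
    by (rule continuous_on_cong) (use f in auto)
  then have c: "continuous_on (closure \<Omega>) f" by simp
  show "smooth_up_to_boundary \<Omega> f"
    unfolding smooth_up_to_boundary_def smooth_on_def
  proof (intro conjI allI ballI c it(2))
    fix js :: "'n list"
    show "\<exists>g. continuous_on (closure \<Omega>) g \<and> (\<forall>x\<in>\<Omega>. g x = iterated_partial js f x)"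
      by (rule exI[of _ "\<lambda>_. if js = [] then c else 0"]) (use it(1) in auto)
  qed
  show "laplacian f x = 0" if "x \<in> \<Omega>" for x
    using it(1)[OF _ that] by (simp add: laplacian_def del: iterated_partial.simps)
  show "neumann_condition \<Omega> f"
    unfolding neumann_condition_def has_normal_derivative_def
  proof (intro ballI allI impI)
    fix x \<nu>
    have "partial_derivative j f y = 0" if "y \<in> \<Omega>" for j y
      using it(1)[OF _ that, where js="[j]"] by simp
    then have "\<forall>\<^sub>F y in at x within \<Omega>. 0 = gradient f y \<bullet> \<nu>"
      by (auto simp: eventually_at_filter inner_vec_def)
    then show "((\<lambda>y. gradient f y \<bullet> \<nu>) \<longlongrightarrow> 0) (at x within \<Omega>)"
      by (rule Lim_transform_eventually[OF tendsto_const])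
  qed
qed

lemma positive_smooth_solution_constant_iff:
  fixes \<Omega> :: "(real ^ 'n::finite) set"
  assumes \<Omega>: "open \<Omega>" "\<Omega> \<noteq> {}" and uv: "\<And>x. x \<in> closure \<Omega> \<Longrightarrow> u x = a \<and> v x = b"
  shows "positive_smooth_solution \<Omega> p q r s \<sigma> d\<^sub>1 d\<^sub>2 u v \<longleftrightarrow>
     a > 0 \<and> b > 0 \<and> - a + a powr p / b powr q + \<sigma> = 0 \<and> - b + a powr r / b powr s = 0"
proof -
  have u: "\<And>x. x \<in> closure \<Omega> \<Longrightarrow> u x = a" and v: "\<And>x. x \<in> closure \<Omega> \<Longrightarrow> v x = b" using uv by auto
  note cu = constant_smooth_neumann[OF \<Omega>(1) u] and cv = constant_smooth_neumann[OF \<Omega>(1) v]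
  have sub: "\<And>x. x \<in> \<Omega> \<Longrightarrow> x \<in> closure \<Omega>" using closure_subset by blast
  obtain z where "z \<in> \<Omega>" using \<Omega> by auto
  then show ?thesis
    unfolding positive_smooth_solution_def using cu cv u v sub by auto
qed

lemma constant_positive_solution_eq:
  fixes \<Omega> :: "(real ^ 'n::finite) set"
  assumes \<Omega>: "open \<Omega>" "\<Omega> \<noteq> {}"
    and eq: "\<exists>!(a, b). a > 0 \<and> b > 0 \<and> - a + a powr p / b powr q + \<sigma> = 0 \<and> - b + a powr r / b powr s = 0"
  shows "constant_positive_solution \<Omega> p q r s \<sigma> = (a, b) \<longleftrightarrow>
     a > 0 \<and> b > 0 \<and> - a + a powr p / b powr q + \<sigma> = 0 \<and> - b + a powr r / b powr s = 0"
proof -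
  define Q where "Q = (\<lambda>(a, b). a > 0 \<and> b > 0 \<and> - a + a powr p / b powr q + \<sigma> = 0 \<and> - b + a powr r / b powr s = 0)"
  have "(\<forall>d\<^sub>1>0. \<forall>d\<^sub>2>0. positive_smooth_solution \<Omega> p q r s \<sigma> d\<^sub>1 d\<^sub>2 (\<lambda>_. a) (\<lambda>_. b)) \<longleftrightarrow> Q (a, b)" for a b
    using positive_smooth_solution_constant_iff[OF \<Omega>, of "\<lambda>_. a" a "\<lambda>_. b" b]
    by (auto simp: Q_def intro: exI[of _ "1::real"])
  then have "constant_positive_solution \<Omega> p q r s \<sigma> = (THE z. Q z)"
    unfolding constant_positive_solution_def by (intro arg_cong[where f=The]) (auto simp: fun_eq_iff)
  moreover have "\<exists>!z. Q z" using eq by (simp add: Q_def)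
  ultimately have "constant_positive_solution \<Omega> p q r s \<sigma> = (a, b) \<longleftrightarrow> Q (a, b)"
    by (metis theI' the1_equality)
  then show ?thesis by (simp add: Q_def)
qed

text \<open>The interval \<open>[A,B]\<close> enlarges the a priori range \<open>[\<alpha>,\<beta>]\<close> so that it also contains the equilibrium value
  \<open>a powr (r / (s + 1))\<close> of the inhibitor for every \<open>a\<close> in \<open>[\<alpha>,\<beta>]\<close>.\<close>

theorem theorem6p1:
  fixes \<Omega> :: "(real ^ 'n::finite) set"
    and p q r s \<sigma> :: real
    and D :: "(real \<times> real) set"
  assumes "bounded_smooth_domain \<Omega>"
    and "\<sigma> \<ge> 0"
    and "p \<ge> 0" and "q \<ge> 0" and "r \<ge> 0" and "s \<ge> 0"
    and "0 < (p - 1) / r" and "(p - 1) / r < q / (s + 1)"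
    and "D \<subseteq> {0<..} \<times> {0<..}" and "D \<noteq> {}"
    and "\<exists>\<alpha> \<beta>. 0 < \<alpha> \<and> \<alpha> \<le> \<beta> \<and>
           (\<forall>(d\<^sub>1, d\<^sub>2)\<in>D. \<forall>u v. positive_smooth_solution \<Omega> p q r s \<sigma> d\<^sub>1 d\<^sub>2 u v \<longrightarrow>
              (\<forall>x\<in>closure \<Omega>. \<alpha> \<le> u x \<and> u x \<le> \<beta> \<and> \<alpha> \<le> v x \<and> v x \<le> \<beta>))"
  shows "\<exists>C>0. \<forall>(d\<^sub>1, d\<^sub>2)\<in>D. d\<^sub>1 \<ge> C \<longrightarrow>
           (\<forall>u v. positive_smooth_solution \<Omega> p q r s \<sigma> d\<^sub>1 d\<^sub>2 u v \<longleftrightarrow>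
              (\<forall>x\<in>closure \<Omega>. (u x, v x) = constant_positive_solution \<Omega> p q r s \<sigma>))"
proof -
  have op: "open \<Omega>" and ne: "\<Omega> \<noteq> {}" using assms(1) by (auto simp: bounded_smooth_domain_def)
  have sub: "\<Omega> \<subseteq> closure \<Omega>" by (rule closure_subset)
  note eq = unique_constant_equilibrium[OF assms(2,5,6,7,8)]
  note cps = constant_positive_solution_eq[OF op ne eq]
  from assms(11) obtain \<alpha> \<beta> where \<alpha>: "0 < \<alpha>" "\<alpha> \<le> \<beta>"
    and bounds: "\<And>d\<^sub>1 d\<^sub>2 u v x. (d\<^sub>1, d\<^sub>2) \<in> D \<Longrightarrow> positive_smooth_solution \<Omega> p q r s \<sigma> d\<^sub>1 d\<^sub>2 u v \<Longrightarrow>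
       x \<in> closure \<Omega> \<Longrightarrow> \<alpha> \<le> u x \<and> u x \<le> \<beta> \<and> \<alpha> \<le> v x \<and> v x \<le> \<beta>"
    by fast
  define A where "A = min \<alpha> (\<alpha> powr (r / (s + 1)))"
  define B where "B = max \<beta> (\<beta> powr (r / (s + 1)))"
  have A: "A > 0" using \<alpha> by (simp add: A_def)
  define f where "f a b = - a + a powr p / b powr q + \<sigma>" for a b
  define g where "g a b = - b + a powr r / b powr s" for a b
  obtain L1 where L1: "L1 \<ge> 0" "\<And>a a' b b'. {a, a', b, b'} \<subseteq> {A..B} \<Longrightarrow>
      \<bar>f a b - f a' b'\<bar> \<le> L1 * (\<bar>a - a'\<bar> + \<bar>b - b'\<bar>)"
    using activator_kinetics_lipschitz[OF A] unfolding f_def by metis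
  obtain L2 where L2: "L2 \<ge> 0" "\<And>a a' b b'. {a, a', b, b'} \<subseteq> {A..B} \<Longrightarrow>
      (b - b') * (g a b - g a' b') \<le> L2 * (\<bar>a - a'\<bar> * \<bar>b - b'\<bar>) - (b - b')\<^sup>2"
    using inhibitor_kinetics_monotone[OF A assms(6)] unfolding g_def by metis
  have root: "\<exists>b\<in>{A..B}. g a b = 0" if a: "a \<in> {\<alpha>..\<beta>}" for a
  proof (rule bexI[of _ "a powr (r / (s + 1))"])
    show "g a (a powr (r / (s + 1))) = 0"
      unfolding g_def using a \<alpha> assms(6) by (subst inhibitor_equilibrium_iff) auto
    have "\<alpha> powr (r / (s + 1)) \<le> a powr (r / (s + 1))" "a powr (r / (s + 1)) \<le> \<beta> powr (r / (s + 1))"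
      using a \<alpha> assms(5,6) by (auto intro!: powr_mono2)
    then show "a powr (r / (s + 1)) \<in> {A..B}" by (auto simp: A_def B_def)
  qed
  have incl: "{\<alpha>..\<beta>} \<subseteq> {A..B}" by (auto simp: A_def B_def)
  obtain C where C: "C > 0" and const: "\<And>d\<^sub>1 d\<^sub>2 u v. d\<^sub>1 \<ge> C \<and> d\<^sub>2 > 0 \<and>
      smooth_up_to_boundary \<Omega> u \<and> smooth_up_to_boundary \<Omega> v \<and> neumann_condition \<Omega> u \<and> neumann_condition \<Omega> v \<and>
      (\<forall>x\<in>\<Omega>. u x \<in> {\<alpha>..\<beta>} \<and> v x \<in> {\<alpha>..\<beta>} \<and>
        d\<^sub>1 * laplacian u x + f (u x) (v x) = 0 \<and> d\<^sub>2 * laplacian v x + g (u x) (v x) = 0)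
      \<Longrightarrow> \<exists>a b. \<forall>x\<in>\<Omega>. u x = a \<and> v x = b"
  proof -
    have "\<bar>f a b - f a' b'\<bar> \<le> max L1 L2 * (\<bar>a - a'\<bar> + \<bar>b - b'\<bar>)" if "{a, a', b, b'} \<subseteq> {A..B}" for a a' b b'
      using L1(2)[OF that] by (rule order_trans) (intro mult_right_mono; simp)
    moreover have "(b - b') * (g a b - g a' b') \<le> max L1 L2 * (\<bar>a - a'\<bar> * \<bar>b - b'\<bar>) - (b - b')\<^sup>2"
      if "{a, a', b, b'} \<subseteq> {A..B}" for a a' b b'
      using L2(2)[OF that] by (rule order_trans) (intro diff_right_mono mult_right_mono; simp)
    moreover have "max L1 L2 \<ge> 0" using L1(1) by simp
    ultimately show thesis
      using large_diffusion_forces_constants[where f=f and g=g and L="max L1 L2" and I="{A..B}",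
          OF assms(1) _ _ _ incl root] that by blast
  qed
  have "positive_smooth_solution \<Omega> p q r s \<sigma> d\<^sub>1 d\<^sub>2 u v \<longleftrightarrow>
      (\<forall>x\<in>closure \<Omega>. (u x, v x) = constant_positive_solution \<Omega> p q r s \<sigma>)"
    if d: "(d\<^sub>1, d\<^sub>2) \<in> D" "d\<^sub>1 \<ge> C" for d\<^sub>1 d\<^sub>2 u v
  proof
    assume sol: "positive_smooth_solution \<Omega> p q r s \<sigma> d\<^sub>1 d\<^sub>2 u v"
    have "d\<^sub>2 > 0" using d(1) assms(9) by auto
    moreover have "u x \<in> {\<alpha>..\<beta>} \<and> v x \<in> {\<alpha>..\<beta>}" if "x \<in> \<Omega>" for x
      using bounds[OF d(1) sol, of x] that sub by auto
    moreover have "d\<^sub>1 * laplacian u x + f (u x) (v x) = 0 \<and> d\<^sub>2 * laplacian v x + g (u x) (v x) = 0"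
      if "x \<in> \<Omega>" for x
      using sol that by (auto simp: positive_smooth_solution_def f_def g_def)
    ultimately obtain a b where ab: "\<And>x. x \<in> \<Omega> \<Longrightarrow> u x = a \<and> v x = b"
      using const[of d\<^sub>1 d\<^sub>2 u v] sol d(2) by (auto simp: positive_smooth_solution_def)
    have "continuous_on (closure \<Omega>) u" "continuous_on (closure \<Omega>) v"
      using sol by (auto simp: positive_smooth_solution_def smooth_up_to_boundary_def)
    then have ab': "u x = a \<and> v x = b" if "x \<in> closure \<Omega>" for x
      using ab that continuous_constant_on_closure[of \<Omega> u a x] continuous_constant_on_closure[of \<Omega> v b x] by blast
    have "constant_positive_solution \<Omega> p q r s \<sigma> = (a, b)"
      by (rule iffD2[OF cps iffD1[OF positive_smooth_solution_constant_iff[OF op ne ab'] sol]])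
    then show "\<forall>x\<in>closure \<Omega>. (u x, v x) = constant_positive_solution \<Omega> p q r s \<sigma>" using ab' by simp
  next
    assume *: "\<forall>x\<in>closure \<Omega>. (u x, v x) = constant_positive_solution \<Omega> p q r s \<sigma>"
    obtain a b where ab: "constant_positive_solution \<Omega> p q r s \<sigma> = (a, b)" by (cases "constant_positive_solution \<Omega> p q r s \<sigma>")
    then have ab': "u x = a \<and> v x = b" if "x \<in> closure \<Omega>" for x using * that by auto
    show "positive_smooth_solution \<Omega> p q r s \<sigma> d\<^sub>1 d\<^sub>2 u v"
      by (rule iffD2[OF positive_smooth_solution_constant_iff[OF op ne ab'] iffD1[OF cps ab]])
  qed
  then show ?thesis using C by (intro exI[of _ C]) auto
qed

end
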